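(* Assume: (i) $\mathbb{Z}=\mathbb{X}\times\mathbb{A}\subseteq\mathbb{R}^{d_{\mathbb{X}}+d_{\mathbb{A}}}$ is compact. (ii) There exist $\ell_P\ge0$ and $\bar q\in[0,1]$ such that $d_{\mathrm{TV}}(P(\cdot\mid x,a),P(\cdot\mid x,b))\le\ell_P|a-b|^{\bar q}$ for all $x\in\mathbb{X}$, $a,b\in\mathbb{A}$. (iii) For some $z_0\in\mathbb{Z}$, $E[|r(z_0,W)|^k]<\infty$ for all integers $k\ge2$. (iv) There exist $\alpha_r\in(0,1]$ and a measurable $L_r:\mathbb{W}\to\mathbb{R}_+$ with $E[L_r(W)^k]<\infty$ for all integers $k\ge2$ such that $|r(z,w)-r(z',w)|\le L_r(w)|z-z'|^{\alpha_r}$ for all $z,z'\in\mathbb{Z}$, $w\in\mathbb{W}$. (v) There exists $\ell_f\ge0$ such that $|f(z,w)-f(z',w)|\le\ell_f|z-z'|$ for all $z,z'\in\mathbb{Z}$, $w\in\mathbb{W}$. Then: (a) For every $\alpha\in(0,\alpha_r]$ with $\gamma\ell_f^\alpha<1$, both $Q^*$ and $\widehat Q_n(\omega,\cdot)$ (for every $n\ge1$, $\omega\in\Omega$) are $\alpha$-Hölder continuous on $\mathbb{Z}$. Consequently: $\bar r$, $V^*$, $Q^*$ are bounded and measurable; for each $x\in\mathbb{X}$, $a\mapsto Q^*(x,a)$ is continuous on $\mathbb{A}$ and $V^*(x)=\max_{a\in\mathbb{A}}Q^*(x,a)$; and for each $n\ge1$ and $P$-a.e. $\omega$, $\widehat Q_n(\omega,\cdot)$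 is measurable and $a\mapsto\widehat Q_n(\omega,x,a)$ is continuous on $\mathbb{A}$ for each $x\in\mathbb{X}$. (b) Let $\alpha^*:=\sup\{\alpha\in[0,\alpha_r]:\gamma\ell_f^\alpha<1\}$. For every $q\in[0,\bar q]$ with $q<\alpha^*$, there exist measurable random variables $\delta_n,\Lambda_n(q)>0$ $(n\ge1)$, a constant $C_\delta<\infty$ and, for each integer $k\ge2$, a constant $C_{\Lambda,k}<\infty$ such that for every $n\ge1$, almost surely, $$\sup_{z\in\mathbb{Z}}|\widehat Q_n(z)-Q^*(z)|\le\delta_n,\qquad\sup_{x\in\mathbb{X}}\sup_{a\ne b}\frac{\left|\left(\widehat Q_n(x,a)-Q^*(x,a)\right)-\left(\widehat Q_n(x,b)-Q^*(x,b)\right)\right|}{|a-b|^q}\le\Lambda_n(q),$$ and $E[\delta_n^2]\le C_\delta/n$, $E[\Lambda_n(q)^k]\le C_{\Lambda,k}\,n^{-k/2}$ for all $n\ge1$ and all integers $k\ge2$.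
   Context: Control problem. $\mathbb{X}\subset\mathbb{R}^{d_{\mathbb{X}}}$ (states), $\mathbb{A}\subset\mathbb{R}^{d_{\mathbb{A}}}$ (actions; nonempty, compact, convex), $\mathbb{W}\subset\mathbb{R}^{d_{\mathbb{W}}}$ (noise) carry their Borel $\sigma$-fields; $\mathbb{Z}:=\mathbb{X}\times\mathbb{A}$; $|\cdot|$ is the Euclidean norm; $\gamma\in(0,1)$ is a discount factor. $f:\mathbb{X}\times\mathbb{A}\times\mathbb{W}\to\mathbb{X}$ and $r:\mathbb{X}\times\mathbb{A}\times\mathbb{W}\to\mathbb{R}$ are measurable, $\psi$ is a probability measure on $\mathbb{W}$ and $\bar r(z):=\int r(z,w)\,\psi(dw)$. The transition kernel is $P(B\mid z):=\psi(\{w:f(z,w)\in B\})$ (distinguished by context from the probability $P$ on $\Omega$); $d_{\mathrm{TV}}$ is total variation distance. Policies are sequences $\pi=(\pi_t)_{t\ge0}$ of measurable maps $\pi_t:\mathbb{X}^{t+1}\to\mathbb{A}$ (class $\Pi_{\mathrm{HD}}$). With noise $\xi_1,\xi_2,\dots$ i.i.d. $\sim\psi$ and $X_0^\pi=x$: $A_t^\pi:=\pi_t(X_t^\pi,\dots,X_0^\pi)$, $X_{t+1}^\pi:=f(X_t^\pi,A_t^\pi,\xi_{t+1})$, and $V^\pi(x):=\mathbb{E}_x[\sum_{t\ge0}\gamma^tr(X_t^\pi,A_t^\pi,\xi_{t+1})]=\mathbb{E}_x[\sum_{t\ge0}\gamma^t\bar r(X_t^\pi,A_t^\pi)]$. Further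 $V^*(x):=\sup_{\pi\in\Pi_{\mathrm{HD}}}V^\pi(x)$ and $Q^*(z):=\bar r(z)+\gamma\int V^*(x')\,P(dx'\mid z)$. Split-sample estimator. On a probability space $(\Omega,\mathcal{F},P)$ (expectation $E$), $W_1^V,\dots,W_n^V,W_1^Q,\dots,W_n^Q$ are i.i.d. with law $\psi$, and $W\sim\psi$ is independent of them. For $U\in\{V,Q\}$, $E_n^U\phi(W):=\frac1n\sum_{i=1}^n\phi(W_i^U)$. $\widehat V_n$ (for each $\omega$) is the unique bounded solution of $$\widehat V_n(x)=\sup_{a\in\mathbb{A}}E_n^V\left[r(x,a,W)+\gamma\widehat V_n(f(x,a,W))\right],\quad x\in\mathbb{X},$$ and $\widehat Q_n(z):=E_n^Q[r(z,W)+\gamma\widehat V_n(f(z,W))]$, $z\in\mathbb{Z}$. A function $g$ on $\mathbb{Z}$ is $\alpha$-Hölder continuous if $\sup_{u\ne u'}|g(u)-g(u')|/|u-u'|^\alpha<\infty$. *)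

theory Defs
  imports "HOL-Probability.Probability"
begin

text \<open>
  The state, action and noise spaces are subsets \<open>XX\<close>, \<open>AA\<close>, \<open>WW\<close> of Euclidean spaces, with their
  trace Borel \<open>\<sigma>\<close>-algebras; the norm of a product type is the Euclidean norm.
  Dynamics and rewards are written \<open>f z w\<close> and \<open>r z w\<close> with \<open>z = (x, a)\<close>.
\<close>

locale control_problem =
  fixes XX :: "'x::euclidean_space set"
    and AA :: "'a::euclidean_space set"
    and WW :: "'w::euclidean_space set"
    and f :: "'x \<times> 'a \<Rightarrow> 'w \<Rightarrow> 'x"
    and r :: "'x \<times> 'a \<Rightarrow> 'w \<Rightarrow> real"
    and \<psi> :: "'w measure"
    and \<gamma> :: real
  assumes AA_nonempty: "AA \<noteq> {}"
    and AA_compact: "compact AA"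
    and AA_convex: "convex AA"
    and discount: "0 < \<gamma>" "\<gamma> < 1"
    and prob_noise: "prob_space \<psi>"
    and sets_noise: "sets \<psi> = sets (restrict_space borel WW)"
    and measurable_dynamics:
      "(\<lambda>(z, w). f z w) \<in>
        restrict_space borel (XX \<times> AA) \<Otimes>\<^sub>M restrict_space borel WW \<rightarrow>\<^sub>M restrict_space borel XX"
    and measurable_reward:
      "(\<lambda>(z, w). r z w) \<in>
        borel_measurable (restrict_space borel (XX \<times> AA) \<Otimes>\<^sub>M restrict_space borel WW)"

definition mean_reward ::
  "('z \<Rightarrow> 'w \<Rightarrow> real) \<Rightarrow> 'w measure \<Rightarrow> 'z \<Rightarrow> real"
where
  "mean_reward r \<psi> z = (\<integral>w. r z w \<partial>\<psi>)"

definition trans_kernel ::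
  "'x::euclidean_space set \<Rightarrow> ('z \<Rightarrow> 'w \<Rightarrow> 'x) \<Rightarrow> 'w measure \<Rightarrow> 'z \<Rightarrow> 'x measure"
where
  "trans_kernel XX f \<psi> z = distr \<psi> (restrict_space borel XX) (f z)"

definition tv_dist :: "'b measure \<Rightarrow> 'b measure \<Rightarrow> real" where
  "tv_dist \<mu> \<nu> = (SUP B\<in>sets \<mu>. \<bar>measure \<mu> B - measure \<nu> B\<bar>)"

definition policies ::
  "'x::euclidean_space set \<Rightarrow> 'a::euclidean_space set \<Rightarrow> (nat \<Rightarrow> (nat \<Rightarrow> 'x) \<Rightarrow> 'a) set"
where
  "policies XX AA =
    {\<pi>. \<forall>t. \<pi> t \<in> (\<Pi>\<^sub>M s\<in>{..t}. restrict_space borel XX) \<rightarrow>\<^sub>M restrict_space borel AA}"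

text \<open>
  \<open>history f \<pi> x \<xi> t\<close> is \<open>s \<mapsto> X\<^sub>s\<close> for \<open>s \<le> t\<close> and \<open>undefined\<close> elsewhere, so that it lies in the space
  of the product over \<open>{..t}\<close>. The noise driving the step from \<open>t\<close> to \<open>t + 1\<close> is \<open>\<xi> t\<close>.
\<close>

primrec history ::
  "('x \<times> 'a \<Rightarrow> 'w \<Rightarrow> 'x) \<Rightarrow> (nat \<Rightarrow> (nat \<Rightarrow> 'x) \<Rightarrow> 'a) \<Rightarrow> 'x \<Rightarrow> (nat \<Rightarrow> 'w) \<Rightarrow> nat \<Rightarrow> nat \<Rightarrow> 'x"
where
  "history f \<pi> x \<xi> 0 = (\<lambda>_. undefined)(0 := x)"
| "history f \<pi> x \<xi> (Suc t) =
    (history f \<pi> x \<xi> t)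
      (Suc t := f (history f \<pi> x \<xi> t t, \<pi> t (history f \<pi> x \<xi> t)) (\<xi> t))"

definition state ::
  "('x \<times> 'a \<Rightarrow> 'w \<Rightarrow> 'x) \<Rightarrow> (nat \<Rightarrow> (nat \<Rightarrow> 'x) \<Rightarrow> 'a) \<Rightarrow> 'x \<Rightarrow> (nat \<Rightarrow> 'w) \<Rightarrow> nat \<Rightarrow> 'x"
where
  "state f \<pi> x \<xi> t = history f \<pi> x \<xi> t t"

definition action ::
  "('x \<times> 'a \<Rightarrow> 'w \<Rightarrow> 'x) \<Rightarrow> (nat \<Rightarrow> (nat \<Rightarrow> 'x) \<Rightarrow> 'a) \<Rightarrow> 'x \<Rightarrow> (nat \<Rightarrow> 'w) \<Rightarrow> nat \<Rightarrow> 'a"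
where
  "action f \<pi> x \<xi> t = \<pi> t (history f \<pi> x \<xi> t)"

text \<open>The i.i.d. noise sequence is realised as the coordinate process on the infinite product space.\<close>

definition policy_value ::
  "('x \<times> 'a \<Rightarrow> 'w \<Rightarrow> 'x) \<Rightarrow> ('x \<times> 'a \<Rightarrow> 'w \<Rightarrow> real) \<Rightarrow> 'w measure \<Rightarrow> real \<Rightarrow>
    (nat \<Rightarrow> (nat \<Rightarrow> 'x) \<Rightarrow> 'a) \<Rightarrow> 'x \<Rightarrow> real"
where
  "policy_value f r \<psi> \<gamma> \<pi> x =
    (\<integral>\<xi>. (\<Sum>t. \<gamma> ^ t * r (state f \<pi> x \<xi> t, action f \<pi> x \<xi> t) (\<xi> t))
      \<partial>(\<Pi>\<^sub>M t\<in>(UNIV :: nat set). \<psi>))"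

definition opt_value ::
  "'x::euclidean_space set \<Rightarrow> 'a::euclidean_space set \<Rightarrow> ('x \<times> 'a \<Rightarrow> 'w \<Rightarrow> 'x) \<Rightarrow>
    ('x \<times> 'a \<Rightarrow> 'w \<Rightarrow> real) \<Rightarrow> 'w measure \<Rightarrow> real \<Rightarrow> 'x \<Rightarrow> real"
where
  "opt_value XX AA f r \<psi> \<gamma> x = (SUP \<pi>\<in>policies XX AA. policy_value f r \<psi> \<gamma> \<pi> x)"

definition opt_q ::
  "'x::euclidean_space set \<Rightarrow> 'a::euclidean_space set \<Rightarrow> ('x \<times> 'a \<Rightarrow> 'w \<Rightarrow> 'x) \<Rightarrow>
    ('x \<times> 'a \<Rightarrow> 'w \<Rightarrow> real) \<Rightarrow> 'w measure \<Rightarrow> real \<Rightarrow> 'x \<times> 'a \<Rightarrow> real"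
where
  "opt_q XX AA f r \<psi> \<gamma> z =
    mean_reward r \<psi> z + \<gamma> * (\<integral>x'. opt_value XX AA f r \<psi> \<gamma> x' \<partial>trans_kernel XX f \<psi> z)"

datatype sample = VSample | QSample

text \<open>
  \<open>S U i\<close> is the \<open>(i + 1)\<close>-st observation of sample \<open>U\<close>, so the first \<open>n\<close> observations have indices
  \<open>i < n\<close>; \<open>W\<close> is a further copy of the noise, independent of all of them
  (index \<open>None\<close> in the joint independence assumption).
\<close>

locale split_sample = prob_space M for M :: "'o measure" +
  fixes \<psi> :: "'w measure"
    and S :: "sample \<Rightarrow> nat \<Rightarrow> 'o \<Rightarrow> 'w"
    and W :: "'o \<Rightarrow> 'w"
  assumes indep: "indep_vars (\<lambda>_. \<psi>) (case_option W (\<lambda>(U, i). S U i)) UNIV"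
    and distr_sample: "\<And>U i. distr M \<psi> (S U i) = \<psi>"
    and distr_copy: "distr M \<psi> W = \<psi>"

definition emp_mean :: "nat \<Rightarrow> (nat \<Rightarrow> 'w) \<Rightarrow> ('w \<Rightarrow> real) \<Rightarrow> real" where
  "emp_mean n w \<phi> = (1 / real n) * (\<Sum>i<n. \<phi> (w i))"

text \<open>Off \<open>XX\<close> the solution is pinned to \<open>undefined\<close>, so uniqueness on \<open>XX\<close> suffices for \<open>THE\<close>.\<close>

definition emp_value ::
  "'x set \<Rightarrow> 'a set \<Rightarrow> ('x \<times> 'a \<Rightarrow> 'w \<Rightarrow> 'x) \<Rightarrow> ('x \<times> 'a \<Rightarrow> 'w \<Rightarrow> real) \<Rightarrow> real \<Rightarrow>
    nat \<Rightarrow> (nat \<Rightarrow> 'w) \<Rightarrow> 'x \<Rightarrow> real"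
where
  "emp_value XX AA f r \<gamma> n w =
    (THE v. v \<in> extensional XX \<and> bounded (v ` XX) \<and>
      (\<forall>x\<in>XX. v x = (SUP a\<in>AA. emp_mean n w (\<lambda>y. r (x, a) y + \<gamma> * v (f (x, a) y)))))"

definition emp_q ::
  "'x set \<Rightarrow> 'a set \<Rightarrow> ('x \<times> 'a \<Rightarrow> 'w \<Rightarrow> 'x) \<Rightarrow> ('x \<times> 'a \<Rightarrow> 'w \<Rightarrow> real) \<Rightarrow> real \<Rightarrow>
    (sample \<Rightarrow> nat \<Rightarrow> 'o \<Rightarrow> 'w) \<Rightarrow> nat \<Rightarrow> 'o \<Rightarrow> 'x \<times> 'a \<Rightarrow> real"
where
  "emp_q XX AA f r \<gamma> S n \<omega> z =
    emp_mean n (\<lambda>i. S QSample i \<omega>)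
      (\<lambda>y. r z y + \<gamma> * emp_value XX AA f r \<gamma> n (\<lambda>i. S VSample i \<omega>) (f z y))"

definition holder_on :: "real \<Rightarrow> 'z::real_normed_vector set \<Rightarrow> ('z \<Rightarrow> real) \<Rightarrow> bool" where
  "holder_on \<alpha> Z g \<longleftrightarrow>
    bdd_above {\<bar>g u - g u'\<bar> / norm (u - u') powr \<alpha> | u u'. u \<in> Z \<and> u' \<in> Z \<and> u \<noteq> u'}"

end

theory Submission
  imports Defs "HOL-Real_Asymp.Real_Asymp"
begin

text \<open>
  The Bellman operators of the true and of the empirical problem are the same construction, applied to
  the noise law and to the uniform measure on the sample indices. Each preserves a class of Hoelder
  functions with a fixed constant \<open>H = E L / (1 - \<gamma> l\<^sup>\<alpha>)\<close>, so value iteration converges to a fixed point in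
  that class; telescoping the Bellman equation along a policy identifies the true one with \<open>V\<^sup>*\<close>.

  Write \<open>G z w = r z w + \<gamma> V\<^sup>* (f z w)\<close>. By contraction \<open>\<bar>V\<^sub>n - V\<^sup>*\<bar>\<close> is at most \<open>1 / (1 - \<gamma>)\<close> times the
  supremum over \<open>z\<close> of the centred empirical mean of \<open>G z\<close>. The increments of such a centred mean have
  moments of order \<open>2 m\<close> bounded by \<open>n\<^sup>-\<^sup>m \<bar>z - z'\<bar>\<^sup>2\<^sup>m\<^sup>\<alpha>\<close>, so Kolmogorov's chaining argument over nets of the
  compact set \<open>Z\<close> bounds the moments of its \<open>q\<close>-Hoelder seminorm for every \<open>q < \<alpha>\<close>, once \<open>m\<close> is large.

  The error \<open>Q\<^sub>n - Q\<^sup>*\<close> is the centred \<open>Q\<close>-sample mean of \<open>r + \<gamma> V\<^sub>n(f)\<close> plus \<open>\<gamma> E (V\<^sub>n - V\<^sup>*)(f)\<close>. The first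
  term is treated by chaining conditionally on the independent \<open>V\<close>-sample, given which \<open>V\<^sub>n\<close> is a fixed
  Hoelder function; the oscillation of the second in the action is controlled by total variation.
\<close>

section \<open>Fixed points of the dynamic programming operator\<close>

text \<open>Two features of the estimator shape the proof. It is defined through \<open>THE\<close>
  and through suprema over an uncountable action set, whereas integrating out one sample after the
  other needs joint measurability. The Bellman operator therefore carries its action set as a
  parameter: value iteration is run over a countable dense set of actions, and density together with
  uniqueness of the bounded solution identifies its limit with the estimator.

  The Hoelder constant of the estimated value function is itself random. It is linear in the sample
  mean of the Hoelder modulus of the reward, and that modulus is only known to have moments.
  Chaining must thus display this constant as an explicit factor, whose power is then integrated
  over the V-sample by Jensen's inequality.

  For the difference of the two value functions only a supremum norm rate is obtained, none for its
  increments, and the total variation hypothesis fills this gap. The final exponent q may be 0 while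
  chaining wants a positive exponent below \<alpha>, so chaining is run at an intermediate
  one.\<close>

lemma abs_SUP_diff_le:
  fixes f g :: "'i \<Rightarrow> real"
  assumes "I \<noteq> {}" "bdd_above (f ` I)" "bdd_above (g ` I)" "\<And>i. i \<in> I \<Longrightarrow> \<bar>f i - g i\<bar> \<le> d"
  shows "\<bar>(SUP i\<in>I. f i) - (SUP i\<in>I. g i)\<bar> \<le> d"
proof -
  have "f i \<le> (SUP i\<in>I. g i) + d" if "i \<in> I" for i
    using cSUP_upper[OF that assms(3)] assms(4)[OF that] by linarith
  then have "(SUP i\<in>I. f i) \<le> (SUP i\<in>I. g i) + d" by (rule cSUP_least[OF assms(1)])
  moreover have "g i \<le> (SUP i\<in>I. f i) + d" if "i \<in> I" for i
    using cSUP_upper[OF that assms(2)] assms(4)[OF that] by linarith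
  then have "(SUP i\<in>I. g i) \<le> (SUP i\<in>I. f i) + d" by (rule cSUP_least[OF assms(1)])
  ultimately show ?thesis by linarith
qed

text \<open>Lets a supremum over all actions be replaced by one over a countable dense set, which
  preserves measurability.\<close>

lemma SUP_dense_eq:
  fixes g :: "'b::topological_space \<Rightarrow> real"
  assumes "continuous_on A g" "A0 \<subseteq> A" "A \<subseteq> closure A0" "A0 \<noteq> {}" "bdd_above (g ` A)"
  shows "(SUP a\<in>A0. g a) = (SUP a\<in>A. g a)"
proof (rule antisym)
  have bdd0: "bdd_above (g ` A0)"
    by (rule bdd_above_mono[OF assms(5)]) (use assms(2) in auto)
  show "(SUP a\<in>A0. g a) \<le> (SUP a\<in>A. g a)"
    by (rule cSUP_subset_mono) (use assms in auto)
  have "g a \<le> (SUP a\<in>A0. g a)" if "a \<in> A" for a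
  proof (rule ccontr)
    assume "\<not> ?thesis"
    moreover obtain U where U: "open U" "U \<inter> A = g -` {(SUP a\<in>A0. g a)<..} \<inter> A"
      using assms(1)[unfolded continuous_on_open_invariant, rule_format, OF open_greaterThan] by blast
    ultimately have "a \<in> U" using that by auto
    with U(1) assms(3) that obtain b where "b \<in> U" "b \<in> A0"
      by (meson closure_iff_nhds_not_empty disjoint_iff subsetD subset_refl)
    with U(2) assms(2) have "g b > (SUP a\<in>A0. g a)" by auto
    with cSUP_upper[OF \<open>b \<in> A0\<close> bdd0] show False by linarith
  qed
  then show "(SUP a\<in>A. g a) \<le> (SUP a\<in>A0. g a)"
    by (intro cSUP_least) (use assms in auto)
qed

lemma abs_integral_le:
  fixes g h :: "'b \<Rightarrow> real"
  assumes "integrable M g" "integrable M h" "\<And>x. x \<in> space M \<Longrightarrow> \<bar>g x\<bar> \<le> h x"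
  shows "\<bar>\<integral>x. g x \<partial>M\<bar> \<le> (\<integral>x. h x \<partial>M)"
  by (rule order_trans[OF integral_norm_bound[of M g, unfolded real_norm_def] integral_mono])
    (use assms in auto)

abbreviation (input) borel_on :: "'b::topological_space set \<Rightarrow> 'b measure" where
  "borel_on S \<equiv> restrict_space borel S"

text \<open>Unlike \<open>holder_on\<close> this names the constant: one and the same constant has
  to survive all Bellman iterations, and for the estimator it is a random quantity.\<close>

definition holder_bound :: "real \<Rightarrow> real \<Rightarrow> 'b::real_normed_vector set \<Rightarrow> ('b \<Rightarrow> real) \<Rightarrow> bool" where
  "holder_bound \<alpha> c S v \<longleftrightarrow> (\<forall>x\<in>S. \<forall>y\<in>S. \<bar>v x - v y\<bar> \<le> c * norm (x - y) powr \<alpha>)"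

lemma holder_boundD:
  "holder_bound \<alpha> c S v \<Longrightarrow> x \<in> S \<Longrightarrow> y \<in> S \<Longrightarrow> \<bar>v x - v y\<bar> \<le> c * norm (x - y) powr \<alpha>"
  by (auto simp: holder_bound_def)

lemma holder_bound_imp_continuous_on:
  assumes "holder_bound \<alpha> c S v" "0 < \<alpha>"
  shows "continuous_on S v"
  unfolding continuous_on_def
proof
  fix x assume x: "x \<in> S"
  have "((\<lambda>y. c * norm (y - x) powr \<alpha>) \<longlongrightarrow> c * norm (x - x) powr \<alpha>) (at x within S)"
    by (intro tendsto_intros tendsto_powr2) (use assms(2) in \<open>auto intro: always_eventually\<close>)
  then have "((\<lambda>y. c * norm (y - x) powr \<alpha>) \<longlongrightarrow> 0) (at x within S)" by simp
  then have "((\<lambda>y. v y - v x) \<longlongrightarrow> 0) (at x within S)"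
    by (rule Lim_null_comparison[rotated])
      (use holder_boundD[OF assms(1) _ x] in \<open>auto simp: eventually_at_filter\<close>)
  then show "(v \<longlongrightarrow> v x) (at x within S)" by (rule LIM_zero_cancel)
qed

lemma holder_bound_imp_holder_on: "holder_bound \<alpha> c S v \<Longrightarrow> holder_on \<alpha> S v"
  unfolding holder_on_def
  by (intro bdd_aboveI[of _ c]) (auto simp: divide_le_eq dest: holder_boundD)

text \<open>Measurability is asked only in the noise, for each fixed \<open>z\<close>. Regularity in
  \<open>z\<close> comes from the Hoelder and Lipschitz bounds, so this setting also fits a finite
  index space as noise.\<close>

locale holder_mdp = prob_space N for N :: "'y measure" +
  fixes X :: "'x::euclidean_space set" and A :: "'a::euclidean_space set"
    and f :: "'x \<times> 'a \<Rightarrow> 'y \<Rightarrow> 'x" and r :: "'x \<times> 'a \<Rightarrow> 'y \<Rightarrow> real"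
    and \<gamma> \<alpha> \<l> :: real and L :: "'y \<Rightarrow> real"
  assumes compact_X: "compact X" and compact_A: "compact A"
    and X_nonempty: "X \<noteq> {}" and A_nonempty: "A \<noteq> {}"
    and discount: "0 < \<gamma>" "\<gamma> < 1"
    and exponent: "0 < \<alpha>" and \<l>_nonneg: "0 \<le> \<l>" and contraction: "\<gamma> * \<l> powr \<alpha> < 1"
    and measurable_f: "\<And>z. z \<in> X \<times> A \<Longrightarrow> f z \<in> N \<rightarrow>\<^sub>M borel_on X"
    and integrable_r: "\<And>z. z \<in> X \<times> A \<Longrightarrow> integrable N (r z)"
    and integrable_L: "integrable N L" and L_nonneg: "\<And>y. y \<in> space N \<Longrightarrow> 0 \<le> L y"
    and holder_r: "\<And>z z' y. z \<in> X \<times> A \<Longrightarrow> z' \<in> X \<times> A \<Longrightarrow> y \<in> space N \<Longrightarrow>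
      \<bar>r z y - r z' y\<bar> \<le> L y * norm (z - z') powr \<alpha>"
    and lipschitz_f: "\<And>z z' y. z \<in> X \<times> A \<Longrightarrow> z' \<in> X \<times> A \<Longrightarrow> y \<in> space N \<Longrightarrow>
      norm (f z y - f z' y) \<le> \<l> * norm (z - z')"
begin

abbreviation Z :: "('x \<times> 'a) set" where
  "Z \<equiv> X \<times> A"

definition qval :: "('x \<Rightarrow> real) \<Rightarrow> 'x \<times> 'a \<Rightarrow> real" where
  "qval v z = (\<integral>y. r z y + \<gamma> * v (f z y) \<partial>N)"

text \<open>The action set is an argument so that the same theory covers a countable dense subset of
  \<open>A\<close>.\<close>

definition bellman :: "'a set \<Rightarrow> ('x \<Rightarrow> real) \<Rightarrow> 'x \<Rightarrow> real" where
  "bellman A0 v x = (SUP a\<in>A0. qval v (x, a))"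

definition iter :: "'a set \<Rightarrow> nat \<Rightarrow> 'x \<Rightarrow> real" where
  "iter A0 k = (bellman A0 ^^ k) (\<lambda>_. 0)"

definition val :: "'x \<Rightarrow> real" where
  "val x = lim (\<lambda>k. iter A k x)"

definition hconst :: real where
  "hconst = (\<integral>y. L y \<partial>N) / (1 - \<gamma> * \<l> powr \<alpha>)"

lemma f_in: "z \<in> Z \<Longrightarrow> y \<in> space N \<Longrightarrow> f z y \<in> X"
  using measurable_space[OF measurable_f, of z y] by (simp add: space_restrict_space)

lemma hconst_nonneg: "0 \<le> hconst"
  unfolding hconst_def using contraction L_nonneg by (intro divide_nonneg_nonneg integral_nonneg_AE) auto

text \<open>By \<open>holder_qval\<close> a Hoelder constant \<open>c\<close> turns into
  \<open>E L + \<gamma> * c * \<l> powr \<alpha>\<close>. \<open>hconst\<close> is the fixed point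
  of this affine map, which is why the class it defines is invariant.\<close>

lemma hconst_eq: "(\<integral>y. L y \<partial>N) + \<gamma> * hconst * \<l> powr \<alpha> = hconst"
  using contraction by (simp add: hconst_def field_simps)

lemma integrable_comp_f:
  assumes z: "z \<in> Z" and v: "(\<lambda>y. v (f z y)) \<in> borel_measurable N" "bounded (v ` X)"
  shows "integrable N (\<lambda>y. v (f z y) :: real)"
proof -
  obtain B where "\<And>x. x \<in> X \<Longrightarrow> norm (v x) \<le> B"
    using v(2) by (auto simp: bounded_iff)
  then show ?thesis
    by (intro integrable_const_bound[of _ B] v AE_I2) (use f_in[OF z] in auto)
qed

lemma holder_comp_f:
  assumes z: "z \<in> Z" and v: "holder_bound \<alpha> c X v"
  shows "integrable N (\<lambda>y. v (f z y))"
proof (rule integrable_comp_f[OF z])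
  have c: "continuous_on X v" by (rule holder_bound_imp_continuous_on[OF v exponent])
  show "(\<lambda>y. v (f z y)) \<in> borel_measurable N"
    by (rule measurable_compose[OF measurable_f[OF z] borel_measurable_continuous_on_restrict[OF c]])
  show "bounded (v ` X)"
    by (rule compact_imp_bounded[OF compact_continuous_image[OF c compact_X]])
qed

text \<open>Composition with a Lipschitz map multiplies an \<alpha>-Hoelder constant by
  \<open>\<l> powr \<alpha>\<close>. This is the origin of the condition
  \<open>\<gamma> * \<l> powr \<alpha> < 1\<close>, which is weaker than
  \<open>\<gamma> * \<l> < 1\<close> when \<open>\<l> > 1\<close> and
  \<open>\<alpha> < 1\<close>.\<close>

lemma holder_integrand:
  assumes v: "holder_bound \<alpha> c X v" and "0 \<le> c"
    and z: "z \<in> Z" and z': "z' \<in> Z" and y: "y \<in> space N"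
  shows "\<bar>(r z y + \<gamma> * v (f z y)) - (r z' y + \<gamma> * v (f z' y))\<bar>
    \<le> (L y + \<gamma> * c * \<l> powr \<alpha>) * norm (z - z') powr \<alpha>"
proof -
  let ?n = "norm (z - z') powr \<alpha>"
  have "\<bar>v (f z y) - v (f z' y)\<bar> \<le> c * norm (f z y - f z' y) powr \<alpha>"
    using v f_in[OF z y] f_in[OF z' y] by (rule holder_boundD)
  also have "\<dots> \<le> c * (\<l> * norm (z - z')) powr \<alpha>"
    using lipschitz_f[OF z z' y] \<open>0 \<le> c\<close> exponent by (intro mult_left_mono powr_mono2) auto
  also have "\<dots> = c * \<l> powr \<alpha> * ?n" using \<l>_nonneg by (simp add: powr_mult)
  finally have "\<gamma> * \<bar>v (f z y) - v (f z' y)\<bar> \<le> \<gamma> * (c * \<l> powr \<alpha> * ?n)"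
    using discount by simp
  moreover have "\<bar>\<gamma> * v (f z y) - \<gamma> * v (f z' y)\<bar> = \<gamma> * \<bar>v (f z y) - v (f z' y)\<bar>"
    using discount by (simp add: abs_mult flip: right_diff_distrib)
  moreover have "(L y + \<gamma> * c * \<l> powr \<alpha>) * ?n = L y * ?n + \<gamma> * (c * \<l> powr \<alpha> * ?n)"
    by (simp add: algebra_simps)
  ultimately show ?thesis using holder_r[OF z z' y] by linarith
qed

lemma holder_qval:
  assumes v: "holder_bound \<alpha> c X v" and "0 \<le> c"
  shows "holder_bound \<alpha> ((\<integral>y. L y \<partial>N) + \<gamma> * c * \<l> powr \<alpha>) Z (qval v)"
  unfolding holder_bound_def
proof (intro ballI)
  fix z z' assume z: "z \<in> Z" and z': "z' \<in> Z"
  let ?n = "norm (z - z') powr \<alpha>"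
  note [simp] = integrable_r[OF z] integrable_r[OF z'] holder_comp_f[OF z v] holder_comp_f[OF z' v]
    integrable_L
  note pt = holder_integrand[OF v \<open>0 \<le> c\<close> z z']
  have "\<bar>qval v z - qval v z'\<bar> = \<bar>\<integral>y. (r z y + \<gamma> * v (f z y)) - (r z' y + \<gamma> * v (f z' y)) \<partial>N\<bar>"
    unfolding qval_def by (subst Bochner_Integration.integral_diff) auto
  also have "\<dots> \<le> (\<integral>y. (L y + \<gamma> * c * \<l> powr \<alpha>) * ?n \<partial>N)"
    by (rule abs_integral_le) (use pt in auto)
  also have "\<dots> = ((\<integral>y. L y \<partial>N) + \<gamma> * c * \<l> powr \<alpha>) * ?n"
    by (simp add: prob_space)
  finally show "\<bar>qval v z - qval v z'\<bar> \<le> \<dots>" .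
qed

lemma holder_qval': "holder_bound \<alpha> hconst X v \<Longrightarrow> holder_bound \<alpha> hconst Z (qval v)"
  using holder_qval[OF _ hconst_nonneg] by (simp add: hconst_eq)

lemma bdd_above_qval:
  assumes v: "holder_bound \<alpha> c X v" "0 \<le> c" and "x \<in> X" "A0 \<subseteq> A"
  shows "bdd_above ((\<lambda>a. qval v (x, a)) ` A0)"
proof -
  have "bounded (qval v ` Z)"
    by (intro compact_imp_bounded compact_continuous_image compact_Times compact_X compact_A
        holder_bound_imp_continuous_on[OF holder_qval[OF v] exponent])
  then have "bdd_above (qval v ` Z)" by (rule bounded_imp_bdd_above)
  then show ?thesis by (rule bdd_above_mono) (use assms in auto)
qed

lemma holder_bellman:
  assumes v: "holder_bound \<alpha> hconst X v" and A0: "A0 \<subseteq> A" "A0 \<noteq> {}"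
  shows "holder_bound \<alpha> hconst X (bellman A0 v)"
  unfolding holder_bound_def bellman_def
proof (intro ballI abs_SUP_diff_le A0 bdd_above_qval[OF v hconst_nonneg])
  fix x x' a assume "x \<in> X" "x' \<in> X" "a \<in> A0"
  then show "\<bar>qval v (x, a) - qval v (x', a)\<bar> \<le> hconst * norm (x - x') powr \<alpha>"
    using holder_boundD[OF holder_qval'[OF v], of "(x, a)" "(x', a)"] A0 by (auto simp: norm_Pair)
qed

lemma qval_diff_le:
  assumes z: "z \<in> Z" and u: "integrable N (\<lambda>y. u (f z y))" and v: "integrable N (\<lambda>y. v (f z y))"
    and d: "\<And>x. x \<in> X \<Longrightarrow> \<bar>u x - v x\<bar> \<le> d"
  shows "\<bar>qval u z - qval v z\<bar> \<le> \<gamma> * d"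
proof -
  have "\<bar>qval u z - qval v z\<bar> = \<bar>\<integral>y. \<gamma> * (u (f z y) - v (f z y)) \<partial>N\<bar>"
    unfolding qval_def using integrable_r[OF z] u v
    by (subst Bochner_Integration.integral_diff[symmetric]) (auto simp: algebra_simps)
  also have "\<dots> \<le> (\<integral>y. \<gamma> * d \<partial>N)"
    by (rule abs_integral_le)
      (use d f_in[OF z] u v discount in \<open>auto simp: abs_mult\<close>)
  finally show ?thesis by (simp add: prob_space)
qed

lemma iter_holder:
  assumes A0: "A0 \<subseteq> A" "A0 \<noteq> {}"
  shows "holder_bound \<alpha> hconst X (iter A0 k)"
proof (induction k)
  case 0
  show ?case using hconst_nonneg by (auto simp: iter_def holder_bound_def)
next
  case (Suc k)
  then show ?case using holder_bellman[OF Suc A0] by (simp add: iter_def)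
qed

lemma bellman_diff_le:
  assumes A0: "A0 \<subseteq> A" "A0 \<noteq> {}" and u: "holder_bound \<alpha> hconst X u" and v: "holder_bound \<alpha> hconst X v"
    and d: "\<And>x. x \<in> X \<Longrightarrow> \<bar>u x - v x\<bar> \<le> d" and x: "x \<in> X"
  shows "\<bar>bellman A0 u x - bellman A0 v x\<bar> \<le> \<gamma> * d"
  unfolding bellman_def
  by (intro abs_SUP_diff_le A0 bdd_above_qval[OF u hconst_nonneg] bdd_above_qval[OF v hconst_nonneg]
      qval_diff_le holder_comp_f[OF _ u] holder_comp_f[OF _ v] d x) (use A0 x in auto)

text \<open>Increments of the iteration decay like \<open>\<gamma> ^ k\<close>, so the Weierstrass
  test gives a uniform limit. The Hoelder bound is closed under pointwise limits, and uniform
  convergence passes through the operator because it is a \<gamma>-contraction in supremum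
  norm.\<close>

lemma ex_fixed_point:
  assumes A0: "A0 \<subseteq> A" "A0 \<noteq> {}"
  shows "\<exists>v. (\<forall>x\<in>X. (\<lambda>k. iter A0 k x) \<longlonglongrightarrow> v x) \<and> holder_bound \<alpha> hconst X v \<and>
    (\<forall>x\<in>X. v x = bellman A0 v x)"
proof -
  \<comment> \<open>The zeroth iterate is 0, so a bound on the first iterate bounds the first
    increment.\<close>
  have "bounded (iter A0 1 ` X)"
    by (intro compact_imp_bounded compact_continuous_image compact_X
        holder_bound_imp_continuous_on[OF iter_holder[OF A0] exponent])
  then obtain d where d: "\<And>x. x \<in> X \<Longrightarrow> \<bar>iter A0 1 x\<bar> \<le> d" by (auto simp: bounded_iff)
  have step: "\<bar>iter A0 (Suc k) x - iter A0 k x\<bar> \<le> \<gamma> ^ k * d" if "x \<in> X" for k x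
    using that
  proof (induction k arbitrary: x)
    case 0
    then show ?case using d[of x] by (simp add: iter_def)
  next
    case (Suc k)
    then show ?case
      using bellman_diff_le[OF A0 iter_holder[OF A0] iter_holder[OF A0] Suc.IH, of x]
      by (simp add: iter_def mult.assoc)
  qed
  define v where "v x = (\<Sum>i. iter A0 (Suc i) x - iter A0 i x)" for x
  have "uniform_limit X (\<lambda>k x. \<Sum>i<k. iter A0 (Suc i) x - iter A0 i x) v sequentially"
    unfolding v_def
  proof (rule Weierstrass_m_test)
    show "summable (\<lambda>k. \<gamma> ^ k * d)" using discount by (intro summable_mult2 summable_geometric) auto
  qed (use step in auto)
  moreover have "(\<Sum>i<k. iter A0 (Suc i) x - iter A0 i x) = iter A0 k x" for k x
    by (induction k) (auto simp: iter_def)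
  ultimately have ul: "uniform_limit X (iter A0) v sequentially" by simp
  then have lim: "(\<lambda>k. iter A0 k x) \<longlonglongrightarrow> v x" if "x \<in> X" for x
    using that by (rule tendsto_uniform_limitI)
  have hv: "holder_bound \<alpha> hconst X v"
    unfolding holder_bound_def
  proof (intro ballI)
    fix x y assume "x \<in> X" "y \<in> X"
    then show "\<bar>v x - v y\<bar> \<le> hconst * norm (x - y) powr \<alpha>"
      by (intro LIMSEQ_le_const2[OF tendsto_rabs[OF tendsto_diff[OF lim lim]]])
        (auto intro!: exI holder_boundD[OF iter_holder[OF A0]])
  qed
  have "v x = bellman A0 v x" if x: "x \<in> X" for x
  proof (rule LIMSEQ_unique)
    show "(\<lambda>k. iter A0 (Suc k) x) \<longlonglongrightarrow> v x" using lim[OF x] by (rule LIMSEQ_Suc)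
    show "(\<lambda>k. iter A0 (Suc k) x) \<longlonglongrightarrow> bellman A0 v x"
    proof (rule tendstoI)
      fix e :: real assume "0 < e"
      from uniform_limitD[OF ul this]
      show "\<forall>\<^sub>F k in sequentially. dist (iter A0 (Suc k) x) (bellman A0 v x) < e"
      proof eventually_elim
        case (elim k)
        then have "\<bar>bellman A0 (iter A0 k) x - bellman A0 v x\<bar> \<le> \<gamma> * e"
          by (intro bellman_diff_le A0 iter_holder hv x) (auto simp: dist_real_def intro: less_imp_le)
        also have "\<gamma> * e < e" using discount \<open>0 < e\<close> by simp
        finally show ?case by (simp add: iter_def dist_real_def)
      qed
    qed
  qed
  with lim hv show ?thesis by blast
qed

lemma
  shows val_holder: "holder_bound \<alpha> hconst X val"
    and val_fixed: "x \<in> X \<Longrightarrow> val x = (SUP a\<in>A. qval val (x, a))"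
proof -
  obtain v where v: "\<And>x. x \<in> X \<Longrightarrow> (\<lambda>k. iter A k x) \<longlonglongrightarrow> v x" "holder_bound \<alpha> hconst X v"
    "\<And>x. x \<in> X \<Longrightarrow> v x = bellman A v x"
    using ex_fixed_point[of A] A_nonempty by (metis order_refl)
  have eq: "val x = v x" if "x \<in> X" for x unfolding val_def using v(1)[OF that] by (rule limI)
  show "holder_bound \<alpha> hconst X val" using v(2) eq by (simp add: holder_bound_def)
  have "qval val z = qval v z" if "z \<in> Z" for z
    unfolding qval_def by (intro Bochner_Integration.integral_cong) (auto simp: eq f_in[OF that])
  then show "val x = (SUP a\<in>A. qval val (x, a))" if "x \<in> X"
    using v(3)[OF that] that by (auto simp: bellman_def eq intro!: SUP_cong)
qed

lemma holder_qval_val: "holder_bound \<alpha> hconst Z (qval val)"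
  by (rule holder_qval'[OF val_holder])

lemma val_continuous: "continuous_on X val"
  by (rule holder_bound_imp_continuous_on[OF val_holder exponent])

lemma val_bounded: "bounded (val ` X)"
  by (intro compact_imp_bounded compact_continuous_image val_continuous compact_X)

lemma qval_val_continuous: "continuous_on Z (qval val)"
  by (rule holder_bound_imp_continuous_on[OF holder_qval_val exponent])

lemma bdd_above_qval_val: "x \<in> X \<Longrightarrow> A0 \<subseteq> A \<Longrightarrow> bdd_above ((\<lambda>a. qval val (x, a)) ` A0)"
  by (rule bdd_above_qval[OF val_holder hconst_nonneg])

lemma qval_le_val: "z \<in> Z \<Longrightarrow> qval val z \<le> val (fst z)"
  using cSUP_upper[OF _ bdd_above_qval_val, of "snd z" A "fst z"] by (auto simp: val_fixed)

text \<open>The supremum distance \<open>d\<close> to \<open>val\<close> satisfies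
  \<open>d \<le> \<gamma> * d\<close>. The competitor \<open>u\<close> is merely bounded and
  integrable along \<open>f\<close>, without any continuity, since the estimator is characterised
  among bounded functions.\<close>

lemma val_unique:
  assumes u: "\<And>z. z \<in> Z \<Longrightarrow> integrable N (\<lambda>y. u (f z y))" "bounded (u ` X)"
      "\<And>x. x \<in> X \<Longrightarrow> u x = (SUP a\<in>A. qval u (x, a))"
    and x: "x \<in> X"
  shows "u x = val x"
proof -
  obtain Bu where Bu: "\<And>x. x \<in> X \<Longrightarrow> \<bar>u x\<bar> \<le> Bu" using u(2) by (auto simp: bounded_iff)
  obtain Bv where Bv: "\<And>x. x \<in> X \<Longrightarrow> \<bar>val x\<bar> \<le> Bv" using val_bounded by (auto simp: bounded_iff)
  have bd: "bdd_above ((\<lambda>x. \<bar>u x - val x\<bar>) ` X)"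
  proof (rule bdd_aboveI2)
    show "\<bar>u x - val x\<bar> \<le> Bu + Bv" if "x \<in> X" for x using Bu[OF that] Bv[OF that] by linarith
  qed
  define d where "d = (SUP x\<in>X. \<bar>u x - val x\<bar>)"
  have le: "\<bar>u x - val x\<bar> \<le> d" if "x \<in> X" for x
    unfolding d_def using bd that by (rule cSUP_upper2) simp
  have q: "\<bar>qval u z - qval val z\<bar> \<le> \<gamma> * d" if "z \<in> Z" for z
    using qval_diff_le[OF that u(1)[OF that] holder_comp_f[OF that val_holder] le] by simp
  have "\<bar>u x - val x\<bar> \<le> \<gamma> * d" if x: "x \<in> X" for x
  proof -
    have bdv: "bdd_above ((\<lambda>a. qval val (x, a)) ` A)"
      by (rule bdd_above_qval_val[OF x order_refl])
    then obtain B where B: "\<And>a. a \<in> A \<Longrightarrow> qval val (x, a) \<le> B" by (auto simp: bdd_above_def)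
    \<comment> \<open>Inherited from \<open>val\<close>, as the two Q-values differ by at most
      \<open>\<gamma> * d\<close>.\<close>
    have "bdd_above ((\<lambda>a. qval u (x, a)) ` A)"
    proof (rule bdd_aboveI2)
      show "qval u (x, a) \<le> B + \<gamma> * d" if "a \<in> A" for a
        using B[OF that] q[of "(x, a)"] x that by auto
    qed
    then show ?thesis
      unfolding u(3)[OF x] val_fixed[OF x]
      by (intro abs_SUP_diff_le bdv A_nonempty) (use q x in auto)
  qed
  then have "d \<le> \<gamma> * d" unfolding d_def using X_nonempty by (intro cSUP_least) auto
  then have "(1 - \<gamma>) * d \<le> 0" by (simp add: algebra_simps)
  then have "d \<le> 0" using discount by (simp add: mult_le_0_iff)
  with le[OF x] show ?thesis by simp
qed

text \<open>The limit over \<open>A0\<close> is continuous, so by density its supremum over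
  \<open>A0\<close> is also the supremum over \<open>A\<close>. It then solves the full Bellman
  equation, and uniqueness identifies it.\<close>

lemma iter_tendsto_val:
  assumes A0: "A0 \<subseteq> A" "A \<subseteq> closure A0" and x: "x \<in> X"
  shows "(\<lambda>k. iter A0 k x) \<longlonglongrightarrow> val x"
proof -
  have ne: "A0 \<noteq> {}" using A0 A_nonempty by auto
  obtain v where v: "\<And>x. x \<in> X \<Longrightarrow> (\<lambda>k. iter A0 k x) \<longlonglongrightarrow> v x" "holder_bound \<alpha> hconst X v"
    "\<And>x. x \<in> X \<Longrightarrow> v x = bellman A0 v x"
    using ex_fixed_point[OF A0(1) ne] by metis
  have cont: "continuous_on A (\<lambda>a. qval v (x, a))" if "x \<in> X" for x
    by (rule continuous_on_compose2[OF holder_bound_imp_continuous_on[OF holder_qval'[OF v(2)] exponent]])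
      (use that in \<open>auto intro!: continuous_intros\<close>)
  have "v x = val x"
  proof (rule val_unique[OF holder_comp_f[OF _ v(2)] _ _ x])
    show "bounded (v ` X)"
      by (intro compact_imp_bounded compact_continuous_image compact_X
        holder_bound_imp_continuous_on[OF v(2) exponent])
    show "v x = (SUP a\<in>A. qval v (x, a))" if "x \<in> X" for x
      unfolding v(3)[OF that] bellman_def
      by (rule SUP_dense_eq[OF cont[OF that] A0 ne bdd_above_qval[OF v(2) hconst_nonneg that order_refl]])
  qed
  with v(1)[OF x] show ?thesis by simp
qed

end

section \<open>Even moments of empirical means\<close>

text \<open>All moments are demanded at once because this class is closed under products as well as
  sums; integrability in binomial expansions then needs no bookkeeping of exponents.\<close>

definition all_moments :: "'b measure \<Rightarrow> ('b \<Rightarrow> real) \<Rightarrow> bool" where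
  "all_moments M f \<longleftrightarrow> f \<in> borel_measurable M \<and> (\<forall>k. integrable M (\<lambda>x. \<bar>f x\<bar> ^ k))"

lemma all_moments_measurable: "all_moments M f \<Longrightarrow> f \<in> borel_measurable M"
  by (simp add: all_moments_def)

lemma all_moments_integrable_abs_power: "all_moments M f \<Longrightarrow> integrable M (\<lambda>x. \<bar>f x\<bar> ^ k)"
  by (simp add: all_moments_def)

lemma all_moments_integrable_power: "all_moments M f \<Longrightarrow> integrable M (\<lambda>x. f x ^ k)"
  by (rule Bochner_Integration.integrable_bound[OF all_moments_integrable_abs_power[of M f k]])
    (auto simp: power_abs dest: all_moments_measurable)

lemma all_moments_integrable: "all_moments M f \<Longrightarrow> integrable M f"
  using all_moments_integrable_power[of M f 1] by simp

lemma all_moments_dominated: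
  assumes g: "all_moments M g" and f: "f \<in> borel_measurable M"
    and le: "\<And>x. x \<in> space M \<Longrightarrow> \<bar>f x\<bar> \<le> \<bar>g x\<bar>"
  shows "all_moments M f"
  unfolding all_moments_def
proof (intro conjI allI f)
  show "integrable M (\<lambda>x. \<bar>f x\<bar> ^ k)" for k
    by (rule Bochner_Integration.integrable_bound[OF all_moments_integrable_abs_power[OF g, of k]])
      (use f in \<open>auto intro!: power_mono le\<close>)
qed

lemma abs_add_power_le: "\<bar>a + b :: real\<bar> ^ k \<le> 2 ^ k * (\<bar>a\<bar> ^ k + \<bar>b\<bar> ^ k)"
proof -
  have "\<bar>a + b\<bar> ^ k \<le> (2 * max \<bar>a\<bar> \<bar>b\<bar>) ^ k" by (intro power_mono) auto
  also have "\<dots> \<le> 2 ^ k * (\<bar>a\<bar> ^ k + \<bar>b\<bar> ^ k)" by (auto simp: power_mult_distrib max_def)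
  finally show ?thesis .
qed

lemma all_moments_add:
  assumes "all_moments M f" "all_moments M g"
  shows "all_moments M (\<lambda>x. f x + g x)"
  unfolding all_moments_def
proof (intro conjI allI)
  note [measurable] = all_moments_measurable[OF assms(1)] all_moments_measurable[OF assms(2)]
  show "(\<lambda>x. f x + g x) \<in> borel_measurable M" by measurable
  show "integrable M (\<lambda>x. \<bar>f x + g x\<bar> ^ k)" for k
  proof (rule Bochner_Integration.integrable_bound)
    show "integrable M (\<lambda>x. 2 ^ k * (\<bar>f x\<bar> ^ k + \<bar>g x\<bar> ^ k))"
      using assms by (intro integrable_mult_right Bochner_Integration.integrable_add
          all_moments_integrable_abs_power)
  qed (auto intro!: order_trans[OF abs_add_power_le])
qed

lemma all_moments_mult:
  assumes "all_moments M f" "all_moments M g"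
  shows "all_moments M (\<lambda>x. f x * g x)"
  unfolding all_moments_def
proof (intro conjI allI)
  note [measurable] = all_moments_measurable[OF assms(1)] all_moments_measurable[OF assms(2)]
  show "(\<lambda>x. f x * g x) \<in> borel_measurable M" by measurable
  show "integrable M (\<lambda>x. \<bar>f x * g x\<bar> ^ k)" for k
  proof (rule Bochner_Integration.integrable_bound)
    show "integrable M (\<lambda>x. \<bar>f x\<bar> ^ (2 * k) + \<bar>g x\<bar> ^ (2 * k))"
      using assms by (intro Bochner_Integration.integrable_add all_moments_integrable_abs_power)
    \<comment> \<open>Applied to the \<open>k\<close>-th powers of both factors: moments of a
      product are paid for by moments of twice the order.\<close>
    have "a * b \<le> a ^ 2 + b ^ 2" if "0 \<le> a" "0 \<le> b" for a b :: real
      using sum_squares_bound[of a b] mult_nonneg_nonneg[OF that] by linarith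
    then show "AE x in M. norm (\<bar>f x * g x\<bar> ^ k) \<le> norm (\<bar>f x\<bar> ^ (2 * k) + \<bar>g x\<bar> ^ (2 * k))"
      by (intro AE_I2) (simp add: abs_mult power_mult_distrib mult.commute[of 2] power_mult)
  qed measurable
qed

lemma (in finite_measure) all_moments_const: "all_moments M (\<lambda>_. c)"
  by (simp add: all_moments_def)

lemma (in finite_measure) all_moments_cmult: "all_moments M f \<Longrightarrow> all_moments M (\<lambda>x. c * f x)"
  by (intro all_moments_mult all_moments_const)

lemma (in finite_measure) all_moments_diff:
  "all_moments M f \<Longrightarrow> all_moments M g \<Longrightarrow> all_moments M (\<lambda>x. f x - g x)"
  using all_moments_add[OF _ all_moments_cmult[of g "-1"], of f] by simp

lemma (in finite_measure) all_moments_sum: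
  "(\<And>i. i \<in> I \<Longrightarrow> all_moments M (f i)) \<Longrightarrow> all_moments M (\<lambda>x. \<Sum>i\<in>I. f i x)"
  by (induction I rule: infinite_finite_induct) (auto intro: all_moments_const all_moments_add)

lemma (in finite_measure) all_moments_power:
  "all_moments M f \<Longrightarrow> all_moments M (\<lambda>x. f x ^ k)"
  by (induction k) (auto intro: all_moments_const all_moments_mult)

section \<open>The i.i.d. sequence as a product measure\<close>

abbreviation iid :: "'w measure \<Rightarrow> (nat \<Rightarrow> 'w) measure" where
  "iid \<psi> \<equiv> \<Pi>\<^sub>M i\<in>(UNIV :: nat set). \<psi>"

lemma prob_space_iid: "prob_space \<psi> \<Longrightarrow> prob_space (iid \<psi>)"
  by (intro prob_space_PiM)

lemma space_iid: "t \<in> space (iid \<psi>) \<longleftrightarrow> (\<forall>i. t i \<in> space \<psi>)"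
  by (auto simp: space_PiM)

lemma integrable_iid_component:
  fixes g :: "'w \<Rightarrow> real"
  assumes "prob_space \<psi>" "integrable \<psi> g"
  shows "integrable (iid \<psi>) (\<lambda>t. g (t i))"
    and "(\<integral>t. g (t i) \<partial>iid \<psi>) = (\<integral>w. g w \<partial>\<psi>)"
proof -
  have d: "distr (iid \<psi>) \<psi> (\<lambda>t. t i) = \<psi>"
    using distr_PiM_component[of UNIV "\<lambda>_. \<psi>" i] assms(1) by simp
  have "integrable (distr (iid \<psi>) \<psi> (\<lambda>t. t i)) g" unfolding d by fact
  then show "integrable (iid \<psi>) (\<lambda>t. g (t i))" by (subst (asm) integrable_distr_eq) (use assms in auto)
  have "(\<integral>w. g w \<partial>distr (iid \<psi>) \<psi> (\<lambda>t. t i)) = (\<integral>t. g (t i) \<partial>iid \<psi>)"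
    by (rule integral_distr) (use assms in auto)
  then show "(\<integral>t. g (t i) \<partial>iid \<psi>) = (\<integral>w. g w \<partial>\<psi>)" unfolding d by simp
qed

lemma all_moments_iid_component:
  assumes "prob_space \<psi>" and g: "all_moments \<psi> g"
  shows "all_moments (iid \<psi>) (\<lambda>t. g (t i))"
  unfolding all_moments_def
  using integrable_iid_component(1)[OF assms(1) all_moments_integrable_abs_power[OF g]]
    all_moments_measurable[OF g] by auto

text \<open>Independence in the form of redrawing one coordinate: overwriting coordinate
  \<open>n\<close> by a fresh draw preserves the product law. Used for the mixed terms of the moment
  recursion and for the one-step Bellman identity along a policy.\<close>

lemma integral_resample:
  fixes F :: "(nat \<Rightarrow> 'w) \<Rightarrow> real"
  assumes \<psi>: "prob_space \<psi>" and F: "integrable (iid \<psi>) F"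
  shows "(\<integral>t. F t \<partial>iid \<psi>) = (\<integral>t. (\<integral>w. F (t(n := w)) \<partial>\<psi>) \<partial>iid \<psi>)"
proof -
  interpret \<psi>: prob_space \<psi> by fact
  interpret iid: prob_space "iid \<psi>" by (rule prob_space_iid[OF \<psi>])
  interpret P: pair_sigma_finite \<psi> "iid \<psi>" ..
  have d: "distr (\<psi> \<Otimes>\<^sub>M iid \<psi>) (iid \<psi>) (\<lambda>(w, t). t(n := w)) = iid \<psi>"
    using distr_pair_PiM_eq_PiM[of UNIV "\<lambda>_. \<psi>" n] \<psi> by simp
  have m: "(\<lambda>(w, t). t(n := w)) \<in> \<psi> \<Otimes>\<^sub>M iid \<psi> \<rightarrow>\<^sub>M iid \<psi>"
    unfolding case_prod_beta by (rule measurable_fun_upd[where J=UNIV]) auto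
  have Fm: "F \<in> borel_measurable (iid \<psi>)" using F by auto
  have "integrable (distr (\<psi> \<Otimes>\<^sub>M iid \<psi>) (iid \<psi>) (\<lambda>(w, t). t(n := w))) F" unfolding d by fact
  then have i: "integrable (\<psi> \<Otimes>\<^sub>M iid \<psi>) (\<lambda>(w, t). F (t(n := w)))"
    by (subst (asm) integrable_distr_eq[OF m Fm]) (simp add: case_prod_beta')
  have "(\<integral>t. F t \<partial>iid \<psi>) = (\<integral>t. F t \<partial>distr (\<psi> \<Otimes>\<^sub>M iid \<psi>) (iid \<psi>) (\<lambda>(w, t). t(n := w)))"
    unfolding d ..
  also have "\<dots> = (\<integral>x. (case x of (w, t) \<Rightarrow> F (t(n := w))) \<partial>(\<psi> \<Otimes>\<^sub>M iid \<psi>))"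
    by (subst integral_distr[OF m Fm]) (simp add: case_prod_beta')
  also have "\<dots> = (\<integral>t. (\<integral>w. F (t(n := w)) \<partial>\<psi>) \<partial>iid \<psi>)"
    by (rule P.integral_snd[symmetric, OF i])
  finally show ?thesis .
qed

text \<open>The linear term of the binomial expansion is kept exactly, since it will have mean zero.
  All higher terms share one bound, and their coefficients add up to at most
  \<open>2 ^ (2 * Suc m)\<close>.\<close>

lemma even_power_add_le:
  fixes s g :: real
  shows "(s + g) ^ (2 * Suc m) \<le> s ^ (2 * Suc m) + real (2 * Suc m) * (s ^ (2 * m + 1) * g)
    + 4 ^ Suc m * (s ^ (2 * m) * g ^ 2 + g ^ (2 * Suc m))"
proof -
  let ?N = "2 * Suc m"
  let ?R = "s ^ (2 * m) * g ^ 2 + g ^ (2 * Suc m)"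
  have Rnn: "0 \<le> ?R" by (auto simp: zero_le_even_power simp del: power_Suc)
  have eq: "(s + g) ^ ?N = s ^ ?N + real ?N * (s ^ (2 * m + 1) * g)
      + (\<Sum>k\<le>2 * m. real (?N choose (k + 2)) * g ^ (k + 2) * s ^ (2 * m - k))"
  proof -
    have "(s + g) ^ ?N = (\<Sum>k\<le>Suc (Suc (2 * m)). real (?N choose k) * g ^ k * s ^ (?N - k))"
      by (subst add.commute, subst binomial_ring) simp
    also have "\<dots> = s ^ ?N + real ?N * (s ^ (2 * m + 1) * g)
      + (\<Sum>k\<le>2 * m. real (?N choose (k + 2)) * g ^ (k + 2) * s ^ (2 * m - k))"
      by (subst sum.atMost_Suc_shift, subst sum.atMost_Suc_shift) (simp add: mult_ac)
    finally show ?thesis .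
  qed
  \<comment> \<open>Once \<open>g ^ 2\<close> is split off, the rest is a monomial of total degree
    \<open>2 * m\<close>, at most the larger of the two absolute values to that power.\<close>
  have summand: "g ^ (k + 2) * s ^ (2 * m - k) \<le> ?R" if "k \<le> 2 * m" for k
  proof -
    let ?x = "max \<bar>g\<bar> \<bar>s\<bar>"
    have "\<bar>g ^ k * s ^ (2 * m - k)\<bar> = \<bar>g\<bar> ^ k * \<bar>s\<bar> ^ (2 * m - k)" by (simp add: abs_mult power_abs)
    also have "\<dots> \<le> ?x ^ k * ?x ^ (2 * m - k)" by (intro mult_mono power_mono) auto
    also have "\<dots> = ?x ^ (2 * m)" using that by (simp flip: power_add)
    also have "\<dots> \<le> \<bar>g\<bar> ^ (2 * m) + \<bar>s\<bar> ^ (2 * m)" by (auto simp: max_def)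
    also have "\<dots> = g ^ (2 * m) + s ^ (2 * m)" by (simp add: power_mult)
    finally have "g ^ 2 * (g ^ k * s ^ (2 * m - k)) \<le> g ^ 2 * (g ^ (2 * m) + s ^ (2 * m))"
      by (intro mult_left_mono) auto
    then show ?thesis by (simp add: power_add algebra_simps power2_eq_square)
  qed
  have "(\<Sum>k\<le>2 * m. real (?N choose (k + 2)) * g ^ (k + 2) * s ^ (2 * m - k))
      \<le> (\<Sum>k\<le>2 * m. real (?N choose (k + 2)) * ?R)"
    by (intro sum_mono) (use summand in \<open>simp add: mult.assoc mult_left_mono del: power_Suc binomial_Suc_Suc\<close>)
  also have "\<dots> = real (\<Sum>k\<le>2 * m. ?N choose (k + 2)) * ?R"
    by (simp add: sum_distrib_right)
  also have "(\<Sum>k\<le>2 * m. ?N choose (k + 2)) \<le> (\<Sum>k\<le>?N. ?N choose k)"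
  proof -
    have "(\<Sum>k\<le>2 * m. ?N choose (k + 2)) = (\<Sum>k\<in>(\<lambda>k. k + 2) ` {..2 * m}. ?N choose k)"
      by (subst sum.reindex) (auto simp: inj_on_def)
    also have "\<dots> \<le> (\<Sum>k\<le>?N. ?N choose k)" by (intro sum_mono2) auto
    finally show ?thesis .
  qed
  also have "(\<Sum>k\<le>?N. ?N choose k) = 4 ^ Suc m"
    by (subst choose_row_sum) (simp add: power_mult)
  finally have "(\<Sum>k\<le>2 * m. real (?N choose (k + 2)) * g ^ (k + 2) * s ^ (2 * m - k)) \<le> 4 ^ Suc m * ?R"
    using Rnn by (auto simp: mult_right_mono)
  then show ?thesis unfolding eq by linarith
qed

text \<open>\<open>B j\<close> stands for the moment of order \<open>2 * j\<close> of an envelope.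
  The recursion reproduces the remainder of \<open>even_power_add_le\<close>: the moment of the sum
  of order \<open>2 * m\<close> times a second moment, plus one pure moment of order
  \<open>2 * Suc m\<close>.\<close>

primrec moment_const :: "(nat \<Rightarrow> real) \<Rightarrow> nat \<Rightarrow> real" where
  "moment_const B 0 = 1"
| "moment_const B (Suc m) = 4 ^ Suc m * (moment_const B m * B 1 + B (Suc m))"

lemma moment_const_nonneg: "(\<And>j. 0 \<le> B j) \<Longrightarrow> 0 \<le> moment_const B m"
  by (induction m) auto

text \<open>Even moments of the partial sums grow by at most a multiple of \<open>n ^ m\<close> per step: the term
  that is linear in the new summand integrates to zero by independence.\<close>

lemma moment_sum_le:
  assumes \<psi>: "prob_space \<psi>" and Y: "all_moments \<psi> Y" and g: "g \<in> borel_measurable \<psi>"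
    and le: "\<And>w. w \<in> space \<psi> \<Longrightarrow> \<bar>g w\<bar> \<le> c * Y w" and c: "0 \<le> c" and mean: "(\<integral>w. g w \<partial>\<psi>) = 0"
  shows "(\<integral>t. (\<Sum>i<n. g (t i)) ^ (2 * m) \<partial>iid \<psi>)
    \<le> moment_const (\<lambda>j. \<integral>w. Y w ^ (2 * j) \<partial>\<psi>) m * real n ^ m * c ^ (2 * m)"
proof (induction m arbitrary: n)
  case 0
  interpret iid: prob_space "iid \<psi>" by (rule prob_space_iid[OF \<psi>])
  show ?case by (simp add: iid.prob_space)
next
  case (Suc m)
  interpret \<psi>: prob_space \<psi> by fact
  interpret iid: prob_space "iid \<psi>" by (rule prob_space_iid[OF \<psi>])
  define B where "B j = (\<integral>w. Y w ^ (2 * j) \<partial>\<psi>)" for j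
  have B: "0 \<le> B j" for j unfolding B_def by (intro integral_nonneg_AE) auto
  note K = moment_const_nonneg[of B, OF B]
  have gm: "all_moments \<psi> g"
    by (rule all_moments_dominated[OF \<psi>.all_moments_cmult[OF Y, of c] g])
      (use le in \<open>force intro: order_trans[OF _ abs_ge_self]\<close>)
  note comp = all_moments_iid_component[OF \<psi> gm]
  let ?S = "\<lambda>n t. \<Sum>i<n. g (t i)"
  have S: "all_moments (iid \<psi>) (?S n)" for n by (intro iid.all_moments_sum comp)
  have moment_g: "(\<integral>w. g w ^ (2 * j) \<partial>\<psi>) \<le> c ^ (2 * j) * B j" for j
  proof -
    have "(\<integral>w. g w ^ (2 * j) \<partial>\<psi>) \<le> (\<integral>w. c ^ (2 * j) * Y w ^ (2 * j) \<partial>\<psi>)"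
    proof (rule integral_mono)
      show "g w ^ (2 * j) \<le> c ^ (2 * j) * Y w ^ (2 * j)" if "w \<in> space \<psi>" for w
        using power_mono[OF le[OF that], of "2 * j"] by (simp add: power_mult_distrib power_mult)
    qed (intro integrable_mult_right all_moments_integrable_power gm Y)+
    then show ?thesis by (simp add: B_def)
  qed
  have indep: "(\<integral>t. ?S n t ^ k * g (t n) ^ j \<partial>iid \<psi>) =
      (\<integral>t. ?S n t ^ k \<partial>iid \<psi>) * (\<integral>w. g w ^ j \<partial>\<psi>)" for n k j
  proof -
    have "(\<integral>t. ?S n t ^ k * g (t n) ^ j \<partial>iid \<psi>) = (\<integral>t. (\<integral>w. ?S n t ^ k * g w ^ j \<partial>\<psi>) \<partial>iid \<psi>)"
      by (subst integral_resample[OF \<psi>, where n=n])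
        (auto intro!: all_moments_integrable all_moments_mult iid.all_moments_power S comp)
    then show ?thesis by simp
  qed
  \<comment> \<open>Bound on the growth per step, frozen at the final index \<open>N\<close>, which
    is legitimate because the lower-order bound increases with the index. Summing \<open>n\<close>
    equal steps then gives order \<open>n ^ Suc m\<close>.\<close>
  define D where "D N = 4 ^ Suc m * (moment_const B m * real N ^ m * c ^ (2 * m) * (c ^ 2 * B 1)
    + c ^ (2 * Suc m) * B (Suc m))" for N
  have step: "(\<integral>t. ?S n t ^ (2 * Suc m) \<partial>iid \<psi>) \<le> real n * D N" if "n \<le> N" for n N
    using that
  proof (induction n)
    case 0
    show ?case by simp
  next
    case (Suc n)
    have "(\<integral>t. ?S (Suc n) t ^ (2 * Suc m) \<partial>iid \<psi>) \<le>
      (\<integral>t. ?S n t ^ (2 * Suc m) + real (2 * Suc m) * (?S n t ^ (2 * m + 1) * g (t n) ^ 1)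
       + 4 ^ Suc m * (?S n t ^ (2 * m) * g (t n) ^ 2 + g (t n) ^ (2 * Suc m)) \<partial>iid \<psi>)"
    proof (rule integral_mono)
      show "?S (Suc n) t ^ (2 * Suc m) \<le> ?S n t ^ (2 * Suc m)
        + real (2 * Suc m) * (?S n t ^ (2 * m + 1) * g (t n) ^ 1)
        + 4 ^ Suc m * (?S n t ^ (2 * m) * g (t n) ^ 2 + g (t n) ^ (2 * Suc m))" for t
        using even_power_add_le[of "?S n t" "g (t n)" m] by (simp only: sum.lessThan_Suc power_one_right)
    qed (intro all_moments_integrable all_moments_add all_moments_mult iid.all_moments_power
        iid.all_moments_cmult S comp)+
    also have "\<dots> = (\<integral>t. ?S n t ^ (2 * Suc m) \<partial>iid \<psi>)
       + real (2 * Suc m) * (\<integral>t. ?S n t ^ (2 * m + 1) * g (t n) ^ 1 \<partial>iid \<psi>)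
       + 4 ^ Suc m * ((\<integral>t. ?S n t ^ (2 * m) * g (t n) ^ 2 \<partial>iid \<psi>) + (\<integral>t. g (t n) ^ (2 * Suc m) \<partial>iid \<psi>))"
    proof -
      have 1: "integrable (iid \<psi>) (\<lambda>t. ?S n t ^ k)" for k
        by (intro all_moments_integrable iid.all_moments_power S)
      have 2: "integrable (iid \<psi>) (\<lambda>t. ?S n t ^ k * g (t n) ^ j)" for k j
        by (intro all_moments_integrable all_moments_mult iid.all_moments_power S comp)
      have 3: "integrable (iid \<psi>) (\<lambda>t. g (t n) ^ k)" for k
        by (intro all_moments_integrable iid.all_moments_power comp)
      show ?thesis
        by (simp only: Bochner_Integration.integral_add 1 2 3 integral_mult_right_zero
            integrable_mult_right Bochner_Integration.integrable_add)
    qed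
    also have "(\<integral>t. ?S n t ^ (2 * m + 1) * g (t n) ^ 1 \<partial>iid \<psi>) = 0"
      by (subst indep) (simp add: mean)
    also have "(\<integral>t. ?S n t ^ (2 * m) * g (t n) ^ 2 \<partial>iid \<psi>) \<le>
        (moment_const B m * real N ^ m * c ^ (2 * m)) * (c ^ 2 * B 1)"
      unfolding indep
    proof (intro mult_mono)
      \<comment> \<open>The outer induction hypothesis, at the next lower even order.\<close>
      have "(\<integral>t. ?S n t ^ (2 * m) \<partial>iid \<psi>) \<le> moment_const B m * real n ^ m * c ^ (2 * m)"
        using \<open>\<And>n. (\<integral>t. ?S n t ^ (2 * m) \<partial>iid \<psi>) \<le> _\<close> by (simp add: B_def[abs_def])
      also have "\<dots> \<le> moment_const B m * real N ^ m * c ^ (2 * m)"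
        using Suc.prems by (intro mult_right_mono mult_left_mono power_mono K) auto
      finally show "(\<integral>t. ?S n t ^ (2 * m) \<partial>iid \<psi>) \<le> moment_const B m * real N ^ m * c ^ (2 * m)" .
      show "(\<integral>w. g w ^ 2 \<partial>\<psi>) \<le> c ^ 2 * B 1" using moment_g[of 1] by simp
      show "0 \<le> moment_const B m * real N ^ m * c ^ (2 * m)" using K c by auto
    qed auto
    also have "(\<integral>t. g (t n) ^ (2 * Suc m) \<partial>iid \<psi>) = (\<integral>w. g w ^ (2 * Suc m) \<partial>\<psi>)"
      by (intro integrable_iid_component(2) \<psi> all_moments_integrable_power gm)
    also note moment_g[of "Suc m"]
    also have "(\<integral>t. ?S n t ^ (2 * Suc m) \<partial>iid \<psi>) \<le> real n * D N"
      using Suc by simp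
    finally show ?case by (simp add: D_def algebra_simps)
  qed
  show ?case
  proof (cases "n = 0")
    case True
    then show ?thesis by simp
  next
    case False
    \<comment> \<open>Lets the summand of \<open>D n\<close> that lacks a power of \<open>n\<close>
      be absorbed into the other one; hence the separate case of the empty sum.\<close>
    then have "1 \<le> real n ^ m" by simp
    then have "c ^ (2 * Suc m) * B (Suc m) * 1 \<le> c ^ (2 * Suc m) * B (Suc m) * real n ^ m"
      using c B by (intro mult_left_mono) auto
    then have "D n \<le> 4 ^ Suc m * ((moment_const B m * B 1 + B (Suc m)) * real n ^ m * c ^ (2 * Suc m))"
      unfolding D_def by (intro mult_left_mono) (auto simp: algebra_simps power2_eq_square)
    then have "real n * D n \<le> real n * (4 ^ Suc m * ((moment_const B m * B 1 + B (Suc m)) * real n ^ m * c ^ (2 * Suc m)))"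
      by (intro mult_left_mono) auto
    with step[of n n] show ?thesis
      unfolding B_def[abs_def, symmetric] by (simp add: algebra_simps)
  qed
qed

section \<open>Centred empirical means\<close>

definition emp_dev :: "'w measure \<Rightarrow> nat \<Rightarrow> (nat \<Rightarrow> 'w) \<Rightarrow> ('w \<Rightarrow> real) \<Rightarrow> real" where
  "emp_dev \<psi> n t g = emp_mean n t g - (\<integral>w. g w \<partial>\<psi>)"

text \<open>Centring a function dominated by \<open>c * Y\<close> enlarges its envelope to
  \<open>c\<close> times \<open>Y\<close> plus the mean of \<open>Y\<close>, whence the shifted
  moments.\<close>

definition emp_dev_const :: "'w measure \<Rightarrow> ('w \<Rightarrow> real) \<Rightarrow> nat \<Rightarrow> real" where
  "emp_dev_const \<psi> Y = moment_const (\<lambda>j. \<integral>w. (Y w + (\<integral>w'. Y w' \<partial>\<psi>)) ^ (2 * j) \<partial>\<psi>)"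

lemma emp_dev_const_nonneg: "0 \<le> emp_dev_const \<psi> Y m"
  unfolding emp_dev_const_def by (intro moment_const_nonneg integral_nonneg_AE) auto

text \<open>The scale \<open>c\<close> stays outside the constant: for increments it will be a
  multiple of \<open>norm (z - z') powr \<alpha>\<close>, and the bound must scale
  accordingly.\<close>

lemma emp_dev_moment:
  assumes \<psi>: "prob_space \<psi>" and Y: "all_moments \<psi> Y" and g: "g \<in> borel_measurable \<psi>"
    and le: "\<And>w. w \<in> space \<psi> \<Longrightarrow> \<bar>g w\<bar> \<le> c * Y w" and c: "0 \<le> c" and n: "1 \<le> n"
  shows "all_moments (iid \<psi>) (\<lambda>t. emp_dev \<psi> n t g)"
    and "(\<integral>t. emp_dev \<psi> n t g ^ (2 * m) \<partial>iid \<psi>) \<le> emp_dev_const \<psi> Y m * c ^ (2 * m) / real n ^ m"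
proof -
  interpret \<psi>: prob_space \<psi> by fact
  interpret iid: prob_space "iid \<psi>" by (rule prob_space_iid[OF \<psi>])
  have gm: "all_moments \<psi> g"
    by (rule all_moments_dominated[OF \<psi>.all_moments_cmult[OF Y, of c] g])
      (use le in \<open>force intro: order_trans[OF _ abs_ge_self]\<close>)
  define h where "h w = g w - (\<integral>w. g w \<partial>\<psi>)" for w
  have h: "all_moments \<psi> h"
    unfolding h_def[abs_def] by (intro \<psi>.all_moments_diff gm \<psi>.all_moments_const)
  have eq: "emp_dev \<psi> n t g = (1 / real n) * (\<Sum>i<n. h (t i))" for t
    using n by (simp add: emp_dev_def emp_mean_def h_def sum_subtractf diff_divide_distrib)
  show "all_moments (iid \<psi>) (\<lambda>t. emp_dev \<psi> n t g)"
    unfolding eq by (intro iid.all_moments_cmult iid.all_moments_sum all_moments_iid_component \<psi> h)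
  have mean_le: "\<bar>\<integral>w. g w \<partial>\<psi>\<bar> \<le> c * (\<integral>w. Y w \<partial>\<psi>)"
    using abs_integral_le[of \<psi> g "\<lambda>w. c * Y w"] le all_moments_integrable[OF gm] all_moments_integrable[OF Y]
    by simp
  have "(\<integral>t. (\<Sum>i<n. h (t i)) ^ (2 * m) \<partial>iid \<psi>) \<le> emp_dev_const \<psi> Y m * real n ^ m * c ^ (2 * m)"
    unfolding emp_dev_const_def
  proof (rule moment_sum_le[OF \<psi> _ all_moments_measurable[OF h] _ c])
    show "all_moments \<psi> (\<lambda>w. Y w + (\<integral>w'. Y w' \<partial>\<psi>))"
      by (intro all_moments_add Y \<psi>.all_moments_const)
    show "\<bar>h w\<bar> \<le> c * (Y w + (\<integral>w'. Y w' \<partial>\<psi>))" if "w \<in> space \<psi>" for w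
      using le[OF that] mean_le by (simp add: h_def distrib_left)
    show "(\<integral>w. h w \<partial>\<psi>) = 0"
      using all_moments_integrable[OF gm] by (simp add: h_def[abs_def] \<psi>.prob_space)
  qed
  then have "(1 / real n) ^ (2 * m) * (\<integral>t. (\<Sum>i<n. h (t i)) ^ (2 * m) \<partial>iid \<psi>)
      \<le> (1 / real n) ^ (2 * m) * (emp_dev_const \<psi> Y m * real n ^ m * c ^ (2 * m))"
    by (intro mult_left_mono) auto
  also have "\<dots> = emp_dev_const \<psi> Y m * c ^ (2 * m) / real n ^ m"
    using n by (simp add: power_divide field_simps power_mult power2_eq_square power_mult_distrib)
  finally show "(\<integral>t. emp_dev \<psi> n t g ^ (2 * m) \<partial>iid \<psi>) \<le> emp_dev_const \<psi> Y m * c ^ (2 * m) / real n ^ m"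
    unfolding eq power_mult_distrib by simp
qed

section \<open>Total variation\<close>

lemma floor_level_sum:
  fixes u :: real
  assumes "0 \<le> u" "u \<le> 1" "0 < m"
  shows "(\<Sum>j\<in>{1..m}. indicator {x. real j \<le> real m * x} u) = real_of_int \<lfloor>real m * u\<rfloor>"
proof -
  define k where "k = nat \<lfloor>real m * u\<rfloor>"
  have k: "real k = real_of_int \<lfloor>real m * u\<rfloor>" using assms by (simp add: k_def)
  have "real m * u \<le> real m * 1" using assms by (intro mult_left_mono) auto
  then have "k \<le> m" using k by linarith
  moreover have "(real j \<le> real m * u) = (j \<le> k)" for j
    using k by linarith
  ultimately have "{j \<in> {1..m}. real j \<le> real m * u} = {1..k}"
    by (intro set_eqI) (metis (no_types, lifting) atLeastAtMost_iff mem_Collect_eq le_trans)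
  moreover have "(\<Sum>j\<in>{1..m}. indicator {x. real j \<le> real m * x} u) =
      real (card {j \<in> {1..m}. real j \<le> real m * u})"
    by (simp add: indicator_def sum.If_cases Int_def)
  ultimately show ?thesis using k by simp
qed

text \<open>A layer-cake formula with \<open>m\<close> levels: the number of levels
  \<open>j / m\<close> not exceeding \<open>u x\<close> is the floor of \<open>m * u x\<close>, so
  the averaged indicators miss \<open>u\<close> by at most \<open>1 / m\<close>. Integrals thereby
  reduce to measures of sets, the only thing \<open>tv_dist\<close> compares.\<close>

lemma integral_level_sum:
  assumes "prob_space \<mu>" and u: "u \<in> borel_measurable \<mu>" "\<And>x. x \<in> space \<mu> \<Longrightarrow> 0 \<le> u x \<and> u x \<le> 1"
    and m: "0 < (m::nat)"
  shows "\<bar>(\<integral>x. u x \<partial>\<mu>) - (\<Sum>j\<in>{1..m}. measure \<mu> {x\<in>space \<mu>. real j \<le> real m * u x}) / m\<bar> \<le> 1 / m"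
proof -
  interpret prob_space \<mu> by fact
  have [simp]: "integrable \<mu> u" by (rule integrable_const_bound[of _ 1]) (use u in auto)
  have [measurable]: "u \<in> borel_measurable \<mu>" by fact
  let ?B = "\<lambda>j. {x\<in>space \<mu>. real j \<le> real m * u x}"
  let ?I = "\<lambda>x. \<Sum>j\<in>{1..m}. indicator (?B j) x :: real"
  have [simp]: "integrable \<mu> (indicator (?B j) :: _ \<Rightarrow> real)" for j
    by (intro integrable_real_indicator) (auto simp: emeasure_eq_measure)
  have eq: "(\<Sum>j\<in>{1..m}. measure \<mu> (?B j)) / m = (\<integral>x. ?I x / m \<partial>\<mu>)"
    by (subst integral_divide_zero, subst Bochner_Integration.integral_sum) auto
  have eq_div: "\<bar>real m * a - b\<bar> / real m = \<bar>a - b / real m\<bar>" for a b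
    using m by (simp add: field_simps abs_if)
  have [simp]: "integrable \<mu> (\<lambda>x. ?I x / m :: real)"
    by (intro integrable_divide Bochner_Integration.integrable_sum) auto
  have "\<bar>\<integral>x. u x - ?I x / m \<partial>\<mu>\<bar> \<le> (\<integral>x. 1 / m \<partial>\<mu>)"
  proof (rule abs_integral_le)
    fix x assume x: "x \<in> space \<mu>"
    then have "?I x = (\<Sum>j\<in>{1..m}. indicator {y. real j \<le> real m * y} (u x))"
      by (intro sum.cong) (auto simp: indicator_def)
    also have "\<dots> = real_of_int \<lfloor>real m * u x\<rfloor>" using floor_level_sum u(2)[OF x] m by auto
    finally have "\<bar>real m * u x - ?I x\<bar> \<le> 1" by linarith
    then have "\<bar>real m * u x - ?I x\<bar> / m \<le> 1 / m"
      by (rule divide_right_mono) simp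
    also have "\<bar>real m * u x - ?I x\<bar> / m =
        \<bar>u x - ?I x / m\<bar>"
      by (rule eq_div)
    finally show "\<bar>u x - ?I x / m\<bar> \<le> 1 / m" .
  qed simp_all
  then show ?thesis unfolding eq by (simp add: prob_space)
qed

lemma measure_diff_le_tv_dist:
  assumes "prob_space \<mu>" "prob_space \<nu>" "sets \<nu> = sets \<mu>" "B \<in> sets \<mu>"
  shows "\<bar>measure \<mu> B - measure \<nu> B\<bar> \<le> tv_dist \<mu> \<nu>"
  unfolding tv_dist_def
proof (rule cSUP_upper[OF assms(4)], rule bdd_aboveI2)
  fix C
  show "\<bar>measure \<mu> C - measure \<nu> C\<bar> \<le> 1"
    using prob_space.prob_le_1[OF assms(1), of C] prob_space.prob_le_1[OF assms(2), of C]
      measure_nonneg[of \<mu> C] measure_nonneg[of \<nu> C] by linarith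
qed

lemma integral_diff_le_tv_dist_unit:
  assumes \<mu>: "prob_space \<mu>" and \<nu>: "prob_space \<nu>" and sets: "sets \<nu> = sets \<mu>"
    and u: "u \<in> borel_measurable \<mu>" "\<And>x. x \<in> space \<mu> \<Longrightarrow> 0 \<le> u x \<and> u x \<le> 1"
  shows "\<bar>(\<integral>x. u x \<partial>\<mu>) - (\<integral>x. u x \<partial>\<nu>)\<bar> \<le> tv_dist \<mu> \<nu>"
proof (rule field_le_epsilon)
  fix e :: real assume "0 < e"
  then obtain m :: nat where m: "0 < m" "inverse m < e / 2"
    using reals_Archimedean[of "e / 2"] by (metis half_gt_zero zero_less_Suc)
  have sp: "space \<nu> = space \<mu>" using sets by (rule sets_eq_imp_space_eq)
  have [measurable]: "u \<in> borel_measurable \<mu>" by fact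
  have u': "u \<in> borel_measurable \<nu>" using u(1) by (simp add: measurable_cong_sets[OF sets refl])
  let ?B = "\<lambda>j. {x\<in>space \<mu>. real j \<le> real m * u x}"
  have "\<bar>(\<Sum>j\<in>{1..m}. measure \<mu> (?B j)) / m - (\<Sum>j\<in>{1..m}. measure \<nu> (?B j)) / m\<bar>
      = \<bar>\<Sum>j\<in>{1..m}. measure \<mu> (?B j) - measure \<nu> (?B j)\<bar> / m"
    by (simp add: sum_subtractf abs_divide diff_divide_distrib[symmetric])
  also have "\<dots> \<le> (\<Sum>j\<in>{1..m}. tv_dist \<mu> \<nu>) / m"
    by (intro divide_right_mono order_trans[OF sum_abs] sum_mono measure_diff_le_tv_dist \<mu> \<nu> sets) auto
  also have "\<dots> = tv_dist \<mu> \<nu>" using m by simp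
  finally have "\<bar>(\<Sum>j\<in>{1..m}. measure \<mu> (?B j)) / m - (\<Sum>j\<in>{1..m}. measure \<nu> (?B j)) / m\<bar> \<le> tv_dist \<mu> \<nu>" .
  moreover note integral_level_sum[OF \<mu> u m(1)] integral_level_sum[OF \<nu> u' _ m(1), unfolded sp, OF u(2)]
  moreover have "1 / real m \<le> e / 2" using m by (simp add: inverse_eq_divide)
  ultimately show "\<bar>(\<integral>x. u x \<partial>\<mu>) - (\<integral>x. u x \<partial>\<nu>)\<bar> \<le> tv_dist \<mu> \<nu> + e" by linarith
qed

text \<open>Rescaling the range from \<open>{-c..c}\<close> to the unit interval costs the factor
  \<open>2 * c\<close>, as \<open>tv_dist\<close> is a supremum over sets.\<close>

lemma integral_diff_le_tv_dist:
  fixes h :: "'b \<Rightarrow> real"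
  assumes \<mu>: "prob_space \<mu>" and \<nu>: "prob_space \<nu>" and sets: "sets \<nu> = sets \<mu>"
    and h: "h \<in> borel_measurable \<mu>" "\<And>x. x \<in> space \<mu> \<Longrightarrow> \<bar>h x\<bar> \<le> c"
  shows "\<bar>(\<integral>x. h x \<partial>\<mu>) - (\<integral>x. h x \<partial>\<nu>)\<bar> \<le> 2 * c * tv_dist \<mu> \<nu>"
proof (cases "c \<le> 0")
  \<comment> \<open>The rescaling divides by \<open>c\<close>. A probability space is nonempty, so
    here \<open>c\<close> must be 0 and the function vanishes.\<close>
  case True
  have sp: "space \<nu> = space \<mu>" using sets by (rule sets_eq_imp_space_eq)
  have z: "h x = 0" if "x \<in> space \<mu>" for x using h(2)[OF that] True by linarith
  obtain x where "x \<in> space \<mu>" using prob_space.not_empty[OF \<mu>] by auto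
  then have "c = 0" using h(2)[of x] True by linarith
  moreover have "(\<integral>x. h x \<partial>\<mu>) = 0" "(\<integral>x. h x \<partial>\<nu>) = 0"
    using z sp by (auto intro!: integral_eq_zero_AE AE_I2)
  ultimately show ?thesis by simp
next
  case False
  then have c: "0 < c" by simp
  have sp: "space \<nu> = space \<mu>" using sets by (rule sets_eq_imp_space_eq)
  have h': "h \<in> borel_measurable \<nu>" using h(1) by (simp add: measurable_cong_sets[OF sets refl])
  interpret \<mu>: prob_space \<mu> by fact
  interpret \<nu>: prob_space \<nu> by fact
  have [simp]: "integrable \<mu> h" by (rule \<mu>.integrable_const_bound[of _ c]) (use h in auto)
  have [simp]: "integrable \<nu> h" by (rule \<nu>.integrable_const_bound[of _ c]) (use h h' sp in auto)
  define u where "u x = (h x + c) / (2 * c)" for x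
  have "\<bar>(\<integral>x. u x \<partial>\<mu>) - (\<integral>x. u x \<partial>\<nu>)\<bar> \<le> tv_dist \<mu> \<nu>"
  proof (rule integral_diff_le_tv_dist_unit[OF \<mu> \<nu> sets])
    show "u \<in> borel_measurable \<mu>" unfolding u_def using h(1) by measurable
    show "0 \<le> u x \<and> u x \<le> 1" if "x \<in> space \<mu>" for x
      using h(2)[OF that] c by (auto simp: u_def field_simps)
  qed
  moreover have "(\<integral>x. u x \<partial>\<mu>) = ((\<integral>x. h x \<partial>\<mu>) + c) / (2 * c)"
    unfolding u_def by (simp add: \<mu>.prob_space)
  moreover have "(\<integral>x. u x \<partial>\<nu>) = ((\<integral>x. h x \<partial>\<nu>) + c) / (2 * c)"
    unfolding u_def by (simp add: \<nu>.prob_space)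
  ultimately have "\<bar>(\<integral>x. h x \<partial>\<mu>) - (\<integral>x. h x \<partial>\<nu>)\<bar> / (2 * c) \<le> tv_dist \<mu> \<nu>"
    using c by (simp add: abs_divide flip: diff_divide_distrib)
  then show ?thesis using c by (simp add: divide_le_eq mult.commute)
qed

section \<open>Chaining\<close>

lemma powr_pow_swap: "0 < x \<Longrightarrow> (x ^ i) powr a = (x powr a) ^ i" for x :: real
  by (simp add: powr_powr mult.commute flip: powr_realpow)

text \<open>A grid with cells of side \<open>1 / s\<close> and one representative for each occupied
  cell. Representatives are taken from \<open>Z\<close> itself because the functions to be chained
  are controlled only there.\<close>

lemma ex_finite_net:
  fixes Z :: "'z::euclidean_space set"
  assumes "bounded Z" "0 < \<rho>"
  shows "\<exists>C\<ge>0. \<forall>i::nat. \<exists>N. finite N \<and> N \<subseteq> Z \<and> real (card N) \<le> C * (2 ^ DIM('z)) ^ i \<and>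
    (\<forall>z\<in>Z. \<exists>p\<in>N. norm (z - p) \<le> \<rho> / 2 ^ i)"
proof -
  obtain B where B: "0 < B" "\<And>z. z \<in> Z \<Longrightarrow> norm z \<le> B"
    using assms(1) by (auto simp: bounded_pos)
  define d where "d = real DIM('z)"
  have d: "1 \<le> d" using DIM_positive[where 'a='z] by (simp add: d_def)
  define C where "C = (2 * d * B / \<rho> + 3) ^ DIM('z)"
  have "0 \<le> C" unfolding C_def using B d assms by (intro zero_le_power add_nonneg_nonneg divide_nonneg_pos mult_nonneg_nonneg) auto
  moreover have "\<exists>N. finite N \<and> N \<subseteq> Z \<and> real (card N) \<le> C * (2 ^ DIM('z)) ^ i \<and>
    (\<forall>z\<in>Z. \<exists>p\<in>N. norm (z - p) \<le> \<rho> / 2 ^ i)" for i :: nat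
  proof -
    \<comment> \<open>Two points of a cell differ by at most \<open>1 / s\<close> in each of
      \<open>d\<close> coordinates, and the Euclidean norm is bounded by the sum norm.\<close>
    define s where "s = 2 ^ i * d / \<rho>"
    have s: "0 < s" using d assms by (simp add: s_def)
    define K where "K = \<lceil>s * B\<rceil>"
    have "0 \<le> s * B" using s B by simp
    then have K: "0 \<le> K" unfolding K_def by linarith
    define \<phi> where "\<phi> z = (\<lambda>b\<in>(Basis :: 'z set). \<lfloor>s * (z \<bullet> b)\<rfloor>)" for z
    have range: "\<phi> ` Z \<subseteq> Basis \<rightarrow>\<^sub>E {- K..K}"
    proof (rule image_subsetI)
      fix z assume z: "z \<in> Z"
      have "\<lfloor>s * (z \<bullet> b)\<rfloor> \<in> {- K..K}" if "b \<in> Basis" for b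
      proof -
        have "\<bar>s * (z \<bullet> b)\<bar> \<le> s * B"
          using Basis_le_norm[OF that, of z] B(2)[OF z] s by (simp add: abs_mult)
        then show ?thesis unfolding K_def by (auto simp: le_floor_iff; linarith)
      qed
      then show "\<phi> z \<in> Basis \<rightarrow>\<^sub>E {- K..K}" by (auto simp: \<phi>_def)
    qed
    define N where "N = inv_into Z \<phi> ` \<phi> ` Z"
    have fin: "finite (Basis \<rightarrow>\<^sub>E {- K..K} :: ('z \<Rightarrow> int) set)" by (intro finite_PiE) auto
    then have "finite (\<phi> ` Z)" using range by (rule finite_subset[rotated])
    then have "finite N" by (simp add: N_def)
    moreover have "N \<subseteq> Z" by (auto simp: N_def inv_into_into)
    moreover have "real (card N) \<le> C * (2 ^ DIM('z)) ^ i"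
    proof -
      have "card N \<le> card (\<phi> ` Z)" unfolding N_def by (rule card_image_le) fact
      also have "\<dots> \<le> card (Basis \<rightarrow>\<^sub>E {- K..K} :: ('z \<Rightarrow> int) set)"
        by (rule card_mono[OF fin range])
      also have "\<dots> = nat (2 * K + 1) ^ DIM('z)" by (simp add: card_PiE)
      finally have "real (card N) \<le> real (nat (2 * K + 1)) ^ DIM('z)" by (metis of_nat_le_iff of_nat_power)
      also have "\<dots> \<le> ((2 * d * B / \<rho> + 3) * 2 ^ i) ^ DIM('z)"
      proof (rule power_mono)
        have "real_of_int K \<le> s * B + 1" unfolding K_def by (rule of_int_ceiling_le_add_one)
        moreover have "real (nat (2 * K + 1)) = 2 * real_of_int K + 1" using K by simp
        moreover have "1 \<le> (2 :: real) ^ i" by simp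
        ultimately have "real (nat (2 * K + 1)) \<le> 2 * (s * B) + 3 * 2 ^ i" by linarith
        also have "\<dots> = (2 * d * B / \<rho> + 3) * 2 ^ i" by (simp add: s_def field_simps)
        finally show "real (nat (2 * K + 1)) \<le> (2 * d * B / \<rho> + 3) * 2 ^ i" .
      qed simp
      also have "\<dots> = C * (2 ^ DIM('z)) ^ i"
        by (simp add: C_def power_mult_distrib power_commutes mult.commute flip: power_mult)
      finally show ?thesis .
    qed
    moreover have "\<exists>p\<in>N. norm (z - p) \<le> \<rho> / 2 ^ i" if z: "z \<in> Z" for z
    proof
      let ?p = "inv_into Z \<phi> (\<phi> z)"
      show "?p \<in> N" using z by (auto simp: N_def)
      have "\<phi> ?p = \<phi> z" using z by (intro f_inv_into_f) auto
      then have fl: "\<lfloor>s * (?p \<bullet> b)\<rfloor> = \<lfloor>s * (z \<bullet> b)\<rfloor>" if "b \<in> Basis" for b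
        using that by (auto simp: \<phi>_def fun_eq_iff restrict_def split: if_splits)
      have "norm (z - ?p) \<le> (\<Sum>b\<in>Basis. \<bar>(z - ?p) \<bullet> b\<bar>)" by (rule norm_le_l1)
      also have "\<dots> \<le> (\<Sum>b\<in>(Basis::'z set). 1 / s)"
      proof (rule sum_mono)
        fix b :: 'z assume b: "b \<in> Basis"
        have "\<bar>s * (z \<bullet> b) - s * (?p \<bullet> b)\<bar> \<le> 1" using fl[OF b] by linarith
        then have "s * \<bar>(z - ?p) \<bullet> b\<bar> \<le> 1"
          using s by (simp add: inner_diff_left abs_mult flip: right_diff_distrib)
        then show "\<bar>(z - ?p) \<bullet> b\<bar> \<le> 1 / s" using s by (simp add: field_simps)
      qed
      also have "\<dots> = \<rho> / 2 ^ i" using d assms by (simp add: s_def d_def field_simps)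
      finally show "norm (z - ?p) \<le> \<rho> / 2 ^ i" .
    qed
    ultimately show ?thesis by blast
  qed
  ultimately show ?thesis by blast
qed

text \<open>All that later arguments need to know about the nets. \<open>J i\<close> holds the pairs
  compared at scale \<open>2 ^ i\<close>; weighting an increment by \<open>(2 powr q) ^ i\<close>
  turns it into a q-Hoelder quotient up to a constant. In the summability condition
  \<open>4 ^ DIM('z)\<close> is the growth rate of the number of pairs, and the other factor the
  decay of their weighted moments.\<close>

locale chaining =
  fixes Z :: "'z::euclidean_space set" and q \<alpha> :: real and J :: "nat \<Rightarrow> ('z \<times> 'z) set" and C B :: real
  assumes finite_J: "finite (J i)" and J_subset: "J i \<subseteq> Z \<times> Z" and J_nonempty: "J 0 \<noteq> {}"
    and C_nonneg: "0 \<le> C"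
    and weight_bound: "\<And>i p p'. (p, p') \<in> J i \<Longrightarrow> (2 powr q) ^ i * norm (p - p') powr \<alpha> \<le> B"
    and chain: "\<And>D K z z'. continuous_on Z D \<Longrightarrow>
      (\<And>i p p'. (p, p') \<in> J i \<Longrightarrow> (2 powr q) ^ i * \<bar>D p - D p'\<bar> \<le> K) \<Longrightarrow> z \<in> Z \<Longrightarrow> z' \<in> Z \<Longrightarrow>
      \<bar>D z - D z'\<bar> \<le> C * K * norm (z - z') powr q"
    and summable_weights: "\<And>m. 4 ^ DIM('z) * (2 powr (q - \<alpha>)) ^ (2 * m) < 1 \<Longrightarrow>
      summable (\<lambda>i. \<Sum>(p, p')\<in>J i. ((2 powr q) ^ i * norm (p - p') powr \<alpha>) ^ (2 * m))"

lemma ex_chaining: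
  fixes Z :: "'z::euclidean_space set"
  assumes Z: "bounded Z" "Z \<noteq> {}" and q: "0 < q" "q < \<alpha>"
  shows "\<exists>J C B. chaining Z q \<alpha> J C B"
proof -
  obtain \<rho> where \<rho>: "0 < \<rho>" and diam: "\<And>z z'. z \<in> Z \<Longrightarrow> z' \<in> Z \<Longrightarrow> norm (z - z') \<le> \<rho>"
  proof -
    obtain B where B: "0 < B" "\<And>z. z \<in> Z \<Longrightarrow> norm z \<le> B"
      using Z(1) by (auto simp: bounded_pos)
    have "norm (z - z') \<le> 2 * B" if "z \<in> Z" "z' \<in> Z" for z z'
      using norm_triangle_ineq4[of z z'] B(2)[OF that(1)] B(2)[OF that(2)] by linarith
    with B(1) show ?thesis by (intro that[of "2 * B"]) auto
  qed
  obtain c N where c: "0 \<le> c" and N: "\<And>i. finite (N i)" "\<And>i. N i \<subseteq> Z"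
      "\<And>i. real (card (N i)) \<le> c * (2 ^ DIM('z)) ^ i"
      "\<And>i z. z \<in> Z \<Longrightarrow> \<exists>p\<in>N i. norm (z - p) \<le> \<rho> / 2 ^ i"
    using ex_finite_net[OF Z(1) \<rho>] by metis
  define p where "p i z = (SOME p. p \<in> N i \<and> norm (z - p) \<le> \<rho> / 2 ^ i)" for i z
  have p: "p i z \<in> N i" "norm (z - p i z) \<le> \<rho> / 2 ^ i" if "z \<in> Z" for i z
    using someI_ex[of "\<lambda>p. p \<in> N i \<and> norm (z - p) \<le> \<rho> / 2 ^ i"] N(4)[OF that] by (auto simp: p_def)
  \<comment> \<open>Contains links inside one net and links to the next finer net. A step along a
    chain has length at most \<open>\<rho> / 2 ^ i + \<rho> / 2 ^ Suc i\<close>, and the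
    approximants of two points at distance at most \<open>\<rho> / 2 ^ i\<close> lie within
    \<open>3 * \<rho> / 2 ^ i\<close>; the radius covers both.\<close>
  define J where "J i = {(u, v) \<in> N i \<times> (N i \<union> N (Suc i)). norm (u - v) \<le> 4 * \<rho> / 2 ^ i}" for i
  define \<theta> where "\<theta> = 2 powr q"
  have \<theta>: "1 < \<theta>" using q by (simp add: \<theta>_def)
  define \<eta> where "\<eta> = 1 / \<theta>"
  have \<eta>: "0 < \<eta>" "\<eta> < 1" using \<theta> by (auto simp: \<eta>_def)
  have \<theta>\<eta>: "\<theta> ^ i * \<eta> ^ i = 1" for i using \<theta> by (simp add: \<eta>_def flip: power_mult_distrib)
  have weight: "\<theta> ^ i * norm (u - v) powr \<alpha> \<le> (4 * \<rho>) powr \<alpha> * (2 powr (q - \<alpha>)) ^ i"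
    if "(u, v) \<in> J i" for i u v
  proof -
    have "norm (u - v) powr \<alpha> \<le> (4 * \<rho> / 2 ^ i) powr \<alpha>"
      using that q by (intro powr_mono2) (auto simp: J_def)
    also have "\<dots> = (4 * \<rho>) powr \<alpha> * (2 powr (- \<alpha>)) ^ i"
      using \<rho> by (subst powr_divide) (simp_all add: powr_pow_swap powr_minus_divide power_one_over)
    finally have "\<theta> ^ i * norm (u - v) powr \<alpha> \<le> \<theta> ^ i * ((4 * \<rho>) powr \<alpha> * (2 powr (- \<alpha>)) ^ i)"
      using \<theta> by (intro mult_left_mono) auto
    also have "\<dots> = (4 * \<rho>) powr \<alpha> * (2 powr (q - \<alpha>)) ^ i"
      by (simp add: \<theta>_def powr_diff powr_minus divide_inverse power_mult_distrib)
    finally show ?thesis .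
  qed
  have chain: "\<bar>D z - D z'\<bar> \<le> (3 * \<theta> / ((1 - \<eta>) * \<rho> powr q)) * K * norm (z - z') powr q"
    if D: "continuous_on Z D" and K: "\<And>i u v. (u, v) \<in> J i \<Longrightarrow> \<theta> ^ i * \<bar>D u - D v\<bar> \<le> K"
      and z: "z \<in> Z" "z' \<in> Z" for D K z z'
  proof (cases "z = z'")
    case False
    have Ki: "\<bar>D u - D v\<bar> \<le> K * \<eta> ^ i" if "(u, v) \<in> J i" for i u v
    proof -
      have "\<bar>D u - D v\<bar> = \<eta> ^ i * (\<theta> ^ i * \<bar>D u - D v\<bar>)"
        using \<theta>\<eta>[of i] by (simp add: mult.commute flip: mult.assoc)
      also have "\<dots> \<le> \<eta> ^ i * K" using K[OF that] \<eta> by (intro mult_left_mono) auto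
      finally show ?thesis by (simp add: mult.commute)
    qed
    have "(p 0 z, p 0 z) \<in> J 0" using p[OF z(1), of 0] \<rho> by (auto simp: J_def)
    from K[OF this] have "0 \<le> K" by simp
    \<comment> \<open>The sum of the geometric series of link bounds. Writing \<open>K\<close> as
      \<open>K' - K' * \<eta>\<close> makes the partial sums along a chain telescope.\<close>
    define K' where "K' = K / (1 - \<eta>)"
    have K': "0 \<le> K'" "K \<le> K'" "K = K' - K' * \<eta>"
    proof -
      show "0 \<le> K'" using \<open>0 \<le> K\<close> \<eta> by (simp add: K'_def)
      have "K' * (1 - \<eta>) = K" using \<eta> by (simp add: K'_def)
      then show eq: "K = K' - K' * \<eta>" by (simp add: algebra_simps)
      show "K \<le> K'" unfolding eq using \<open>0 \<le> K'\<close> \<eta> by simp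
    qed
    have tail: "\<bar>D (p j y) - D y\<bar> \<le> K' * \<eta> ^ j" if y: "y \<in> Z" for j y
    proof -
      have part: "\<bar>D (p j y) - D (p (j + l) y)\<bar> \<le> K' * \<eta> ^ j - K' * \<eta> ^ (j + l)" for l
      proof (induction l)
        case (Suc l)
        let ?a = "p (j + l) y" and ?b = "p (Suc (j + l)) y"
        have "norm (?a - ?b) \<le> norm (y - ?b) + norm (y - ?a)"
          using norm_triangle_ineq4[of "y - ?b" "y - ?a"] by simp
        also have "\<dots> \<le> \<rho> / 2 ^ Suc (j + l) + \<rho> / 2 ^ (j + l)" by (intro add_mono p y)
        also have "\<dots> \<le> 4 * \<rho> / 2 ^ (j + l)" using \<rho> by (simp add: field_simps)
        finally have "(?a, ?b) \<in> J (j + l)" using p[OF y] by (auto simp: J_def)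
        from Ki[OF this] have "\<bar>D ?a - D ?b\<bar> \<le> (K' - K' * \<eta>) * \<eta> ^ (j + l)"
          using K'(3) by simp
        also have "\<dots> = K' * \<eta> ^ (j + l) - K' * \<eta> ^ (j + Suc l)" by (simp add: algebra_simps)
        finally show ?case using Suc by simp
      qed simp
      have le: "\<bar>D (p j y) - D (p (j + l) y)\<bar> \<le> K' * \<eta> ^ j" for l
      proof -
        have "0 \<le> K' * \<eta> ^ (j + l)" using K' \<eta> by simp
        with part[of l] show ?thesis by linarith
      qed
      have "(\<lambda>l. \<rho> / 2 ^ (j + l)) \<longlonglongrightarrow> 0" by real_asymp
      then have "(\<lambda>l. p (j + l) y - y) \<longlonglongrightarrow> 0"
        by (rule Lim_null_comparison[rotated]) (use p(2)[OF y] in \<open>auto simp: norm_minus_commute\<close>)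
      then have "(\<lambda>l. p (j + l) y) \<longlonglongrightarrow> y" by (rule LIM_zero_cancel)
      then have "(\<lambda>l. D (p (j + l) y)) \<longlonglongrightarrow> D y"
        by (rule continuous_on_tendsto_compose[OF D]) (use y subsetD[OF N(2) p(1)[OF y]] in auto)
      then have "(\<lambda>l. \<bar>D (p j y) - D (p (j + l) y)\<bar>) \<longlonglongrightarrow> \<bar>D (p j y) - D y\<bar>"
        by (intro tendsto_intros)
      then show ?thesis by (rule LIMSEQ_le_const2) (use le in auto)
    qed
    have nz: "0 < norm (z - z')" using False by simp
    have "(\<lambda>j. \<rho> / 2 ^ Suc j) \<longlonglongrightarrow> 0" by real_asymp
    from order_tendstoD(2)[OF this nz] have ex: "\<exists>j. \<rho> / 2 ^ Suc j < norm (z - z')"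
      by (auto simp: eventually_sequentially)
    \<comment> \<open>The dyadic scale of the distance: it lies above
      \<open>\<rho> / 2 ^ Suc j\<close> and at most at \<open>\<rho> / 2 ^ j\<close>. For
      \<open>j = 0\<close> the latter holds because \<rho> bounds all distances in
      \<open>Z\<close>.\<close>
    define j where "j = (LEAST j. \<rho> / 2 ^ Suc j < norm (z - z'))"
    have j1: "\<rho> / 2 ^ Suc j < norm (z - z')" unfolding j_def by (rule LeastI_ex[OF ex])
    have j2: "norm (z - z') \<le> \<rho> / 2 ^ j"
    proof (cases j)
      case 0
      then show ?thesis using diam[OF z] by simp
    next
      case (Suc k)
      then have "k < j" by simp
      from not_less_Least[OF this[unfolded j_def]] Suc show ?thesis by simp
    qed
    have "norm (p j z - p j z') \<le> norm (z - p j z) + norm (z - z') + norm (z' - p j z')"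
      using norm_triangle_ineq4[of "z - z'" "z - p j z"] norm_triangle_ineq[of "p j z - z'" "z' - p j z'"]
      by simp
    also have "\<dots> \<le> \<rho> / 2 ^ j + \<rho> / 2 ^ j + \<rho> / 2 ^ j" by (intro add_mono p z j2)
    also have "\<dots> \<le> 4 * \<rho> / 2 ^ j" using \<rho> by (simp add: field_simps)
    finally have "(p j z, p j z') \<in> J j" using p z by (auto simp: J_def)
    from Ki[OF this] have "\<bar>D (p j z) - D (p j z')\<bar> \<le> K' * \<eta> ^ j"
      using K'(2) \<eta> by (meson less_imp_le mult_right_mono order_trans zero_le_power)
    \<comment> \<open>Two chains down to the points and one link at level \<open>j\<close> give the
      factor 3.\<close>
    with tail[OF z(1), of j] tail[OF z(2), of j] have "\<bar>D z - D z'\<bar> \<le> 3 * (K' * \<eta> ^ j)" by linarith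
    \<comment> \<open>\<open>\<eta> ^ j\<close> is \<open>2 powr (- q * j)\<close>. The distance is
      bounded below only at scale \<open>Suc j\<close>, which costs one factor \<theta>.\<close>
    also have "\<eta> ^ j \<le> \<theta> / \<rho> powr q * norm (z - z') powr q"
    proof -
      have "(\<rho> / 2 ^ Suc j) powr q \<le> norm (z - z') powr q"
        using j1 \<rho> q by (intro powr_mono2) auto
      also have "(\<rho> / 2 ^ Suc j) powr q = \<rho> powr q * \<eta> ^ Suc j"
        using \<rho> by (subst powr_divide)
          (simp_all add: powr_pow_swap \<theta>_def[symmetric] \<eta>_def power_one_over del: power_Suc)
      finally show ?thesis using \<rho> \<theta> by (simp add: \<eta>_def field_simps)
    qed
    then have "3 * (K' * \<eta> ^ j) \<le> 3 * (K' * (\<theta> / \<rho> powr q * norm (z - z') powr q))"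
      using K' by (intro mult_left_mono) auto
    also have "\<dots> = (3 * \<theta> / ((1 - \<eta>) * \<rho> powr q)) * K * norm (z - z') powr q"
      by (simp add: K'_def)
    finally show ?thesis .
  qed simp
  have fin: "finite (J i)" for i
    by (rule finite_subset[of _ "N i \<times> (N i \<union> N (Suc i))"]) (use N(1) in \<open>auto simp: J_def\<close>)
  \<comment> \<open>A pair involves two nets of size of order \<open>(2 ^ DIM('z)) ^ i\<close>, and
    each weight decays like \<open>(2 powr (q - \<alpha>)) ^ i\<close>. The series is dominated by a
    geometric one with ratio \<open>x\<close> below.\<close>
  have summable: "summable (\<lambda>i. \<Sum>(u, v)\<in>J i. (\<theta> ^ i * norm (u - v) powr \<alpha>) ^ (2 * m))"
    if m: "4 ^ DIM('z) * (2 powr (q - \<alpha>)) ^ (2 * m) < 1" for m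
  proof (rule summable_comparison_test')
    define d :: real where "d = 2 ^ DIM('z)"
    define w where "w = ((4 * \<rho>) powr \<alpha>) ^ (2 * m)"
    define x where "x = 4 ^ DIM('z) * (2 powr (q - \<alpha>)) ^ (2 * m)"
    have dd: "d * d = 4 ^ DIM('z)" by (simp add: d_def flip: power_mult_distrib)
    show "summable (\<lambda>i. c * (c + c * d) * w * x ^ i)"
      using m by (intro summable_mult summable_geometric) (simp add: x_def)
    fix i :: nat
    have d: "1 \<le> d" by (simp add: d_def)
    have "card (J i) \<le> card (N i \<times> (N i \<union> N (Suc i)))"
      by (rule card_mono) (use N(1) in \<open>auto simp: J_def\<close>)
    also have "\<dots> \<le> card (N i) * (card (N i) + card (N (Suc i)))"
      by (simp add: card_cartesian_product card_Un_le)
    finally have "real (card (J i)) \<le> real (card (N i)) * (real (card (N i)) + real (card (N (Suc i))))"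
      by (metis of_nat_le_iff of_nat_mult of_nat_add)
    also have "\<dots> \<le> (c * d ^ i) * (c * d ^ i + c * d ^ Suc i)"
      using d c by (intro mult_mono add_mono N(3)[folded d_def]) auto
    also have "\<dots> = c * (c + c * d) * (d * d) ^ i" by (simp add: algebra_simps power_mult_distrib)
    finally have cardJ: "real (card (J i)) \<le> c * (c + c * d) * (4 ^ DIM('z)) ^ i" by (simp only: dd)
    have "(\<Sum>(u, v)\<in>J i. (\<theta> ^ i * norm (u - v) powr \<alpha>) ^ (2 * m)) \<le>
        (\<Sum>(u, v)\<in>J i. w * ((2 powr (q - \<alpha>)) ^ i) ^ (2 * m))"
      using \<theta> weight unfolding w_def by (intro sum_mono) (auto simp flip: power_mult_distrib intro!: power_mono)
    also have "\<dots> = real (card (J i)) * (w * ((2 powr (q - \<alpha>)) ^ i) ^ (2 * m))"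
      by (simp add: case_prod_beta)
    also have "\<dots> \<le> c * (c + c * d) * (4 ^ DIM('z)) ^ i * (w * ((2 powr (q - \<alpha>)) ^ i) ^ (2 * m))"
      by (intro mult_right_mono cardJ) (simp add: w_def)
    also have "\<dots> = c * (c + c * d) * w * x ^ i"
      by (simp add: x_def power_mult_distrib mult_ac flip: power_mult)
    finally show "norm (\<Sum>(u, v)\<in>J i. (\<theta> ^ i * norm (u - v) powr \<alpha>) ^ (2 * m)) \<le> c * (c + c * d) * w * x ^ i"
      using \<theta> by (subst real_norm_def, subst abs_of_nonneg) (auto intro!: sum_nonneg)
  qed
  obtain z where z: "z \<in> Z" using Z by auto
  have "chaining Z q \<alpha> J (3 * \<theta> / ((1 - \<eta>) * \<rho> powr q)) ((4 * \<rho>) powr \<alpha>)"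
  proof
    show "J i \<subseteq> Z \<times> Z" for i using N(2) by (auto simp: J_def)
    have "(p 0 z, p 0 z) \<in> J 0" using p[OF z, of 0] \<rho> by (auto simp: J_def)
    then show "J 0 \<noteq> {}" by auto
    show "0 \<le> 3 * \<theta> / ((1 - \<eta>) * \<rho> powr q)" using \<theta> \<eta> by simp
    show "(2 powr q) ^ i * norm (u - v) powr \<alpha> \<le> (4 * \<rho>) powr \<alpha>" if "(u, v) \<in> J i" for i u v
    proof -
      have "(2 powr (q - \<alpha>)) ^ i \<le> 1" using q powr_mono[of "q - \<alpha>" 0 2] by (intro power_le_one) auto
      then have "(4 * \<rho>) powr \<alpha> * (2 powr (q - \<alpha>)) ^ i \<le> (4 * \<rho>) powr \<alpha> * 1" by (intro mult_left_mono) auto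
      with weight[OF that] show ?thesis by (simp add: \<theta>_def)
    qed
  qed (use fin chain summable in \<open>auto simp: \<theta>_def\<close>)
  then show ?thesis by blast
qed

section \<open>Moments of the chained supremum\<close>

context chaining
begin

text \<open>Stands in for the q-Hoelder seminorm. The supremum runs over countably many pairs, so it
  is measurable in a random \<open>D\<close>.\<close>

definition chain_sup :: "('z \<Rightarrow> real) \<Rightarrow> real" where
  "chain_sup D = (SUP (i, u, v)\<in>Sigma UNIV J. (2 powr q) ^ i * \<bar>D u - D v\<bar>)"

text \<open>Makes the real-valued supremum meaningful. The constant may be random and arbitrarily
  large here; it does not enter the moment bound for \<open>chain_sup\<close>.\<close>

lemma bdd_above_chain_sup:
  assumes "holder_bound \<alpha> H Z D"
  shows "bdd_above ((\<lambda>(i, u, v). (2 powr q) ^ i * \<bar>D u - D v\<bar>) ` Sigma UNIV J)"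
proof (rule bdd_aboveI2)
  fix x assume "x \<in> Sigma UNIV J"
  then obtain i u v where x: "x = (i, u, v)" "(u, v) \<in> J i" by (cases x) auto
  then have "u \<in> Z" "v \<in> Z" using J_subset by auto
  then have "\<bar>D u - D v\<bar> \<le> \<bar>H\<bar> * norm (u - v) powr \<alpha>"
    using holder_boundD[OF assms, of u v] by (smt (verit) mult_right_mono powr_ge_zero)
  then have "(2 powr q) ^ i * \<bar>D u - D v\<bar> \<le> \<bar>H\<bar> * ((2 powr q) ^ i * norm (u - v) powr \<alpha>)"
    by (simp add: mult.left_commute mult_left_mono)
  also have "\<dots> \<le> \<bar>H\<bar> * B" by (intro mult_left_mono weight_bound x) auto
  finally show "(case x of (i, u, v) \<Rightarrow> (2 powr q) ^ i * \<bar>D u - D v\<bar>) \<le> \<bar>H\<bar> * B" using x by simp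
qed

lemma chain_sup_upper:
  assumes "holder_bound \<alpha> H Z D" "(u, v) \<in> J i"
  shows "(2 powr q) ^ i * \<bar>D u - D v\<bar> \<le> chain_sup D"
  unfolding chain_sup_def
  using cSUP_upper[OF _ bdd_above_chain_sup[OF assms(1)], of "(i, u, v)"] assms(2) by simp

lemma chain_sup_nonneg: "holder_bound \<alpha> H Z D \<Longrightarrow> 0 \<le> chain_sup D"
proof -
  assume H: "holder_bound \<alpha> H Z D"
  obtain u v where "(u, v) \<in> J 0" using J_nonempty by (metis equals0I surj_pair)
  from order_trans[OF _ chain_sup_upper[OF H this]] show ?thesis by simp
qed

lemma chain_sup_increment:
  assumes "holder_bound \<alpha> H Z D" "0 < \<alpha>" "z \<in> Z" "z' \<in> Z"
  shows "\<bar>D z - D z'\<bar> \<le> C * chain_sup D * norm (z - z') powr q"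
  by (rule chain[OF holder_bound_imp_continuous_on[OF assms(1,2)] chain_sup_upper[OF assms(1)] assms(3,4)])

lemma measurable_chain_sup:
  assumes D: "\<And>z. z \<in> Z \<Longrightarrow> (\<lambda>t. D t z) \<in> borel_measurable M"
    and H: "\<And>t. t \<in> space M \<Longrightarrow> holder_bound \<alpha> (H t) Z (D t)"
  shows "(\<lambda>t. chain_sup (D t)) \<in> borel_measurable M"
  unfolding chain_sup_def
proof (rule borel_measurable_cSUP)
  show "countable (Sigma UNIV J)" by (intro countable_SIGMA) (auto intro: countable_finite finite_J)
  fix x assume "x \<in> Sigma UNIV J"
  then obtain i u v where x: "x = (i, u, v)" "(u, v) \<in> J i" by (cases x) auto
  then have uv: "u \<in> Z" "v \<in> Z" using J_subset by auto
  note [measurable] = D[OF uv(1)] D[OF uv(2)]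
  show "(\<lambda>t. case x of (i, u, v) \<Rightarrow> (2 powr q) ^ i * \<bar>D t u - D t v\<bar>) \<in> borel_measurable M"
    unfolding x prod.case by measurable
next
  show "bdd_above ((\<lambda>x. case x of (i, u, v) \<Rightarrow> (2 powr q) ^ i * \<bar>D t u - D t v\<bar>) ` Sigma UNIV J)"
    if "t \<in> space M" for t by (rule bdd_above_chain_sup[OF H[OF that]])
qed

definition weight_sum :: "nat \<Rightarrow> real" where
  "weight_sum m = (\<Sum>i. \<Sum>(u, v)\<in>J i. ((2 powr q) ^ i * norm (u - v) powr \<alpha>) ^ (2 * m))"

text \<open>A power of a supremum is at most the sum of the powers, and the expectation of each term
  is controlled by the increment moments. Raising \<open>m\<close> improves the decay of the terms
  without adding any, so the sum over pairs converges for large \<open>m\<close>.\<close>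

lemma chain_sup_moment:
  assumes D: "\<And>z. z \<in> Z \<Longrightarrow> all_moments M (\<lambda>t. D t z)"
    and H: "\<And>t. t \<in> space M \<Longrightarrow> holder_bound \<alpha> (H t) Z (D t)"
    and m: "4 ^ DIM('z) * (2 powr (q - \<alpha>)) ^ (2 * m) < 1" "0 < m"
    and \<kappa>: "0 \<le> \<kappa>" "\<And>u v. u \<in> Z \<Longrightarrow> v \<in> Z \<Longrightarrow>
      (\<integral>t. (D t u - D t v) ^ (2 * m) \<partial>M) \<le> \<kappa> * (norm (u - v) powr \<alpha>) ^ (2 * m)"
    and M: "finite_measure M"
  shows "(\<integral>\<^sup>+t. ennreal (chain_sup (D t) ^ (2 * m)) \<partial>M) \<le> ennreal (\<kappa> * weight_sum m)"
proof -
  interpret finite_measure M by fact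
  let ?w = "2 powr q"
  let ?g = "\<lambda>i t. \<Sum>(u, v)\<in>J i. (?w ^ i * \<bar>D t u - D t v\<bar>) ^ (2 * m)"
  have gnn: "0 \<le> ?g i t" for i t by (intro sum_nonneg) auto
  have Dm: "all_moments M (\<lambda>t. (?w ^ i * \<bar>D t u - D t v\<bar>) ^ (2 * m))" if "(u, v) \<in> J i" for i u v
  proof -
    have "u \<in> Z" "v \<in> Z" using J_subset that by auto
    then have "all_moments M (\<lambda>t. (?w ^ i * (D t u - D t v)) ^ (2 * m))"
      by (intro all_moments_power all_moments_cmult all_moments_diff D)
    then show ?thesis by (simp add: power_mult_distrib power_mult)
  qed
  have gm: "all_moments M (?g i)" for i
    by (intro all_moments_sum) (auto intro: Dm)
  have pointwise: "ennreal (chain_sup (D t) ^ (2 * m)) \<le> (\<Sum>i. ennreal (?g i t))" if t: "t \<in> space M" for t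
  proof (cases "(\<Sum>i. ennreal (?g i t)) = \<infinity>")
    case False
    then obtain \<rho> where \<rho>: "0 \<le> \<rho>" "(\<Sum>i. ennreal (?g i t)) = ennreal \<rho>"
      by (cases "\<Sum>i. ennreal (?g i t)") auto
    \<comment> \<open>Only samples with a finite sum matter; there the root of the sum bounds every
      term, hence the supremum.\<close>
    have "?w ^ i * \<bar>D t u - D t v\<bar> \<le> root (2 * m) \<rho>" if uv: "(u, v) \<in> J i" for i u v
    proof -
      have "(?w ^ i * \<bar>D t u - D t v\<bar>) ^ (2 * m) \<le> ?g i t"
        using member_le_sum[OF uv, of "\<lambda>(u, v). (?w ^ i * \<bar>D t u - D t v\<bar>) ^ (2 * m)"] finite_J by auto
      moreover have "ennreal (?g i t) \<le> ennreal \<rho>"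
        unfolding \<rho>(2)[symmetric] using sum_le_suminf[of "\<lambda>i. ennreal (?g i t)" "{i}"] by simp
      ultimately have "(?w ^ i * \<bar>D t u - D t v\<bar>) ^ (2 * m) \<le> \<rho>"
        using \<rho> gnn by (auto simp: ennreal_le_iff)
      then have "root (2 * m) ((?w ^ i * \<bar>D t u - D t v\<bar>) ^ (2 * m)) \<le> root (2 * m) \<rho>"
        using m by (subst real_root_le_iff) auto
      then show ?thesis using m by (subst (asm) real_root_power_cancel) auto
    qed
    then have "chain_sup (D t) \<le> root (2 * m) \<rho>"
      unfolding chain_sup_def by (intro cSUP_least) (use J_nonempty in force, auto)
    then have "chain_sup (D t) ^ (2 * m) \<le> root (2 * m) \<rho> ^ (2 * m)"
      by (intro power_mono chain_sup_nonneg[OF H[OF t]])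
    also have "\<dots> = \<rho>" using m \<rho> by (intro real_root_pow_pos2) auto
    finally show ?thesis using \<rho> by (simp add: ennreal_leI)
  qed simp
  have "(\<integral>\<^sup>+t. ennreal (chain_sup (D t) ^ (2 * m)) \<partial>M) \<le> (\<integral>\<^sup>+t. (\<Sum>i. ennreal (?g i t)) \<partial>M)"
    by (rule nn_integral_mono[OF pointwise])
  also have "\<dots> = (\<Sum>i. \<integral>\<^sup>+t. ennreal (?g i t) \<partial>M)"
    by (rule nn_integral_suminf) (rule measurable_compose[OF all_moments_measurable[OF gm] measurable_ennreal])
  also have "\<dots> \<le> (\<Sum>i. ennreal (\<kappa> * (\<Sum>(u, v)\<in>J i. (?w ^ i * norm (u - v) powr \<alpha>) ^ (2 * m))))"
  proof (intro suminf_le summableI)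
    fix i
    have "(\<integral>\<^sup>+t. ennreal (?g i t) \<partial>M) = ennreal (\<integral>t. ?g i t \<partial>M)"
      by (intro nn_integral_eq_integral all_moments_integrable[OF gm]) (use gnn in auto)
    also have "(\<integral>t. ?g i t \<partial>M) = (\<Sum>(u, v)\<in>J i. (\<integral>t. (?w ^ i * \<bar>D t u - D t v\<bar>) ^ (2 * m) \<partial>M))"
      unfolding case_prod_beta
      by (rule Bochner_Integration.integral_sum) (rule all_moments_integrable, rule Dm, simp)
    also have "\<dots> \<le> (\<Sum>(u, v)\<in>J i. \<kappa> * (?w ^ i * norm (u - v) powr \<alpha>) ^ (2 * m))"
    proof (rule sum_mono, clarify)
      fix u v assume "(u, v) \<in> J i"
      then have "u \<in> Z" "v \<in> Z" using J_subset by auto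
      from \<kappa>(2)[OF this]
      have "(?w ^ i) ^ (2 * m) * (\<integral>t. (D t u - D t v) ^ (2 * m) \<partial>M) \<le>
          (?w ^ i) ^ (2 * m) * (\<kappa> * (norm (u - v) powr \<alpha>) ^ (2 * m))"
        by (intro mult_left_mono) auto
      then show "(\<integral>t. (?w ^ i * \<bar>D t u - D t v\<bar>) ^ (2 * m) \<partial>M) \<le> \<kappa> * (?w ^ i * norm (u - v) powr \<alpha>) ^ (2 * m)"
        by (simp add: power_mult_distrib mult.left_commute power_mult)
    qed
    also have "\<dots> = \<kappa> * (\<Sum>(u, v)\<in>J i. (?w ^ i * norm (u - v) powr \<alpha>) ^ (2 * m))"
      by (simp add: sum_distrib_left case_prod_beta)
    finally show "(\<integral>\<^sup>+t. ennreal (?g i t) \<partial>M) \<le>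
        ennreal (\<kappa> * (\<Sum>(u, v)\<in>J i. (?w ^ i * norm (u - v) powr \<alpha>) ^ (2 * m)))"
      by (simp add: ennreal_leI)
  qed
  also have "\<dots> = ennreal (\<Sum>i. \<kappa> * (\<Sum>(u, v)\<in>J i. (?w ^ i * norm (u - v) powr \<alpha>) ^ (2 * m)))"
    using \<kappa>(1) by (intro suminf_ennreal2 summable_mult summable_weights m mult_nonneg_nonneg sum_nonneg) auto
  also have "\<dots> = ennreal (\<kappa> * weight_sum m)"
    unfolding weight_sum_def by (subst suminf_mult[OF summable_weights[OF m(1)]]) simp
  finally show ?thesis .
qed

lemma weight_sum_nonneg: "4 ^ DIM('z) * (2 powr (q - \<alpha>)) ^ (2 * m) < 1 \<Longrightarrow> 0 \<le> weight_sum m"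
  unfolding weight_sum_def by (intro suminf_nonneg summable_weights sum_nonneg) auto

end

section \<open>The optimal value function\<close>

lemma measurable_Pair_restrict_borel:
  fixes X :: "'x::second_countable_topology set" and A :: "'a::second_countable_topology set"
  assumes "g \<in> M \<rightarrow>\<^sub>M borel_on X" "h \<in> M \<rightarrow>\<^sub>M borel_on A"
  shows "(\<lambda>t. (g t, h t)) \<in> M \<rightarrow>\<^sub>M borel_on (X \<times> A)"
  using assms by (auto simp: measurable_restrict_space2_iff intro: borel_measurable_Pair)

text \<open>Policies do not anticipate, so redrawing the noise at time \<open>t\<close> leaves state
  and action at time \<open>t\<close> untouched.\<close>

lemma history_cong: "(\<And>i. i < t \<Longrightarrow> \<xi> i = \<xi>' i) \<Longrightarrow> history f \<pi> x \<xi> t = history f \<pi> x \<xi>' t"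
proof (induction t)
  case (Suc t)
  then have "history f \<pi> x \<xi> t = history f \<pi> x \<xi>' t" "\<xi> t = \<xi>' t" by auto
  then show ?case by simp
qed simp

text \<open>Joint measurability enters as soon as the state-action pair is itself random, along a
  policy or inside empirical iterates.\<close>

locale noisy_mdp = holder_mdp \<psi> X A f r \<gamma> \<alpha> \<l> L
  for \<psi> :: "'w measure" and X :: "'x::euclidean_space set" and A :: "'a::euclidean_space set"
    and f r \<gamma> \<alpha> \<l> L +
  assumes joint_f: "(\<lambda>(z, w). f z w) \<in> borel_on (X \<times> A) \<Otimes>\<^sub>M \<psi> \<rightarrow>\<^sub>M borel_on X"
    and joint_r: "(\<lambda>(z, w). r z w) \<in> borel_measurable (borel_on (X \<times> A) \<Otimes>\<^sub>M \<psi>)"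
begin

lemma measurable_comp_f:
  "g \<in> M \<rightarrow>\<^sub>M borel_on Z \<Longrightarrow> h \<in> M \<rightarrow>\<^sub>M \<psi> \<Longrightarrow>
    (\<lambda>t. f (g t) (h t)) \<in> M \<rightarrow>\<^sub>M borel_on X"
  using measurable_compose[OF measurable_Pair joint_f, of g M h] by simp

lemma measurable_comp_r:
  "g \<in> M \<rightarrow>\<^sub>M borel_on Z \<Longrightarrow> h \<in> M \<rightarrow>\<^sub>M \<psi> \<Longrightarrow>
    (\<lambda>t. r (g t) (h t)) \<in> borel_measurable M"
  using measurable_compose[OF measurable_Pair joint_r, of g M h] by simp

text \<open>Rewards may be unbounded in the noise, so domination needs one integrable envelope for
  all \<open>z\<close>: the reward at an anchor point plus the Hoelder modulus over the
  diameter.\<close>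

lemma ex_reward_envelope:
  "\<exists>R. integrable \<psi> R \<and> (\<forall>z\<in>Z. \<forall>w\<in>space \<psi>. \<bar>r z w\<bar> \<le> R w)"
proof -
  obtain z0 where z0: "z0 \<in> Z" using X_nonempty A_nonempty by auto
  have "bounded Z" by (intro compact_imp_bounded compact_Times compact_X compact_A)
  then obtain D where D: "\<And>z z'. z \<in> Z \<Longrightarrow> z' \<in> Z \<Longrightarrow> norm (z - z') \<le> D"
    unfolding dist_norm[symmetric] by (metis bounded_two_points)
  have "\<bar>r z w\<bar> \<le> \<bar>r z0 w\<bar> + L w * D powr \<alpha>" if "z \<in> Z" "w \<in> space \<psi>" for z w
  proof -
    have "L w * norm (z - z0) powr \<alpha> \<le> L w * D powr \<alpha>"
      using L_nonneg[OF that(2)] D[OF that(1) z0] exponent by (intro mult_left_mono powr_mono2) auto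
    then show ?thesis using holder_r[OF that(1) z0 that(2)] by linarith
  qed
  moreover have "integrable \<psi> (\<lambda>w. \<bar>r z0 w\<bar> + L w * D powr \<alpha>)"
    using integrable_r[OF z0] integrable_L by auto
  ultimately show ?thesis by blast
qed

section \<open>Discounted rewards along a fixed policy\<close>

context
  fixes \<pi> :: "nat \<Rightarrow> (nat \<Rightarrow> 'x) \<Rightarrow> 'a" and x :: 'x
  assumes \<pi>: "\<pi> \<in> policies X A" and x: "x \<in> X"
begin

abbreviation "Xt \<equiv> state f \<pi> x"
abbreviation "Zt \<xi> t \<equiv> (state f \<pi> x \<xi> t, action f \<pi> x \<xi> t)"

lemma policy_measurable: "\<pi> t \<in> (\<Pi>\<^sub>M s\<in>{..t}. borel_on X) \<rightarrow>\<^sub>M borel_on A"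
  using \<pi> by (simp add: policies_def)

lemma history_measurable:
  "(\<lambda>\<xi>. history f \<pi> x \<xi> t) \<in> iid \<psi> \<rightarrow>\<^sub>M (\<Pi>\<^sub>M s\<in>{..t}. borel_on X)"
proof (induction t)
  case 0
  have "(\<lambda>\<xi>. (\<lambda>_. undefined)(0 := x)) \<in> iid \<psi> \<rightarrow>\<^sub>M (\<Pi>\<^sub>M s\<in>{..(0::nat)}. borel_on X)"
    by (rule measurable_const) (use x in \<open>auto simp: space_PiM space_restrict_space PiE_def extensional_def\<close>)
  then show ?case by (simp only: history.simps)
next
  case (Suc t)
  have z: "(\<lambda>\<xi>. (history f \<pi> x \<xi> t t, \<pi> t (history f \<pi> x \<xi> t))) \<in> iid \<psi> \<rightarrow>\<^sub>M borel_on Z"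
    by (intro measurable_Pair_restrict_borel measurable_compose[OF Suc policy_measurable]
        measurable_compose[OF Suc measurable_component_singleton]) auto
  show ?case
    unfolding history.simps
    by (rule measurable_fun_upd[OF _ Suc measurable_comp_f[OF z]]) auto
qed

lemma Zt_measurable: "(\<lambda>\<xi>. Zt \<xi> t) \<in> iid \<psi> \<rightarrow>\<^sub>M borel_on Z"
  unfolding state_def action_def
  by (intro measurable_Pair_restrict_borel measurable_compose[OF history_measurable policy_measurable]
      measurable_compose[OF history_measurable measurable_component_singleton]) auto

lemma Zt_in: "\<xi> \<in> space (iid \<psi>) \<Longrightarrow> Zt \<xi> t \<in> Z"
  using measurable_space[OF Zt_measurable, of \<xi> t] by (simp add: space_restrict_space)

lemma Xt_measurable: "(\<lambda>\<xi>. Xt \<xi> t) \<in> iid \<psi> \<rightarrow>\<^sub>M borel_on X"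
  unfolding state_def
  by (intro measurable_compose[OF history_measurable measurable_component_singleton]) auto

lemma Zt_upd: "Zt (\<xi>(t := w)) t = Zt \<xi> t"
  using history_cong[of t "\<xi>(t := w)" \<xi> f \<pi> x] by (simp add: state_def action_def)

lemma Xt_Suc: "Xt \<xi> (Suc t) = f (Zt \<xi> t) (\<xi> t)"
  by (simp add: state_def action_def)

lemma integrable_reward: "integrable (iid \<psi>) (\<lambda>\<xi>. r (Zt \<xi> t) (\<xi> t))"
proof -
  obtain R where R: "integrable \<psi> R" "\<And>z w. z \<in> Z \<Longrightarrow> w \<in> space \<psi> \<Longrightarrow> \<bar>r z w\<bar> \<le> R w"
    using ex_reward_envelope by blast
  show ?thesis
  proof (rule Bochner_Integration.integrable_bound[OF integrable_iid_component(1)[OF prob_space_axioms R(1), of t]])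
    show "(\<lambda>\<xi>. r (Zt \<xi> t) (\<xi> t)) \<in> borel_measurable (iid \<psi>)"
      by (intro measurable_comp_r Zt_measurable measurable_component_singleton) auto
    show "AE \<xi> in iid \<psi>. norm (r (Zt \<xi> t) (\<xi> t)) \<le> norm (R (\<xi> t))"
    proof (rule AE_I2)
      fix \<xi> assume "\<xi> \<in> space (iid \<psi>)"
      then have "\<bar>r (Zt \<xi> t) (\<xi> t)\<bar> \<le> R (\<xi> t)" by (intro R(2) Zt_in) (auto simp: space_iid)
      then show "norm (r (Zt \<xi> t) (\<xi> t)) \<le> norm (R (\<xi> t))" by simp
    qed
  qed
qed

lemma integrable_bounded_continuous:
  assumes "continuous_on S u" "compact S" "Y \<in> iid \<psi> \<rightarrow>\<^sub>M borel_on S"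
  shows "integrable (iid \<psi>) (\<lambda>\<xi>. u (Y \<xi>) :: real)"
proof -
  interpret iid: prob_space "iid \<psi>" by (rule prob_space_iid[OF prob_space_axioms])
  obtain K where K: "\<And>y. y \<in> S \<Longrightarrow> norm (u y) \<le> K"
    using compact_imp_bounded[OF compact_continuous_image[OF assms(1,2)]] by (auto simp: bounded_iff)
  show ?thesis
  proof (rule iid.integrable_const_bound[of _ K])
    show "AE \<xi> in iid \<psi>. norm (u (Y \<xi>)) \<le> K"
      by (intro AE_I2 K) (use measurable_space[OF assms(3)] in \<open>auto simp: space_restrict_space\<close>)
    show "(\<lambda>\<xi>. u (Y \<xi>)) \<in> borel_measurable (iid \<psi>)"
      by (rule measurable_compose[OF assms(3) borel_measurable_continuous_on_restrict[OF assms(1)]])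
  qed
qed

lemma integrable_val_Xt: "integrable (iid \<psi>) (\<lambda>\<xi>. val (Xt \<xi> t))"
  by (rule integrable_bounded_continuous[OF val_continuous compact_X Xt_measurable])

lemma integrable_qval_Zt: "integrable (iid \<psi>) (\<lambda>\<xi>. qval val (Zt \<xi> t))"
  by (rule integrable_bounded_continuous[OF qval_val_continuous compact_Times[OF compact_X compact_A] Zt_measurable])

text \<open>Redrawing the noise at time \<open>t\<close> averages reward plus continuation value
  over a fresh draw with \<open>Zt\<close> held fixed, and that average is the Q-value.\<close>

lemma integral_step:
  "(\<integral>\<xi>. r (Zt \<xi> t) (\<xi> t) \<partial>iid \<psi>) + \<gamma> * (\<integral>\<xi>. val (Xt \<xi> (Suc t)) \<partial>iid \<psi>) = (\<integral>\<xi>. qval val (Zt \<xi> t) \<partial>iid \<psi>)"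
proof -
  let ?F = "\<lambda>\<xi>. r (Zt \<xi> t) (\<xi> t) + \<gamma> * val (Xt \<xi> (Suc t))"
  have i: "integrable (iid \<psi>) ?F"
    by (intro Bochner_Integration.integrable_add integrable_mult_right integrable_reward integrable_val_Xt)
  have "(\<integral>\<xi>. ?F \<xi> \<partial>iid \<psi>) = (\<integral>\<xi>. qval val (Zt \<xi> t) \<partial>iid \<psi>)"
    by (subst integral_resample[OF prob_space_axioms i, of t]) (simp only: Zt_upd Xt_Suc fun_upd_same qval_def)
  then show ?thesis
    using integrable_reward[of t] integrable_val_Xt[of "Suc t"] by simp
qed

text \<open>\<open>policy_value\<close> integrates the infinite sum. The envelope bounds the
  expected absolute summands by \<open>\<gamma> ^ t\<close> times a constant, which yields almost
  sure absolute convergence and the exchange of sum and integral.\<close>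

lemma policy_value_sums:
  "(\<lambda>t. \<gamma> ^ t * (\<integral>\<xi>. r (Zt \<xi> t) (\<xi> t) \<partial>iid \<psi>)) sums policy_value f r \<psi> \<gamma> \<pi> x"
proof -
  obtain R where R: "integrable \<psi> R" "\<And>z w. z \<in> Z \<Longrightarrow> w \<in> space \<psi> \<Longrightarrow> \<bar>r z w\<bar> \<le> R w"
    using ex_reward_envelope by blast
  let ?g = "\<lambda>t \<xi>. \<gamma> ^ t * r (Zt \<xi> t) (\<xi> t)"
  have gi: "integrable (iid \<psi>) (?g t)" for t by (intro integrable_mult_right integrable_reward)
  have ER: "(\<integral>\<xi>. \<bar>r (Zt \<xi> t) (\<xi> t)\<bar> \<partial>iid \<psi>) \<le> (\<integral>w. R w \<partial>\<psi>)" for t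
  proof -
    have "(\<integral>\<xi>. \<bar>r (Zt \<xi> t) (\<xi> t)\<bar> \<partial>iid \<psi>) \<le> (\<integral>\<xi>. R (\<xi> t) \<partial>iid \<psi>)"
    proof (rule integral_mono)
      show "\<bar>r (Zt \<xi> t) (\<xi> t)\<bar> \<le> R (\<xi> t)" if "\<xi> \<in> space (iid \<psi>)" for \<xi>
        using that by (intro R(2) Zt_in) (auto simp: space_iid)
    qed (use integrable_reward integrable_iid_component(1)[OF prob_space_axioms R(1)] in auto)
    then show ?thesis using integrable_iid_component(2)[OF prob_space_axioms R(1), of t] by simp
  qed
  have norm_le: "(\<integral>\<xi>. norm (?g t \<xi>) \<partial>iid \<psi>) \<le> \<gamma> ^ t * (\<integral>w. R w \<partial>\<psi>)" for t
    using mult_left_mono[OF ER, of "\<gamma> ^ t" t] discount by (simp add: abs_mult)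
  have sum_norm: "summable (\<lambda>t. \<integral>\<xi>. norm (?g t \<xi>) \<partial>iid \<psi>)"
  proof (rule summable_comparison_test')
    show "summable (\<lambda>t. \<gamma> ^ t * (\<integral>w. R w \<partial>\<psi>))"
      using discount by (intro summable_mult2 summable_geometric) auto
    show "norm (\<integral>\<xi>. norm (?g t \<xi>) \<partial>iid \<psi>) \<le> \<gamma> ^ t * (\<integral>w. R w \<partial>\<psi>)" for t
      using norm_le[of t] by (subst real_norm_def, subst abs_of_nonneg) (auto intro!: integral_nonneg_AE)
  qed
  have ae: "AE \<xi> in iid \<psi>. summable (\<lambda>t. norm (?g t \<xi>))"
  proof -
    have meas: "(\<lambda>\<xi>. ennreal (norm (?g t \<xi>))) \<in> borel_measurable (iid \<psi>)" for t
      by (rule measurable_compose[OF measurable_compose[OF borel_measurable_integrable[OF gi]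
            borel_measurable_norm] measurable_ennreal])
    have "(\<integral>\<^sup>+\<xi>. (\<Sum>t. ennreal (norm (?g t \<xi>))) \<partial>iid \<psi>) = (\<Sum>t. \<integral>\<^sup>+\<xi>. ennreal (norm (?g t \<xi>)) \<partial>iid \<psi>)"
      by (rule nn_integral_suminf[OF meas])
    also have "\<dots> = (\<Sum>t. ennreal (\<integral>\<xi>. norm (?g t \<xi>) \<partial>iid \<psi>))"
    proof (rule suminf_cong, rule nn_integral_eq_integral)
      show "integrable (iid \<psi>) (\<lambda>\<xi>. norm (?g t \<xi>))" for t
        by (rule Bochner_Integration.integrable_norm[OF gi])
    qed simp
    also have "\<dots> = ennreal (\<Sum>t. \<integral>\<xi>. norm (?g t \<xi>) \<partial>iid \<psi>)"
      by (rule suminf_ennreal2[OF _ sum_norm]) (auto intro!: integral_nonneg_AE)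
    finally have "(\<integral>\<^sup>+\<xi>. (\<Sum>t. ennreal (norm (?g t \<xi>))) \<partial>iid \<psi>) \<noteq> \<infinity>" by simp
    then have "AE \<xi> in iid \<psi>. (\<Sum>t. ennreal (norm (?g t \<xi>))) \<noteq> \<infinity>"
      using meas by (intro nn_integral_noteq_infinite borel_measurable_suminf_order) auto
    then show ?thesis
      by eventually_elim (rule summable_suminf_not_top, auto)
  qed
  have "(\<lambda>t. \<integral>\<xi>. ?g t \<xi> \<partial>iid \<psi>) sums (\<integral>\<xi>. (\<Sum>t. ?g t \<xi>) \<partial>iid \<psi>)"
    by (rule sums_integral[OF gi ae sum_norm])
  then show ?thesis by (simp add: policy_value_def)
qed

text \<open>The performance difference formula: the loss of a policy is the discounted sum of its
  expected one-step gaps. Upper and near-optimal lower bounds follow from the size of the gaps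
  alone.\<close>

lemma policy_value_gap:
  "(\<lambda>t. \<gamma> ^ t * (\<integral>\<xi>. val (Xt \<xi> t) - qval val (Zt \<xi> t) \<partial>iid \<psi>)) sums (val x - policy_value f r \<psi> \<gamma> \<pi> x)"
proof -
  interpret iid: prob_space "iid \<psi>" by (rule prob_space_iid[OF prob_space_axioms])
  define e where "e t = (\<integral>\<xi>. val (Xt \<xi> t) \<partial>iid \<psi>)" for t
  obtain K where K: "\<And>y. y \<in> X \<Longrightarrow> \<bar>val y\<bar> \<le> K" using val_bounded by (auto simp: bounded_iff)
  have "\<bar>e t\<bar> \<le> K" for t
  proof -
    have "\<bar>e t\<bar> \<le> (\<integral>\<xi>. K \<partial>iid \<psi>)"
      unfolding e_def
    proof (intro abs_integral_le integrable_val_Xt)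
      show "\<bar>val (Xt \<xi> t)\<bar> \<le> K" if "\<xi> \<in> space (iid \<psi>)" for \<xi>
        using Zt_in[OF that, of t] by (intro K) (rule SigmaD1)
    qed simp
    then show ?thesis by (simp add: iid.prob_space)
  qed
  then have eb: "norm (\<gamma> ^ t * e t) \<le> \<gamma> ^ t * K" for t
    using discount mult_left_mono[of "\<bar>e t\<bar>" K "\<gamma> ^ t"] by (simp add: abs_mult)
  have "(\<lambda>t. \<gamma> ^ t) \<longlonglongrightarrow> 0" using discount by (intro LIMSEQ_power_zero) simp
  then have "(\<lambda>t. \<gamma> ^ t * K) \<longlonglongrightarrow> 0" by (rule tendsto_mult_left_zero)
  then have "(\<lambda>t. \<gamma> ^ t * e t) \<longlonglongrightarrow> 0"
    by (rule Lim_null_comparison[OF always_eventually[OF allI[OF eb]]])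
  from telescope_sums'[OF this]
  have "(\<lambda>t. \<gamma> ^ t * e t - \<gamma> ^ Suc t * e (Suc t)) sums e 0" by simp
  moreover have "e 0 = val x" by (simp add: e_def state_def iid.prob_space)
  ultimately have "(\<lambda>t. (\<gamma> ^ t * e t - \<gamma> ^ Suc t * e (Suc t)) - \<gamma> ^ t * (\<integral>\<xi>. r (Zt \<xi> t) (\<xi> t) \<partial>iid \<psi>))
      sums (val x - policy_value f r \<psi> \<gamma> \<pi> x)"
    using policy_value_sums by (intro sums_diff) auto
  moreover have "(\<gamma> ^ t * e t - \<gamma> ^ Suc t * e (Suc t)) - \<gamma> ^ t * (\<integral>\<xi>. r (Zt \<xi> t) (\<xi> t) \<partial>iid \<psi>)
      = \<gamma> ^ t * (\<integral>\<xi>. val (Xt \<xi> t) - qval val (Zt \<xi> t) \<partial>iid \<psi>)" for t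
    using integral_step[of t, symmetric] integrable_val_Xt[of t] integrable_qval_Zt[of t]
    by (simp add: e_def algebra_simps)
  ultimately show ?thesis by simp
qed

lemma policy_value_le_val: "policy_value f r \<psi> \<gamma> \<pi> x \<le> val x"
proof -
  have "0 \<le> \<gamma> ^ t * (\<integral>\<xi>. val (Xt \<xi> t) - qval val (Zt \<xi> t) \<partial>iid \<psi>)" for t
    using discount qval_le_val[OF Zt_in, of _ t]
    by (intro mult_nonneg_nonneg integral_nonneg_AE AE_I2) auto
  then have "0 \<le> val x - policy_value f r \<psi> \<gamma> \<pi> x"
    by (rule sums_le[OF _ sums_zero policy_value_gap])
  then show ?thesis by simp
qed

lemma val_le_policy_value:
  assumes eps: "\<And>\<xi> t. \<xi> \<in> space (iid \<psi>) \<Longrightarrow> val (Xt \<xi> t) \<le> qval val (Zt \<xi> t) + \<epsilon>"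
  shows "val x \<le> policy_value f r \<psi> \<gamma> \<pi> x + \<epsilon> / (1 - \<gamma>)"
proof -
  interpret iid: prob_space "iid \<psi>" by (rule prob_space_iid[OF prob_space_axioms])
  have "(\<integral>\<xi>. val (Xt \<xi> t) - qval val (Zt \<xi> t) \<partial>iid \<psi>) \<le> (\<integral>\<xi>. \<epsilon> \<partial>iid \<psi>)" for t
    using integrable_val_Xt integrable_qval_Zt eps by (intro integral_mono) (auto simp: algebra_simps)
  then have "\<gamma> ^ t * (\<integral>\<xi>. val (Xt \<xi> t) - qval val (Zt \<xi> t) \<partial>iid \<psi>) \<le> \<gamma> ^ t * \<epsilon>" for t
    using discount by (intro mult_left_mono) (auto simp: iid.prob_space)
  moreover have "(\<lambda>t. \<gamma> ^ t * \<epsilon>) sums (1 / (1 - \<gamma>) * \<epsilon>)"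
    using discount by (intro sums_mult2 geometric_sums) auto
  ultimately have "val x - policy_value f r \<psi> \<gamma> \<pi> x \<le> 1 / (1 - \<gamma>) * \<epsilon>"
    by (rule sums_le[OF _ policy_value_gap])
  then show ?thesis by simp
qed

end

text \<open>By compactness of \<open>A\<close> and uniform continuity finitely many actions suffice; choosing the first
  one that is good enough makes the selector measurable.\<close>

lemma ex_near_optimal_selector:
  assumes "0 < \<epsilon>"
  shows "\<exists>g. g \<in> borel_on X \<rightarrow>\<^sub>M borel_on A \<and>
    (\<forall>x\<in>X. val x \<le> qval val (x, g x) + \<epsilon>)"
proof -
  have "uniformly_continuous_on Z (qval val)"
    by (intro compact_uniformly_continuous qval_val_continuous compact_Times compact_X compact_A)
  then obtain d where d: "0 < d" "\<And>z z'. z \<in> Z \<Longrightarrow> z' \<in> Z \<Longrightarrow> dist z' z < d \<Longrightarrow>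
      dist (qval val z') (qval val z) < \<epsilon> / 2"
    using assms by (auto simp: uniformly_continuous_on_def dest!: spec[of _ "\<epsilon> / 2"])
  obtain F where F: "finite F" "F \<subseteq> A" "A \<subseteq> (\<Union>a\<in>F. ball a d)"
    using compactE_image[OF compact_A, of A "\<lambda>a. ball a d"] d(1) by (metis UN_I centre_in_ball open_ball subsetI)
  obtain as where as: "set as = F" using finite_list[OF F(1)] by blast
  define good where "good x a \<longleftrightarrow> val x \<le> qval val (x, a) + \<epsilon>" for x a
  have ex: "\<exists>i. i < length as \<and> good x (as ! i)" if x: "x \<in> X" for x
  proof -
    \<comment> \<open>Half of \<epsilon> goes into almost attaining the supremum, half into moving
      to a nearby action of \<open>F\<close>.\<close>
    have "val x - \<epsilon> / 2 < (SUP a\<in>A. qval val (x, a))" using assms val_fixed[OF x] by simp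
    then obtain a where a: "a \<in> A" "val x - \<epsilon> / 2 < qval val (x, a)"
      using less_cSUP_iff[OF A_nonempty bdd_above_qval_val[OF x order_refl]] by blast
    then obtain b where b: "b \<in> F" "dist b a < d" using F(3) by auto
    have "dist (qval val (x, b)) (qval val (x, a)) < \<epsilon> / 2"
      using b a F(2) x by (intro d(2)) (auto simp: dist_Pair_Pair)
    then have "good x b" using a(2) unfolding good_def dist_real_def by linarith
    then show ?thesis using b(1) as by (metis in_set_conv_nth)
  qed
  define k where "k x = (LEAST i. i < length as \<and> good x (as ! i))" for x
  have k: "k x < length as" "good x (as ! k x)" if "x \<in> X" for x
    using LeastI_ex[OF ex[OF that]] by (auto simp: k_def)
  have k_in: "as ! k x \<in> A" if "x \<in> X" for x using k(1)[OF that] as F(2) by (metis nth_mem subsetD)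
  have good_meas: "Measurable.pred (borel_on X) (\<lambda>x. i < length as \<and> good x (as ! i))" for i
  proof (cases "i < length as")
    case True
    then have "as ! i \<in> A" using as F(2) by (metis nth_mem subsetD)
    then have "continuous_on X (\<lambda>x. qval val (x, as ! i))"
      by (intro continuous_on_compose2[OF qval_val_continuous]) (auto intro!: continuous_intros)
    then have [measurable]: "(\<lambda>x. qval val (x, as ! i)) \<in> borel_measurable (borel_on X)"
      by (rule borel_measurable_continuous_on_restrict)
    have [measurable]: "val \<in> borel_measurable (borel_on X)"
      by (rule borel_measurable_continuous_on_restrict[OF val_continuous])
    show ?thesis unfolding good_def by measurable
  qed simp
  have km: "k \<in> borel_on X \<rightarrow>\<^sub>M count_space UNIV"
    unfolding k_def[abs_def] by (intro measurable_Least good_meas)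
  have "(\<lambda>x. as ! k x) \<in> borel_on X \<rightarrow>\<^sub>M borel_on A"
    by (rule measurable_restrict_space2) (use k_in km in \<open>auto simp: space_restrict_space intro: measurable_compose\<close>)
  with k(2) show ?thesis unfolding good_def by blast
qed

lemma policies_Markov:
  assumes g: "g \<in> borel_on X \<rightarrow>\<^sub>M borel_on A"
  shows "(\<lambda>t h. g (h t)) \<in> policies X A"
  unfolding policies_def
  by (intro CollectI allI measurable_compose[OF _ g] measurable_component_singleton) auto

text \<open>Since the optimal value is a supremum, \<epsilon>-optimal stationary policies suffice
  and no exact measurable maximiser has to be constructed.\<close>

lemma opt_value_eq_val:
  assumes x: "x \<in> X"
  shows "opt_value X A f r \<psi> \<gamma> x = val x"
  unfolding opt_value_def
proof (rule antisym)
  have le: "policy_value f r \<psi> \<gamma> \<pi> x \<le> val x" if "\<pi> \<in> policies X A" for \<pi>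
    using that x by (rule policy_value_le_val)
  \<comment> \<open>Any accuracy would do: this only shows that some policy exists.\<close>
  obtain g where "g \<in> borel_on X \<rightarrow>\<^sub>M borel_on A"
    using ex_near_optimal_selector[of 1] zero_less_one by blast
  then have "policies X A \<noteq> {}" using policies_Markov by blast
  then show "(SUP \<pi>\<in>policies X A. policy_value f r \<psi> \<gamma> \<pi> x) \<le> val x"
    by (rule cSUP_least) (rule le)
  have bdd: "bdd_above ((\<lambda>\<pi>. policy_value f r \<psi> \<gamma> \<pi> x) ` policies X A)"
    by (rule bdd_aboveI2) (rule le)
  show "val x \<le> (SUP \<pi>\<in>policies X A. policy_value f r \<psi> \<gamma> \<pi> x)"
  proof (rule field_le_epsilon)
    fix e :: real assume "0 < e"
    \<comment> \<open>A one-step loss accumulates to \<open>1 / (1 - \<gamma>)\<close> times itself,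
      so the selector is taken this much more accurate.\<close>
    then have "0 < e * (1 - \<gamma>)" using discount by simp
    then obtain g where g: "g \<in> borel_on X \<rightarrow>\<^sub>M borel_on A"
      "\<And>x. x \<in> X \<Longrightarrow> val x \<le> qval val (x, g x) + e * (1 - \<gamma>)"
      using ex_near_optimal_selector by blast
    let ?\<pi> = "\<lambda>t h. g (h t)"
    have \<pi>: "?\<pi> \<in> policies X A" using g(1) by (rule policies_Markov)
    have "val x \<le> policy_value f r \<psi> \<gamma> ?\<pi> x + e * (1 - \<gamma>) / (1 - \<gamma>)"
    proof (rule val_le_policy_value[OF \<pi> x])
      fix \<xi> t assume "\<xi> \<in> space (iid \<psi>)"
      from Zt_in[OF \<pi> x this, of t]
      show "val (state f ?\<pi> x \<xi> t) \<le> qval val (state f ?\<pi> x \<xi> t, action f ?\<pi> x \<xi> t) + e * (1 - \<gamma>)"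
        using g(2) by (simp add: action_def state_def)
    qed
    also have "\<dots> = policy_value f r \<psi> \<gamma> ?\<pi> x + e" using discount by simp
    also have "policy_value f r \<psi> \<gamma> ?\<pi> x \<le> (SUP \<pi>\<in>policies X A. policy_value f r \<psi> \<gamma> \<pi> x)"
      by (rule cSUP_upper[OF \<pi> bdd])
    finally show "val x \<le> (SUP \<pi>\<in>policies X A. policy_value f r \<psi> \<gamma> \<pi> x) + e" by simp
  qed
qed

lemma opt_q_eq_qval:
  assumes z: "z \<in> Z"
  shows "opt_q X A f r \<psi> \<gamma> z = qval val z"
proof -
  have vm: "val \<in> borel_measurable (borel_on X)"
    by (rule borel_measurable_continuous_on_restrict[OF val_continuous])
  have "(\<integral>x'. opt_value X A f r \<psi> \<gamma> x' \<partial>trans_kernel X f \<psi> z) = (\<integral>x'. val x' \<partial>trans_kernel X f \<psi> z)"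
    by (intro Bochner_Integration.integral_cong refl opt_value_eq_val)
      (simp add: trans_kernel_def space_restrict_space)
  also have "\<dots> = (\<integral>w. val (f z w) \<partial>\<psi>)"
    unfolding trans_kernel_def by (rule integral_distr[OF measurable_f[OF z] vm])
  finally show ?thesis
    using integrable_r[OF z] holder_comp_f[OF z val_holder] by (simp add: opt_q_def mean_reward_def qval_def)
qed

end

section \<open>The empirical value function\<close>

lemma integral_uniform_count_eq_emp_mean:
  "(\<integral>i. \<phi> (s i) \<partial>uniform_count_measure {..<n}) = emp_mean n s \<phi>"
  by (simp add: emp_mean_def integral_uniform_count_measure)

lemma integrable_uniform_count: "integrable (uniform_count_measure {..<n::nat}) (\<phi> :: nat \<Rightarrow> real)"
  unfolding uniform_count_measure_def by (rule integrable_point_measure_finite) simp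

lemma prob_space_uniform_count: "1 \<le> n \<Longrightarrow> prob_space (uniform_count_measure {..<n::nat})"
  by (rule prob_space_uniform_count_measure) (auto simp: lessThan_empty_iff)

context noisy_mdp
begin

lemma emp_holder_mdp:
  assumes n: "1 \<le> n" and s: "s \<in> space (iid \<psi>)"
  shows "holder_mdp (uniform_count_measure {..<n}) X A (\<lambda>z i. f z (s i)) (\<lambda>z i. r z (s i)) \<gamma> \<alpha> \<l> (\<lambda>i. L (s i))"
proof -
  have s': "s i \<in> space \<psi>" for i using s by (simp add: space_iid)
  interpret N: prob_space "uniform_count_measure {..<n}" by (rule prob_space_uniform_count[OF n])
  show ?thesis
  proof
    show "(\<lambda>i. f z (s i)) \<in> uniform_count_measure {..<n} \<rightarrow>\<^sub>M borel_on X" if "z \<in> Z" for z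
      using f_in[OF that s'] by (simp add: measurable_def space_uniform_count_measure
          sets_uniform_count_measure space_restrict_space Pi_iff)
  qed (simp_all add: compact_X compact_A X_nonempty A_nonempty discount exponent \<l>_nonneg contraction
      integrable_uniform_count L_nonneg holder_r lipschitz_f s')
qed

text \<open>Linear in the sample mean of \<open>L\<close>, hence random, with moments controlled by
  those of \<open>L\<close>.\<close>

definition emp_hconst :: "nat \<Rightarrow> (nat \<Rightarrow> 'w) \<Rightarrow> real" where
  "emp_hconst n s = emp_mean n s L / (1 - \<gamma> * \<l> powr \<alpha>)"

abbreviation Vn :: "nat \<Rightarrow> (nat \<Rightarrow> 'w) \<Rightarrow> 'x \<Rightarrow> real" where
  "Vn n s \<equiv> emp_value X A f r \<gamma> n s"

text \<open>The iterates with the sample as an explicit argument, so that measurability in the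
  sample can be stated; \<open>iter\<close> belongs to a locale in which the sample is
  fixed.\<close>

primrec emp_iter :: "'a set \<Rightarrow> nat \<Rightarrow> nat \<Rightarrow> (nat \<Rightarrow> 'w) \<Rightarrow> 'x \<Rightarrow> real" where
  "emp_iter A0 m 0 t x = 0"
| "emp_iter A0 m (Suc k) t x = (SUP a\<in>A0. emp_mean m t (\<lambda>w. r (x, a) w + \<gamma> * emp_iter A0 m k t (f (x, a) w)))"

context
  fixes n :: nat and s :: "nat \<Rightarrow> 'w"
  assumes n: "1 \<le> n" and s: "s \<in> space (iid \<psi>)"
begin

interpretation emp: holder_mdp "uniform_count_measure {..<n}" X A "\<lambda>z i. f z (s i)" "\<lambda>z i. r z (s i)"
  \<gamma> \<alpha> \<l> "\<lambda>i. L (s i)"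
  by (rule emp_holder_mdp[OF n s])

lemma emp_qval_eq: "emp.qval v z = emp_mean n s (\<lambda>w. r z w + \<gamma> * v (f z w))"
  unfolding emp.qval_def by (rule integral_uniform_count_eq_emp_mean)

lemma emp_hconst_eq: "emp.hconst = emp_hconst n s"
  unfolding emp.hconst_def emp_hconst_def by (subst integral_uniform_count_eq_emp_mean) simp

text \<open>Evaluating \<open>THE\<close> requires uniqueness among all bounded functions, which
  \<open>val_unique\<close> supplies; integrability is automatic over finitely many indices.\<close>

lemma Vn_eq_val: "x \<in> X \<Longrightarrow> Vn n s x = emp.val x"
proof -
  let ?P = "\<lambda>v. v \<in> extensional X \<and> bounded (v ` X) \<and>
      (\<forall>x\<in>X. v x = (SUP a\<in>A. emp_mean n s (\<lambda>y. r (x, a) y + \<gamma> * v (f (x, a) y))))"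
  \<comment> \<open>\<open>emp.val\<close> is not controlled off \<open>X\<close>; its restriction
    is the extensional representative that the definition asks for.\<close>
  let ?v = "restrict emp.val X"
  have inX: "f z (s i) \<in> X" if "z \<in> Z" for z i
    using that s by (intro f_in) (auto simp: space_iid)
  have "(THE v. ?P v) = ?v"
  proof (rule the_equality)
    have "emp_mean n s (\<lambda>y. r z y + \<gamma> * ?v (f z y)) = emp.qval emp.val z" if "z \<in> Z" for z
      unfolding emp_qval_eq by (simp add: emp_mean_def inX[OF that])
    moreover have "?v ` X = emp.val ` X" by auto
    ultimately show "?P ?v" using emp.val_bounded emp.val_fixed by auto
  next
    fix v assume v: "?P v"
    then have "v x = emp.val x" if "x \<in> X" for x
      by (intro emp.val_unique that integrable_uniform_count) (auto simp: emp_qval_eq)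
    with v show "v = ?v" by (intro extensionalityI[of _ X]) auto
  qed
  then show "Vn n s x = emp.val x" if "x \<in> X" using that by (simp add: emp_value_def)
qed

lemma holder_Vn: "holder_bound \<alpha> (emp_hconst n s) X (Vn n s)"
  using emp.val_holder Vn_eq_val by (auto simp: holder_bound_def emp_hconst_eq)

lemma emp_hconst_nonneg: "0 \<le> emp_hconst n s"
  using emp.hconst_nonneg by (simp add: emp_hconst_eq)

lemma emp_mean_Vn:
  assumes "z \<in> Z"
  shows "emp_mean n s (\<lambda>w. r z w + \<gamma> * Vn n s (f z w)) = emp.qval emp.val z"
  unfolding emp_qval_eq using f_in[OF assms] s by (auto simp: emp_mean_def space_iid Vn_eq_val)

lemma Vn_fixed: "x \<in> X \<Longrightarrow> Vn n s x = (SUP a\<in>A. emp_mean n s (\<lambda>w. r (x, a) w + \<gamma> * Vn n s (f (x, a) w)))"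
  by (simp add: Vn_eq_val emp.val_fixed emp_mean_Vn cong: SUP_cong)

lemma bounded_Vn: "bounded (Vn n s ` X)"
  by (intro compact_imp_bounded compact_continuous_image compact_X
      holder_bound_imp_continuous_on[OF holder_Vn exponent])

lemma bdd_above_emp_mean_Vn:
  "x \<in> X \<Longrightarrow> bdd_above ((\<lambda>a. emp_mean n s (\<lambda>w. r (x, a) w + \<gamma> * Vn n s (f (x, a) w))) ` A)"
  using emp.bdd_above_qval_val[of x A] by (simp add: emp_mean_Vn cong: image_cong)

text \<open>Stated for an arbitrary \<open>v\<close>, because the Q-sample averages a function built
  from the V-sample.\<close>

lemma holder_emp_mean:
  assumes "holder_bound \<alpha> c X v" "0 \<le> c"
  shows "holder_bound \<alpha> (emp_mean n s L + \<gamma> * c * \<l> powr \<alpha>) Z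
    (\<lambda>z. emp_mean n s (\<lambda>w. r z w + \<gamma> * v (f z w)))"
  using emp.holder_qval[OF assms] unfolding emp_qval_eq[abs_def] by (simp add: integral_uniform_count_eq_emp_mean)

lemma emp_iter_eq: "emp_iter A0 n k s x = emp.iter A0 k x"
  by (induction k arbitrary: x) (simp_all add: emp.iter_def emp.bellman_def emp_qval_eq)

lemma emp_iter_tendsto: "A0 \<subseteq> A \<Longrightarrow> A \<subseteq> closure A0 \<Longrightarrow> x \<in> X \<Longrightarrow> (\<lambda>k. emp_iter A0 n k s x) \<longlonglongrightarrow> Vn n s x"
  using emp.iter_tendsto_val[of A0 x] by (simp add: emp_iter_eq Vn_eq_val)

lemma bdd_above_emp_iter:
  assumes "A0 \<subseteq> A" "A0 \<noteq> {}" "x \<in> X"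
  shows "bdd_above ((\<lambda>a. emp_mean n s (\<lambda>w. r (x, a) w + \<gamma> * emp_iter A0 n k s (f (x, a) w))) ` A0)"
  using emp.bdd_above_qval[OF emp.iter_holder[OF assms(1,2), of k] emp.hconst_nonneg assms(3,1)]
  by (simp add: emp_iter_eq emp_qval_eq)

end

text \<open>Measurability has to be joint in sample and state, since the recursion evaluates the
  previous iterate at a state depending on the sample. Countability of \<open>A0\<close> takes care
  of the supremum.\<close>

lemma measurable_emp_iter:
  assumes n: "1 \<le> n" and A0: "countable A0" "A0 \<subseteq> A" "A0 \<noteq> {}"
  shows "(\<lambda>(s, x). emp_iter A0 n k s x) \<in> borel_measurable (iid \<psi> \<Otimes>\<^sub>M borel_on X)"
proof (induction k)
  case 0
  show ?case by (simp add: case_prod_beta)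
next
  case (Suc k)
  let ?N = "iid \<psi> \<Otimes>\<^sub>M borel_on X"
  have "(\<lambda>p. SUP a\<in>A0. emp_mean n (fst p) (\<lambda>w. r (snd p, a) w + \<gamma> * emp_iter A0 n k (fst p) (f (snd p, a) w)))
      \<in> borel_measurable ?N"
  proof (rule borel_measurable_cSUP[OF A0(1)])
    fix a assume a: "a \<in> A0"
    have z: "(\<lambda>p. (snd p, a)) \<in> ?N \<rightarrow>\<^sub>M borel_on Z"
      by (rule measurable_Pair_restrict_borel[OF measurable_snd measurable_const])
        (use a A0 in \<open>auto simp: space_restrict_space\<close>)
    have w: "(\<lambda>p. fst p i) \<in> ?N \<rightarrow>\<^sub>M \<psi>" for i
      by (rule measurable_compose[OF measurable_fst measurable_component_singleton]) simp
    have "(\<lambda>p. emp_iter A0 n k (fst p) (f (snd p, a) (fst p i))) \<in> borel_measurable ?N" for i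
      using measurable_compose[OF measurable_Pair[OF measurable_fst measurable_comp_f[OF z w]] Suc, of i]
      by simp
    then show "(\<lambda>p. emp_mean n (fst p) (\<lambda>w. r (snd p, a) w + \<gamma> * emp_iter A0 n k (fst p) (f (snd p, a) w)))
        \<in> borel_measurable ?N"
      unfolding emp_mean_def
      by (intro borel_measurable_times borel_measurable_const borel_measurable_sum borel_measurable_add
          measurable_comp_r[OF z w])
  next
    fix p assume "p \<in> space ?N"
    then show "bdd_above ((\<lambda>a. emp_mean n (fst p)
        (\<lambda>w. r (snd p, a) w + \<gamma> * emp_iter A0 n k (fst p) (f (snd p, a) w))) ` A0)"
      by (intro bdd_above_emp_iter[OF n] A0) (auto simp: space_pair_measure space_restrict_space)
  qed
  then show ?case by (simp add: case_prod_beta)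
qed

text \<open>The estimator is the pointwise limit of value iteration over a countable dense set of
  actions.\<close>

lemma measurable_Vn:
  assumes n: "1 \<le> n"
  shows "(\<lambda>(s, x). Vn n s x) \<in> borel_measurable (iid \<psi> \<Otimes>\<^sub>M borel_on X)"
proof -
  obtain A0 where A0: "countable A0" "A0 \<subseteq> A" "A \<subseteq> closure A0"
    by (rule separable)
  have ne: "A0 \<noteq> {}" using A0 A_nonempty by auto
  show ?thesis
  proof (rule borel_measurable_LIMSEQ_metric[OF measurable_emp_iter[OF n A0(1,2) ne]])
    fix p assume "p \<in> space (iid \<psi> \<Otimes>\<^sub>M borel_on X)"
    then show "(\<lambda>k. case p of (s, x) \<Rightarrow> emp_iter A0 n k s x) \<longlonglongrightarrow> (case p of (s, x) \<Rightarrow> Vn n s x)"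
      using emp_iter_tendsto[OF n _ A0(2,3)] by (auto simp: space_pair_measure space_restrict_space)
  qed
qed

lemma measurable_Vn_comp:
  assumes "1 \<le> n" "g \<in> M \<rightarrow>\<^sub>M iid \<psi>" "h \<in> M \<rightarrow>\<^sub>M borel_on X"
  shows "(\<lambda>t. Vn n (g t) (h t)) \<in> borel_measurable M"
  using measurable_compose[OF measurable_Pair[OF assms(2,3)] measurable_Vn[OF assms(1)]] by simp

end

section \<open>Rates of convergence\<close>

abbreviation scaled_moment :: "'b measure \<Rightarrow> (nat \<Rightarrow> 'b \<Rightarrow> real) \<Rightarrow> nat \<Rightarrow> nat \<Rightarrow> ennreal" where
  "scaled_moment M U k n \<equiv> \<integral>\<^sup>+x. ennreal ((sqrt n * U n x) ^ k) \<partial>M"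

text \<open>Convergence at rate \<open>1 / sqrt n\<close> in every moment. The nonnegative integral
  makes integrability part of the bound, and the class is closed under sums, nonnegative multiples
  and measure-preserving maps.\<close>

definition root_rate :: "'b measure \<Rightarrow> (nat \<Rightarrow> 'b \<Rightarrow> real) \<Rightarrow> bool" where
  "root_rate M U \<longleftrightarrow>
    (\<forall>n\<ge>1. U n \<in> borel_measurable M \<and> (\<forall>x\<in>space M. 0 \<le> U n x)) \<and>
    (\<forall>k. \<exists>C\<ge>0. \<forall>n\<ge>1. scaled_moment M U k n \<le> ennreal C)"

lemma root_rate_measurable: "root_rate M U \<Longrightarrow> 1 \<le> n \<Longrightarrow> U n \<in> borel_measurable M"
  by (simp add: root_rate_def)

lemma root_rate_nonneg: "root_rate M U \<Longrightarrow> 1 \<le> n \<Longrightarrow> x \<in> space M \<Longrightarrow> 0 \<le> U n x"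
  by (simp add: root_rate_def)

lemma root_rate_bound:
  "root_rate M U \<Longrightarrow> \<exists>C\<ge>0. \<forall>n\<ge>1. scaled_moment M U k n \<le> ennreal C"
  by (simp add: root_rate_def)

text \<open>Even moments beyond a cutoff suffice, as \<open>u ^ k \<le> 1 + u ^ (2 * m)\<close> for
  nonnegative \<open>u\<close> once \<open>k \<le> 2 * m\<close>. The cutoff is there because
  chaining only delivers high moments.\<close>

lemma root_rateI:
  assumes M: "prob_space M"
    and meas: "\<And>n. 1 \<le> n \<Longrightarrow> U n \<in> borel_measurable M"
    and nn: "\<And>n x. 1 \<le> n \<Longrightarrow> x \<in> space M \<Longrightarrow> 0 \<le> U n x"
    and bound: "\<And>m. cutoff \<le> m \<Longrightarrow> \<exists>C\<ge>0. \<forall>n\<ge>1. (\<integral>\<^sup>+x. ennreal (U n x ^ (2 * m)) \<partial>M) \<le> ennreal (C / real n ^ m)"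
  shows "root_rate M U"
  unfolding root_rate_def
proof (intro conjI allI impI ballI)
  fix k
  interpret prob_space M by fact
  \<comment> \<open>Beyond the cutoff and with \<open>k \<le> 2 * m\<close>.\<close>
  define m where "m = cutoff + k"
  obtain C where C: "0 \<le> C" "\<And>n. 1 \<le> n \<Longrightarrow> (\<integral>\<^sup>+x. ennreal (U n x ^ (2 * m)) \<partial>M) \<le> ennreal (C / real n ^ m)"
    using bound[of m] by (auto simp: m_def)
  have "scaled_moment M U k n \<le> ennreal (1 + C)" if n: "1 \<le> n" for n
  proof -
    note [measurable] = meas[OF n]
    have sq: "sqrt (real n) ^ (2 * m) = real n ^ m" by (simp add: power_mult)
    have "scaled_moment M U k n \<le>
        (\<integral>\<^sup>+x. 1 + ennreal (real n ^ m) * ennreal (U n x ^ (2 * m)) \<partial>M)"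
    proof (rule nn_integral_mono)
      fix x assume "x \<in> space M"
      then have U: "0 \<le> sqrt n * U n x" using nn[OF n] by simp
      have "(sqrt n * U n x) ^ k \<le> 1 + (sqrt n * U n x) ^ (2 * m)"
      proof (cases "sqrt n * U n x \<le> 1")
        case True
        then have "(sqrt n * U n x) ^ k \<le> 1" using U by (rule power_le_one[rotated])
        then show ?thesis using zero_le_power[OF U, of "2 * m"] by linarith
      next
        case False
        then have "(sqrt n * U n x) ^ k \<le> (sqrt n * U n x) ^ (2 * m)"
          by (intro power_increasing) (auto simp: m_def)
        then show ?thesis by linarith
      qed
      then have "ennreal ((sqrt n * U n x) ^ k) \<le> ennreal (1 + real n ^ m * U n x ^ (2 * m))"
        by (intro ennreal_leI) (simp add: power_mult_distrib sq)
      also have "\<dots> = 1 + ennreal (real n ^ m) * ennreal (U n x ^ (2 * m))"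
        by (subst ennreal_plus) (auto simp: ennreal_mult power_mult)
      finally show "ennreal ((sqrt n * U n x) ^ k) \<le> \<dots>" .
    qed
    also have "\<dots> = 1 + ennreal (real n ^ m) * (\<integral>\<^sup>+x. ennreal (U n x ^ (2 * m)) \<partial>M)"
      by (subst nn_integral_add) (auto simp: nn_integral_cmult emeasure_space_1)
    also have "\<dots> \<le> 1 + ennreal (real n ^ m) * ennreal (C / real n ^ m)"
      by (intro add_left_mono mult_left_mono C n) simp
    also have "\<dots> = ennreal (1 + C)"
      using C(1) n by (subst ennreal_mult[symmetric]) (auto simp: ennreal_plus)
    finally show ?thesis .
  qed
  then show "\<exists>C\<ge>0. \<forall>n\<ge>1. scaled_moment M U k n \<le> ennreal C"
    using C(1) by (intro exI[of _ "1 + C"]) auto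
qed (use meas nn in auto)

lemma root_rate_add:
  assumes U: "root_rate M U" and V: "root_rate M V"
  shows "root_rate M (\<lambda>n x. U n x + V n x)"
  unfolding root_rate_def
proof (intro conjI allI impI ballI)
  fix k
  obtain C D where C: "0 \<le> C" "\<And>n. 1 \<le> n \<Longrightarrow> scaled_moment M U k n \<le> ennreal C"
    and D: "0 \<le> D" "\<And>n. 1 \<le> n \<Longrightarrow> scaled_moment M V k n \<le> ennreal D"
    using root_rate_bound[OF U, of k] root_rate_bound[OF V, of k] by auto
  have "(\<integral>\<^sup>+x. ennreal ((sqrt n * (U n x + V n x)) ^ k) \<partial>M) \<le> ennreal (2 ^ k * (C + D))" if n: "1 \<le> n" for n
  proof -
    note [measurable] = root_rate_measurable[OF U n] root_rate_measurable[OF V n]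
    have "(\<integral>\<^sup>+x. ennreal ((sqrt n * (U n x + V n x)) ^ k) \<partial>M) \<le>
        (\<integral>\<^sup>+x. ennreal (2 ^ k) * (ennreal ((sqrt n * U n x) ^ k) + ennreal ((sqrt n * V n x) ^ k)) \<partial>M)"
    proof (rule nn_integral_mono)
      fix x assume x: "x \<in> space M"
      have nn: "0 \<le> sqrt n * U n x" "0 \<le> sqrt n * V n x"
        using root_rate_nonneg[OF U n x] root_rate_nonneg[OF V n x] by auto
      have "(sqrt n * (U n x + V n x)) ^ k \<le> 2 ^ k * ((sqrt n * U n x) ^ k + (sqrt n * V n x) ^ k)"
        using abs_add_power_le[of "sqrt n * U n x" "sqrt n * V n x" k] nn by (simp add: distrib_left)
      then show "ennreal ((sqrt n * (U n x + V n x)) ^ k) \<le>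
          ennreal (2 ^ k) * (ennreal ((sqrt n * U n x) ^ k) + ennreal ((sqrt n * V n x) ^ k))"
        using nn by (simp only: ennreal_plus[symmetric] ennreal_mult[symmetric] zero_le_power
            add_nonneg_nonneg zero_le_numeral ennreal_leI)
    qed
    also have "\<dots> = ennreal (2 ^ k) * (scaled_moment M U k n
        + scaled_moment M V k n)"
      by (simp add: nn_integral_cmult nn_integral_add)
    also have "\<dots> \<le> ennreal (2 ^ k) * (ennreal C + ennreal D)"
      by (intro mult_left_mono add_mono C D n) simp
    also have "\<dots> = ennreal (2 ^ k * (C + D))"
      using C(1) D(1) by (simp only: ennreal_plus[symmetric] ennreal_mult[symmetric] zero_le_power
            add_nonneg_nonneg zero_le_numeral)
    finally show ?thesis .
  qed
  then show "\<exists>C\<ge>0. \<forall>n\<ge>1. (\<integral>\<^sup>+x. ennreal ((sqrt n * (U n x + V n x)) ^ k) \<partial>M) \<le> ennreal C"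
    using C(1) D(1) by (intro exI[of _ "2 ^ k * (C + D)"]) auto
qed (auto simp del: One_nat_def intro: borel_measurable_add root_rate_measurable U V add_nonneg_nonneg root_rate_nonneg)

lemma root_rate_cmult:
  assumes U: "root_rate M U" and c: "0 \<le> c"
  shows "root_rate M (\<lambda>n x. c * U n x)"
  unfolding root_rate_def
proof (intro conjI allI impI ballI)
  fix k
  obtain C where C: "0 \<le> C" "\<And>n. 1 \<le> n \<Longrightarrow> scaled_moment M U k n \<le> ennreal C"
    using root_rate_bound[OF U, of k] by auto
  have "(\<integral>\<^sup>+x. ennreal ((sqrt n * (c * U n x)) ^ k) \<partial>M) \<le> ennreal (c ^ k * C)" if n: "1 \<le> n" for n
  proof -
    note [measurable] = root_rate_measurable[OF U n]
    have "(\<integral>\<^sup>+x. ennreal ((sqrt n * (c * U n x)) ^ k) \<partial>M) =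
        (\<integral>\<^sup>+x. ennreal (c ^ k) * ennreal ((sqrt n * U n x) ^ k) \<partial>M)"
    proof (rule nn_integral_cong)
      fix x assume "x \<in> space M"
      then have "0 \<le> U n x" by (rule root_rate_nonneg[OF U n])
      then show "ennreal ((sqrt n * (c * U n x)) ^ k) = ennreal (c ^ k) * ennreal ((sqrt n * U n x) ^ k)"
        using c by (subst ennreal_mult[symmetric]) (auto simp: power_mult_distrib mult_ac)
    qed
    also have "\<dots> = ennreal (c ^ k) * scaled_moment M U k n"
      by (simp add: nn_integral_cmult)
    also have "\<dots> \<le> ennreal (c ^ k) * ennreal C" by (intro mult_left_mono C n) simp
    also have "\<dots> = ennreal (c ^ k * C)" using c C(1) by (simp add: ennreal_mult)
    finally show ?thesis .
  qed
  then show "\<exists>C\<ge>0. \<forall>n\<ge>1. (\<integral>\<^sup>+x. ennreal ((sqrt n * (c * U n x)) ^ k) \<partial>M) \<le> ennreal C"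
    using C(1) c by (intro exI[of _ "c ^ k * C"]) auto
qed (use c in \<open>auto simp del: One_nat_def intro: borel_measurable_times[OF borel_measurable_const] root_rate_measurable U mult_nonneg_nonneg root_rate_nonneg\<close>)

text \<open>A deterministic term of the right order, added to the final bounds to make them strictly
  positive.\<close>

lemma root_rate_inverse_sqrt: "prob_space M \<Longrightarrow> root_rate M (\<lambda>n _. 1 / sqrt (real n))"
  by (rule root_rateI[where cutoff = 0])
    (auto intro!: exI[of _ 1] simp: prob_space.emeasure_space_1 power_divide power_mult)

lemma root_rate_distr:
  assumes U: "root_rate N U" and T: "T \<in> M \<rightarrow>\<^sub>M N" and d: "distr M N T = N"
  shows "root_rate M (\<lambda>n x. U n (T x))"
  unfolding root_rate_def
proof (intro conjI allI impI ballI)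
  show "(\<lambda>x. U n (T x)) \<in> borel_measurable M" if "1 \<le> n" for n
    by (rule measurable_compose[OF T root_rate_measurable[OF U that]])
  show "0 \<le> U n (T x)" if "1 \<le> n" "x \<in> space M" for n x
    by (rule root_rate_nonneg[OF U that(1) measurable_space[OF T that(2)]])
  fix k
  have "(\<integral>\<^sup>+x. ennreal ((sqrt n * U n (T x)) ^ k) \<partial>M) = (\<integral>\<^sup>+x. ennreal ((sqrt n * U n x) ^ k) \<partial>N)"
    if n: "1 \<le> n" for n
  proof -
    note [measurable] = root_rate_measurable[OF U n]
    have "(\<integral>\<^sup>+x. ennreal ((sqrt n * U n x) ^ k) \<partial>distr M N T) = (\<integral>\<^sup>+x. ennreal ((sqrt n * U n (T x)) ^ k) \<partial>M)"
      by (rule nn_integral_distr[OF T]) (simp add: d)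
    then show ?thesis unfolding d by simp
  qed
  with root_rate_bound[OF U, of k]
  show "\<exists>C\<ge>0. \<forall>n\<ge>1. (\<integral>\<^sup>+x. ennreal ((sqrt n * U n (T x)) ^ k) \<partial>M) \<le> ennreal C" by simp
qed

lemma root_rate_moments:
  assumes U: "root_rate M U"
  shows "\<exists>C. \<forall>n\<ge>1. integrable M (\<lambda>x. U n x ^ k) \<and> (\<integral>x. U n x ^ k \<partial>M) \<le> C * real n powr (- real k / 2)"
proof -
  obtain C where C: "0 \<le> C" "\<And>n. 1 \<le> n \<Longrightarrow> scaled_moment M U k n \<le> ennreal C"
    using root_rate_bound[OF U, of k] by auto
  have "integrable M (\<lambda>x. U n x ^ k) \<and> (\<integral>x. U n x ^ k \<partial>M) \<le> C * real n powr (- real k / 2)"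
    if n: "1 \<le> n" for n
  proof -
    note [measurable] = root_rate_measurable[OF U n]
    have n0: "n \<noteq> 0" using n by simp
    then have s: "0 < sqrt (real n) ^ k" by simp
    have nn: "AE x in M. 0 \<le> (sqrt n * U n x) ^ k" using root_rate_nonneg[OF U n] by auto
    have "scaled_moment M U k n < \<infinity>"
      using C(2)[OF n] by (rule le_less_trans) simp
    then have i: "integrable M (\<lambda>x. (sqrt n * U n x) ^ k)"
      by (intro integrableI_nonneg nn) measurable
    then have "integrable M (\<lambda>x. (sqrt n * U n x) ^ k / sqrt n ^ k)" by (rule integrable_divide)
    then have iU: "integrable M (\<lambda>x. U n x ^ k)" using n0 by (simp add: power_mult_distrib)
    have "ennreal (\<integral>x. (sqrt n * U n x) ^ k \<partial>M) \<le> ennreal C"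
      using C(2)[OF n] by (subst nn_integral_eq_integral[OF i nn, symmetric])
    then have "(\<integral>x. (sqrt n * U n x) ^ k \<partial>M) \<le> C" using C(1) by (simp add: ennreal_le_iff)
    then have "sqrt n ^ k * (\<integral>x. U n x ^ k \<partial>M) \<le> C" by (simp add: power_mult_distrib)
    then have "(\<integral>x. U n x ^ k \<partial>M) \<le> C / sqrt n ^ k" using s by (simp add: field_simps)
    also have "sqrt n ^ k = real n powr (real k / 2)"
    proof -
      have "sqrt n = real n powr (1 / 2)" by (simp add: powr_half_sqrt)
      moreover have "(real n powr (1 / 2)) ^ k = (real n powr (1 / 2)) powr real k"
        using n0 by (intro powr_realpow[symmetric]) simp
      ultimately show ?thesis by (simp only: powr_powr) simp
    qed
    also have "C / real n powr (real k / 2) = C * real n powr (- real k / 2)"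
      using powr_minus[of "real n" "real k / 2"] by (simp only: minus_divide_left divide_inverse[of C])
    finally show ?thesis using iU by (rule conjI[rotated])
  qed
  then show ?thesis by blast
qed

text \<open>Jensen's inequality for the uniform weights. It moves the power of the random Hoelder
  constant onto single observations.\<close>

lemma emp_mean_even_power_le:
  assumes n: "1 \<le> n"
  shows "emp_mean n s \<phi> ^ (2 * m) \<le> emp_mean n s (\<lambda>w. \<phi> w ^ (2 * m))"
proof -
  have "convex_on UNIV (\<lambda>x :: real. x ^ (2 * m))" by (rule convex_power_even) simp
  moreover have "(\<Sum>i<n. 1 / real n) = 1" using n by simp
  ultimately have "(\<Sum>i<n. (1 / real n) *\<^sub>R \<phi> (s i)) ^ (2 * m) \<le> (\<Sum>i<n. (1 / real n) * \<phi> (s i) ^ (2 * m))"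
    using n by (intro convex_on_sum[of "{..<n}" UNIV "\<lambda>x. x ^ (2 * m)" "\<lambda>_. 1 / real n" "\<lambda>i. \<phi> (s i)"])
      (auto simp: lessThan_empty_iff)
  then show ?thesis by (simp add: emp_mean_def sum_distrib_left)
qed

lemma integral_emp_mean:
  assumes "prob_space \<psi>" "integrable \<psi> g" "1 \<le> n"
  shows "integrable (iid \<psi>) (\<lambda>t. emp_mean n t g)" "(\<integral>t. emp_mean n t g \<partial>iid \<psi>) = (\<integral>w. g w \<partial>\<psi>)"
  unfolding emp_mean_def using integrable_iid_component[OF assms(1,2)] assms(3)
  by (simp_all add: Bochner_Integration.integral_sum)

lemma emp_dev_diff:
  assumes "integrable \<psi> g" "integrable \<psi> h"
  shows "emp_dev \<psi> n t g - emp_dev \<psi> n t h = emp_dev \<psi> n t (\<lambda>w. g w - h w)"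
  using assms by (simp add: emp_dev_def emp_mean_def sum_subtractf right_diff_distrib)

lemma abs_emp_mean_le:
  assumes "1 \<le> n" "\<And>i. \<bar>g (t i)\<bar> \<le> h (t i)"
  shows "\<bar>emp_mean n t g\<bar> \<le> emp_mean n t h"
proof -
  have "\<bar>\<Sum>i<n. g (t i)\<bar> \<le> (\<Sum>i<n. h (t i))"
    by (rule order_trans[OF sum_abs sum_mono]) (rule assms(2))
  then show ?thesis by (simp add: emp_mean_def abs_mult divide_right_mono)
qed

lemma emp_mean_const: "1 \<le> n \<Longrightarrow> emp_mean n t (\<lambda>_. c) = c"
  by (simp add: emp_mean_def)

section \<open>Deviations of the empirical Bellman operator\<close>

locale chained_mdp = noisy_mdp \<psi> X A f r \<gamma> \<alpha> \<l> L + chaining "X \<times> A" q \<alpha> J C B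
  for \<psi> :: "'w measure" and X :: "'x::euclidean_space set" and A :: "'a::euclidean_space set"
    and f r \<gamma> \<alpha> \<l> L q J C B +
  fixes z0 :: "'x \<times> 'a" and D :: real
  assumes z0: "z0 \<in> X \<times> A" and moments_L: "all_moments \<psi> L" and moments_r: "all_moments \<psi> (r z0)"
    and q: "0 < q" "q < \<alpha>"
    and diam: "0 < D" "\<And>z z'. z \<in> X \<times> A \<Longrightarrow> z' \<in> X \<times> A \<Longrightarrow> norm (z - z') \<le> D"
begin

definition integrand :: "('x \<Rightarrow> real) \<Rightarrow> 'x \<times> 'a \<Rightarrow> 'w \<Rightarrow> real" where
  "integrand v z w = r z w + \<gamma> * v (f z w)"

definition dev :: "('x \<Rightarrow> real) \<Rightarrow> nat \<Rightarrow> (nat \<Rightarrow> 'w) \<Rightarrow> 'x \<times> 'a \<Rightarrow> real" where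
  "dev v n t z = emp_dev \<psi> n t (integrand v z)"

lemma dev_eq: "dev v n t z = emp_mean n t (integrand v z) - qval v z"
  by (simp add: dev_def emp_dev_def integrand_def[abs_def] qval_def)

lemma all_moments_integrand:
  assumes v: "holder_bound \<alpha> c X v" and z: "z \<in> Z"
  shows "all_moments \<psi> (integrand v z)"
proof -
  have cont: "continuous_on X v" by (rule holder_bound_imp_continuous_on[OF v exponent])
  obtain K where K: "\<And>x. x \<in> X \<Longrightarrow> \<bar>v x\<bar> \<le> K"
    using compact_imp_bounded[OF compact_continuous_image[OF cont compact_X]] by (auto simp: bounded_iff)
  have "all_moments \<psi> (\<lambda>w. v (f z w))"
  proof (rule all_moments_dominated[OF all_moments_const[of K]])
    show "(\<lambda>w. v (f z w)) \<in> borel_measurable \<psi>"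
      by (rule measurable_compose[OF measurable_f[OF z] borel_measurable_continuous_on_restrict[OF cont]])
    show "\<bar>v (f z w)\<bar> \<le> \<bar>K\<bar>" if "w \<in> space \<psi>" for w
      using K[OF f_in[OF z that]] by linarith
  qed
  moreover have "all_moments \<psi> (r z)"
  proof -
    have abs: "all_moments \<psi> (\<lambda>w. \<bar>r z0 w\<bar>)"
      by (rule all_moments_dominated[OF moments_r]) (use all_moments_measurable[OF moments_r] in auto)
    have env: "all_moments \<psi> (\<lambda>w. \<bar>r z0 w\<bar> + norm (z - z0) powr \<alpha> * L w)"
      by (intro all_moments_add abs all_moments_cmult moments_L)
    show ?thesis
    proof (rule all_moments_dominated[OF env])
      show "r z \<in> borel_measurable \<psi>" using integrable_r[OF z] by auto
      show "\<bar>r z w\<bar> \<le> \<bar>\<bar>r z0 w\<bar> + norm (z - z0) powr \<alpha> * L w\<bar>" if "w \<in> space \<psi>" for w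
        using holder_r[OF z z0 that] by (simp add: mult.commute)
    qed
  qed
  ultimately show ?thesis unfolding integrand_def[abs_def] by (intro all_moments_add all_moments_cmult)
qed

text \<open>The envelope \<open>L w + 1\<close> is free of \<open>c\<close>; all dependence on
  \<open>c\<close> sits in the scalar factor. This matters when \<open>c\<close> is the random
  constant of the V-sample.\<close>

lemma integrand_diff_le:
  assumes v: "holder_bound \<alpha> c X v" "0 \<le> c" and z: "z \<in> Z" "z' \<in> Z" and w: "w \<in> space \<psi>"
  shows "\<bar>integrand v z w - integrand v z' w\<bar> \<le>
    (1 + \<gamma> * c * \<l> powr \<alpha>) * norm (z - z') powr \<alpha> * (L w + 1)"
proof -
  let ?k = "\<gamma> * c * \<l> powr \<alpha>"
  have k: "0 \<le> ?k" using v(2) discount by simp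
  have "L w + ?k \<le> (1 + ?k) * (L w + 1)"
    using mult_nonneg_nonneg[OF k L_nonneg[OF w]] by (simp add: algebra_simps)
  then have "(L w + ?k) * norm (z - z') powr \<alpha> \<le> (1 + ?k) * (L w + 1) * norm (z - z') powr \<alpha>"
    by (rule mult_right_mono) simp
  with holder_integrand[OF v z w] show ?thesis unfolding integrand_def by (simp add: mult_ac)
qed

text \<open>Empirical and true Hoelder constants added. For each sample it supplies continuity and a
  finite \<open>chain_sup\<close>.\<close>

definition dev_hconst :: "real \<Rightarrow> nat \<Rightarrow> (nat \<Rightarrow> 'w) \<Rightarrow> real" where
  "dev_hconst c n t = (emp_mean n t L + \<gamma> * c * \<l> powr \<alpha>) + ((\<integral>w. L w \<partial>\<psi>) + \<gamma> * c * \<l> powr \<alpha>)"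

lemma holder_dev:
  assumes v: "holder_bound \<alpha> c X v" "0 \<le> c" and n: "1 \<le> n" and t: "t \<in> space (iid \<psi>)"
  shows "holder_bound \<alpha> (dev_hconst c n t) Z (dev v n t)"
  unfolding holder_bound_def
proof (intro ballI)
  fix z z' assume z: "z \<in> Z" "z' \<in> Z"
  from holder_boundD[OF holder_emp_mean[OF n t v] z] holder_boundD[OF holder_qval[OF v] z]
  show "\<bar>dev v n t z - dev v n t z'\<bar> \<le>
      dev_hconst c n t * norm (z - z') powr \<alpha>"
    unfolding dev_eq integrand_def dev_hconst_def distrib_right[of _ _ "norm (z - z') powr \<alpha>"] by linarith
qed

lemma all_moments_dev:
  assumes v: "holder_bound \<alpha> c X v" and z: "z \<in> Z" and n: "1 \<le> n"
  shows "all_moments (iid \<psi>) (\<lambda>t. dev v n t z)"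
  unfolding dev_def
proof (rule emp_dev_moment(1)[OF prob_space_axioms _ _ _ _ n])
  show am: "all_moments \<psi> (\<lambda>w. \<bar>integrand v z w\<bar>)"
    by (rule all_moments_dominated[OF all_moments_integrand[OF v z]])
      (use all_moments_measurable[OF all_moments_integrand[OF v z]] in auto)
  show "integrand v z \<in> borel_measurable \<psi>"
    by (rule all_moments_measurable[OF all_moments_integrand[OF v z]])
  show "\<bar>integrand v z w\<bar> \<le> 1 * \<bar>integrand v z w\<bar>" for w by simp
qed simp

abbreviation "envelope w \<equiv> L w + 1"

lemma dev_chain_moment:
  assumes v: "holder_bound \<alpha> c X v" "0 \<le> c" and n: "1 \<le> n"
    and m: "4 ^ DIM('x \<times> 'a) * (2 powr (q - \<alpha>)) ^ (2 * m) < 1" "0 < m"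
  shows "(\<integral>\<^sup>+t. ennreal (chain_sup (dev v n t) ^ (2 * m)) \<partial>iid \<psi>) \<le>
    ennreal (emp_dev_const \<psi> envelope m * (1 + \<gamma> * c * \<l> powr \<alpha>) ^ (2 * m) / real n ^ m * weight_sum m)"
proof (rule chain_sup_moment[OF all_moments_dev[OF v(1) _ n] holder_dev[OF v n] m])
  let ?k = "1 + \<gamma> * c * \<l> powr \<alpha>"
  have k: "0 \<le> ?k" using v(2) discount by simp
  show "0 \<le> emp_dev_const \<psi> envelope m * ?k ^ (2 * m) / real n ^ m"
    using emp_dev_const_nonneg k by (intro divide_nonneg_nonneg mult_nonneg_nonneg) auto
  show "finite_measure (iid \<psi>)"
    using prob_space_iid[OF prob_space_axioms] by (rule prob_space.finite_measure)
  fix u u' assume u: "u \<in> Z" "u' \<in> Z"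
  note am = all_moments_integrand[OF v(1) u(1)] all_moments_integrand[OF v(1) u(2)]
  have "(\<integral>t. emp_dev \<psi> n t (\<lambda>w. integrand v u w - integrand v u' w) ^ (2 * m) \<partial>iid \<psi>) \<le>
      emp_dev_const \<psi> envelope m * (?k * norm (u - u') powr \<alpha>) ^ (2 * m) / real n ^ m"
  proof (rule emp_dev_moment(2)[OF prob_space_axioms _ _ _ _ n])
    show "all_moments \<psi> envelope" by (intro all_moments_add moments_L all_moments_const)
    show "(\<lambda>w. integrand v u w - integrand v u' w) \<in> borel_measurable \<psi>"
      by (intro all_moments_measurable all_moments_diff am)
    show "0 \<le> ?k * norm (u - u') powr \<alpha>" using k by simp
  qed (rule integrand_diff_le[OF v u])
  then show "(\<integral>t. (dev v n t u - dev v n t u') ^ (2 * m) \<partial>iid \<psi>) \<le>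
      emp_dev_const \<psi> envelope m * ?k ^ (2 * m) / real n ^ m * (norm (u - u') powr \<alpha>) ^ (2 * m)"
    unfolding dev_def using am by (simp add: emp_dev_diff all_moments_integrable power_mult_distrib)
qed

text \<open>As \<open>q < \<alpha>\<close> the base \<open>2 powr (q - \<alpha>)\<close> is below 1,
  so high moments beat the entropy factor of the nets.\<close>

lemma eventually_moment_condition:
  "\<exists>m0. \<forall>m\<ge>m0. 4 ^ DIM('x \<times> 'a) * (2 powr (q - \<alpha>)) ^ (2 * m) < 1 \<and> 0 < m"
proof -
  have x: "0 \<le> (2 powr (q - \<alpha>)) ^ 2" "(2 powr (q - \<alpha>)) ^ 2 < 1"
    using q by (auto simp: power_less_one_iff powr_less_one)
  have "(\<lambda>m. 4 ^ DIM('x \<times> 'a) * ((2 powr (q - \<alpha>)) ^ 2) ^ m) \<longlonglongrightarrow> 4 ^ DIM('x \<times> 'a) * 0"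
    using x by (intro tendsto_mult tendsto_const LIMSEQ_power_zero) simp
  from order_tendstoD(2)[OF this, of 1]
  have "eventually (\<lambda>m. 4 ^ DIM('x \<times> 'a) * (2 powr (q - \<alpha>)) ^ (2 * m) < 1) sequentially"
    by (simp add: power_mult)
  then have "eventually (\<lambda>m. 4 ^ DIM('x \<times> 'a) * (2 powr (q - \<alpha>)) ^ (2 * m) < 1 \<and> 0 < m) sequentially"
    using eventually_gt_at_top[of 0] by (rule eventually_conj)
  then show ?thesis by (simp add: eventually_sequentially)
qed

text \<open>A measurable majorant of the supremum of the deviation over \<open>Z\<close>: its value
  at an anchor plus its oscillation across the diameter.\<close>

definition dev_bound :: "nat \<Rightarrow> (nat \<Rightarrow> 'w) \<Rightarrow> real" where
  "dev_bound n t = \<bar>dev val n t z0\<bar> + C * D powr q * chain_sup (dev val n t)"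

lemma dev_le_dev_bound:
  assumes n: "1 \<le> n" and t: "t \<in> space (iid \<psi>)" and z: "z \<in> Z"
  shows "\<bar>dev val n t z\<bar> \<le> dev_bound n t"
proof -
  note h = holder_dev[OF val_holder hconst_nonneg n t]
  have "\<bar>dev val n t z - dev val n t z0\<bar> \<le> C * chain_sup (dev val n t) * norm (z - z0) powr q"
    by (rule chain_sup_increment[OF h exponent z z0])
  also have "\<dots> \<le> C * chain_sup (dev val n t) * D powr q"
    using C_nonneg chain_sup_nonneg[OF h] diam(2)[OF z z0] q
    by (intro mult_left_mono powr_mono2 mult_nonneg_nonneg) auto
  finally show ?thesis unfolding dev_bound_def by (simp add: mult_ac)
qed

lemma root_rate_dev_bound: "root_rate (iid \<psi>) dev_bound"
proof -
  have ps: "prob_space (iid \<psi>)" by (rule prob_space_iid[OF prob_space_axioms])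
  have "root_rate (iid \<psi>) (\<lambda>n t. \<bar>dev val n t z0\<bar>)"
  proof (rule root_rateI[OF ps, where cutoff = 0])
    show "(\<lambda>t. \<bar>dev val n t z0\<bar>) \<in> borel_measurable (iid \<psi>)" if "1 \<le> n" for n
      using all_moments_measurable[OF all_moments_dev[OF val_holder z0 that]] by auto
    fix m
    \<comment> \<open>At a single point the integrand is its own envelope, with scale 1.\<close>
    let ?E = "\<lambda>w. \<bar>integrand val z0 w\<bar>"
    have abs_even_power: "\<bar>u\<bar> ^ (2 * m) = u ^ (2 * m)" for u :: real by (simp add: power_mult)
    note am0 = all_moments_integrand[OF val_holder z0]
    have am: "all_moments \<psi> ?E"
      by (rule all_moments_dominated[OF am0]) (use all_moments_measurable[OF am0] in auto)
    have "(\<integral>\<^sup>+t. ennreal (\<bar>dev val n t z0\<bar> ^ (2 * m)) \<partial>iid \<psi>) \<le> ennreal (emp_dev_const \<psi> ?E m / real n ^ m)"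
      if n: "1 \<le> n" for n
    proof -
      have "(\<integral>\<^sup>+t. ennreal (\<bar>dev val n t z0\<bar> ^ (2 * m)) \<partial>iid \<psi>) = ennreal (\<integral>t. dev val n t z0 ^ (2 * m) \<partial>iid \<psi>)"
        unfolding abs_even_power
        by (rule nn_integral_eq_integral[OF all_moments_integrable_power[OF all_moments_dev[OF val_holder z0 n]]]) simp
      also have "(\<integral>t. dev val n t z0 ^ (2 * m) \<partial>iid \<psi>) \<le> emp_dev_const \<psi> ?E m * 1 ^ (2 * m) / real n ^ m"
        unfolding dev_def
        by (rule emp_dev_moment(2)[OF prob_space_axioms am all_moments_measurable[OF am0] _ _ n]) auto
      finally show ?thesis by (simp add: ennreal_leI)
    qed
    then show "\<exists>C\<ge>0. \<forall>n\<ge>1. (\<integral>\<^sup>+t. ennreal (\<bar>dev val n t z0\<bar> ^ (2 * m)) \<partial>iid \<psi>) \<le> ennreal (C / real n ^ m)"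
      using emp_dev_const_nonneg by blast
  qed simp
  moreover have "root_rate (iid \<psi>) (\<lambda>n t. chain_sup (dev val n t))"
  proof -
    obtain m0 where m0: "\<And>m. m0 \<le> m \<Longrightarrow> 4 ^ DIM('x \<times> 'a) * (2 powr (q - \<alpha>)) ^ (2 * m) < 1 \<and> 0 < m"
      using eventually_moment_condition by blast
    show ?thesis
    proof (rule root_rateI[OF ps, where cutoff = m0])
      show "(\<lambda>t. chain_sup (dev val n t)) \<in> borel_measurable (iid \<psi>)" if n: "1 \<le> n" for n
        by (rule measurable_chain_sup[OF all_moments_measurable[OF all_moments_dev[OF val_holder _ n]]
              holder_dev[OF val_holder hconst_nonneg n]])
      show "0 \<le> chain_sup (dev val n t)" if "1 \<le> n" "t \<in> space (iid \<psi>)" for n t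
        by (rule chain_sup_nonneg[OF holder_dev[OF val_holder hconst_nonneg that]])
      fix m assume "m0 \<le> m"
      with m0 have m: "4 ^ DIM('x \<times> 'a) * (2 powr (q - \<alpha>)) ^ (2 * m) < 1" "0 < m" by auto
      let ?c = "emp_dev_const \<psi> envelope m * (1 + \<gamma> * hconst * \<l> powr \<alpha>) ^ (2 * m) * weight_sum m"
      have "0 \<le> ?c"
        using emp_dev_const_nonneg hconst_nonneg discount weight_sum_nonneg[OF m(1)]
        by (intro mult_nonneg_nonneg zero_le_power) auto
      moreover have "(\<integral>\<^sup>+t. ennreal (chain_sup (dev val n t) ^ (2 * m)) \<partial>iid \<psi>) \<le> ennreal (?c / real n ^ m)"
        if n: "1 \<le> n" for n
        using dev_chain_moment[OF val_holder hconst_nonneg n m] by simp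
      ultimately show "\<exists>C\<ge>0. \<forall>n\<ge>1.
          (\<integral>\<^sup>+t. ennreal (chain_sup (dev val n t) ^ (2 * m)) \<partial>iid \<psi>) \<le> ennreal (C / real n ^ m)"
        by blast
    qed
  qed
  then have "root_rate (iid \<psi>) (\<lambda>n t. C * D powr q * chain_sup (dev val n t))"
    using C_nonneg by (intro root_rate_cmult) auto
  ultimately show ?thesis unfolding dev_bound_def[abs_def] by (rule root_rate_add)
qed

lemma emp_mean_integrand_diff_le:
  assumes n: "1 \<le> n" and t: "t \<in> space (iid \<psi>)" and z: "z \<in> Z"
    and d: "\<And>x. x \<in> X \<Longrightarrow> \<bar>u x - v x\<bar> \<le> d"
  shows "\<bar>emp_mean n t (integrand u z) - emp_mean n t (integrand v z)\<bar> \<le> \<gamma> * d"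
proof -
  have "emp_mean n t (integrand u z) - emp_mean n t (integrand v z) =
      emp_mean n t (\<lambda>w. \<gamma> * (u (f z w) - v (f z w)))"
    unfolding emp_mean_def integrand_def right_diff_distrib[symmetric] sum_subtractf[symmetric]
    by (simp add: algebra_simps)
  also have "\<bar>\<dots>\<bar> \<le> emp_mean n t (\<lambda>_. \<gamma> * d)"
    using d[OF f_in[OF z]] t discount by (intro abs_emp_mean_le n) (auto simp: abs_mult space_iid)
  finally show ?thesis by (simp add: emp_mean_const[OF n])
qed

lemma Vn_diff_val_le:
  assumes n: "1 \<le> n" and s: "s \<in> space (iid \<psi>)" and x: "x \<in> X"
  shows "\<bar>Vn n s x - val x\<bar> \<le> dev_bound n s / (1 - \<gamma>)"
proof -
  obtain K K' where K: "\<And>x. x \<in> X \<Longrightarrow> \<bar>Vn n s x\<bar> \<le> K" "\<And>x. x \<in> X \<Longrightarrow> \<bar>val x\<bar> \<le> K'"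
    using bounded_Vn[OF n s] val_bounded unfolding bounded_iff by (metis image_eqI real_norm_def)
  define d where "d = (SUP x\<in>X. \<bar>Vn n s x - val x\<bar>)"
  have bdd: "bdd_above ((\<lambda>x. \<bar>Vn n s x - val x\<bar>) ` X)"
  proof (rule bdd_aboveI2)
    show "\<bar>Vn n s x - val x\<bar> \<le> K + K'" if "x \<in> X" for x using K[OF that] by linarith
  qed
  have le: "\<bar>Vn n s x - val x\<bar> \<le> d" if "x \<in> X" for x
    unfolding d_def by (rule cSUP_upper[OF that bdd])
  have "\<bar>Vn n s x - val x\<bar> \<le> \<gamma> * d + dev_bound n s" if x: "x \<in> X" for x
    unfolding Vn_fixed[OF n s x] val_fixed[OF x]
  proof (rule abs_SUP_diff_le[OF A_nonempty bdd_above_emp_mean_Vn[OF n s x] bdd_above_qval_val[OF x order_refl]])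
    fix a assume "a \<in> A"
    with x have z: "(x, a) \<in> Z" by simp
    show "\<bar>emp_mean n s (\<lambda>w. r (x, a) w + \<gamma> * Vn n s (f (x, a) w)) - qval val (x, a)\<bar> \<le> \<gamma> * d + dev_bound n s"
      using emp_mean_integrand_diff_le[of n s "(x, a)" "Vn n s" val, OF n s z le] dev_le_dev_bound[OF n s z]
      unfolding dev_eq integrand_def by linarith
  qed
  then have "d \<le> \<gamma> * d + dev_bound n s" unfolding d_def by (intro cSUP_least X_nonempty)
  then have "d \<le> dev_bound n s / (1 - \<gamma>)" using discount by (simp add: field_simps)
  with le[OF x] show ?thesis by linarith
qed

lemma emp_q_error_le:
  assumes n: "1 \<le> n" and s: "s \<in> space (iid \<psi>)" and t: "t \<in> space (iid \<psi>)" and z: "z \<in> Z"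
  shows "\<bar>emp_mean n t (integrand (Vn n s) z) - qval val z\<bar> \<le> dev_bound n t + \<gamma> / (1 - \<gamma>) * dev_bound n s"
  using emp_mean_integrand_diff_le[of n t z "Vn n s" val, OF n t z Vn_diff_val_le[OF n s]] dev_le_dev_bound[OF n t z]
  unfolding dev_eq by simp

text \<open>\<open>s\<close> is the V-sample that determines the value function, \<open>t\<close>
  the independent Q-sample that averages it.\<close>

definition osc_bound :: "nat \<Rightarrow> (nat \<Rightarrow> 'w) \<times> (nat \<Rightarrow> 'w) \<Rightarrow> real" where
  "osc_bound n = (\<lambda>(s, t). chain_sup (dev (Vn n s) n t))"

text \<open>For \<open>Vn n s - val\<close> only a supremum norm bound is at hand. Integrated
  against two transition kernels it still yields an increment in the action, because total variation
  needs no smoothness of the integrand.\<close>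

lemma emp_q_increment_le:
  assumes n: "1 \<le> n" and s: "s \<in> space (iid \<psi>)" and t: "t \<in> space (iid \<psi>)"
    and x: "x \<in> X" and ab: "a \<in> A" "b \<in> A"
    and tv: "tv_dist (trans_kernel X f \<psi> (x, a)) (trans_kernel X f \<psi> (x, b)) \<le> T"
  shows "\<bar>(emp_mean n t (integrand (Vn n s) (x, a)) - qval val (x, a))
      - (emp_mean n t (integrand (Vn n s) (x, b)) - qval val (x, b))\<bar>
    \<le> C * osc_bound n (s, t) * norm (a - b) powr q + 2 * \<gamma> / (1 - \<gamma>) * dev_bound n s * T"
proof -
  let ?h = "\<lambda>x. Vn n s x - val x" and ?P = "\<lambda>a. trans_kernel X f \<psi> (x, a)"
  have za: "(x, a) \<in> Z" "(x, b) \<in> Z" using x ab by auto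
  have eq: "emp_mean n t (integrand (Vn n s) z) - qval val z =
      dev (Vn n s) n t z + \<gamma> * (\<integral>y. ?h y \<partial>trans_kernel X f \<psi> z)" if z: "z \<in> Z" for z
  proof -
    have hm: "?h \<in> borel_measurable (borel_on X)"
      by (intro borel_measurable_diff borel_measurable_continuous_on_restrict val_continuous
          holder_bound_imp_continuous_on[OF holder_Vn[OF n s] exponent])
    have "(\<integral>y. ?h y \<partial>trans_kernel X f \<psi> z) = (\<integral>w. ?h (f z w) \<partial>\<psi>)"
      unfolding trans_kernel_def by (rule integral_distr[OF measurable_f[OF z] hm])
    also have "\<dots> = (\<integral>w. Vn n s (f z w) \<partial>\<psi>) - (\<integral>w. val (f z w) \<partial>\<psi>)"
      by (intro Bochner_Integration.integral_diff holder_comp_f[OF z val_holder] holder_comp_f[OF z holder_Vn[OF n s]])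
    finally have "\<gamma> * (\<integral>y. ?h y \<partial>trans_kernel X f \<psi> z) = qval (Vn n s) z - qval val z"
      using integrable_r[OF z] holder_comp_f[OF z val_holder] holder_comp_f[OF z holder_Vn[OF n s]]
      by (simp add: qval_def right_diff_distrib)
    then show ?thesis by (simp add: dev_eq)
  qed
  have "\<bar>dev (Vn n s) n t (x, a) - dev (Vn n s) n t (x, b)\<bar> \<le> C * osc_bound n (s, t) * norm (a - b) powr q"
    using chain_sup_increment[OF holder_dev[OF holder_Vn[OF n s] emp_hconst_nonneg[OF n s] n t] exponent za]
    by (simp add: osc_bound_def norm_Pair)
  moreover have "\<bar>(\<integral>y. ?h y \<partial>?P a) - (\<integral>y. ?h y \<partial>?P b)\<bar>
      \<le> 2 * (dev_bound n s / (1 - \<gamma>)) * T"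
  proof (rule order_trans[OF integral_diff_le_tv_dist])
    show "prob_space (?P a)" "prob_space (?P b)"
      unfolding trans_kernel_def by (intro prob_space_distr measurable_f za)+
    show "\<bar>?h y\<bar> \<le> dev_bound n s / (1 - \<gamma>)" if "y \<in> space (?P a)" for y
      using that by (intro Vn_diff_val_le[OF n s]) (simp add: trans_kernel_def space_restrict_space)
    show "?h \<in> borel_measurable (?P a)"
      unfolding trans_kernel_def measurable_distr_eq1
      by (intro borel_measurable_diff borel_measurable_continuous_on_restrict val_continuous
          holder_bound_imp_continuous_on[OF holder_Vn[OF n s] exponent])
    have "0 \<le> dev_bound n s / (1 - \<gamma>)"
      using root_rate_nonneg[OF root_rate_dev_bound n s] discount by simp
    then show "2 * (dev_bound n s / (1 - \<gamma>)) *
        tv_dist (?P a) (?P b) \<le> 2 * (dev_bound n s / (1 - \<gamma>)) * T"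
      using tv by (intro mult_left_mono) auto
  qed (simp add: trans_kernel_def)
  then have "\<gamma> * \<bar>(\<integral>y. ?h y \<partial>?P a) - (\<integral>y. ?h y \<partial>?P b)\<bar>
      \<le> \<gamma> * (2 * (dev_bound n s / (1 - \<gamma>)) * T)"
    using discount by (intro mult_left_mono) auto
  then have "\<bar>\<gamma> * (\<integral>y. ?h y \<partial>?P a) - \<gamma> * (\<integral>y. ?h y \<partial>?P b)\<bar>
      \<le> 2 * \<gamma> / (1 - \<gamma>) * dev_bound n s * T"
    using discount by (simp add: abs_mult right_diff_distrib[symmetric] mult_ac)
  ultimately show ?thesis unfolding eq[OF za(1)] eq[OF za(2)] by linarith
qed

text \<open>Joint measurability in both samples, which integrating over one sample at a time
  requires.\<close>

lemma measurable_dev_Vn: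
  assumes n: "1 \<le> n" and z: "z \<in> Z"
  shows "(\<lambda>p. dev (Vn n (fst p)) n (snd p) z) \<in> borel_measurable (iid \<psi> \<Otimes>\<^sub>M iid \<psi>)"
proof -
  have r: "r z \<in> borel_measurable \<psi>" using integrable_r[OF z] by auto
  have comp: "(\<lambda>p. integrand (Vn n (g p)) z (h p)) \<in> borel_measurable M"
    if "g \<in> M \<rightarrow>\<^sub>M iid \<psi>" "h \<in> M \<rightarrow>\<^sub>M \<psi>" for g h and M :: "'m measure"
    unfolding integrand_def
    by (intro borel_measurable_add borel_measurable_times borel_measurable_const
        measurable_compose[OF that(2) r] measurable_Vn_comp[OF n that(1)]
        measurable_compose[OF that(2) measurable_f[OF z]])
  have comp_i: "(\<lambda>p. integrand (Vn n (fst p)) z (snd p i)) \<in> borel_measurable (iid \<psi> \<Otimes>\<^sub>M iid \<psi>)" for i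
    by (rule comp[OF measurable_fst measurable_compose[OF measurable_snd]])
      (rule measurable_component_singleton, simp)
  have "(\<lambda>p. emp_mean n (snd p) (integrand (Vn n (fst p)) z)) \<in> borel_measurable (iid \<psi> \<Otimes>\<^sub>M iid \<psi>)"
    unfolding emp_mean_def
    by (intro borel_measurable_times borel_measurable_const borel_measurable_sum comp_i)
  moreover have "(\<lambda>s. \<integral>w. integrand (Vn n s) z w \<partial>\<psi>) \<in> borel_measurable (iid \<psi>)"
    by (rule borel_measurable_lebesgue_integral)
      (use comp[OF measurable_fst measurable_snd] in \<open>simp add: case_prod_beta'\<close>)
  then have "(\<lambda>p. \<integral>w. integrand (Vn n (fst p)) z w \<partial>\<psi>) \<in> borel_measurable (iid \<psi> \<Otimes>\<^sub>M iid \<psi>)"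
    by (rule measurable_compose[OF measurable_fst])
  ultimately show ?thesis unfolding dev_def emp_dev_def by (rule borel_measurable_diff)
qed

text \<open>For fixed \<open>s\<close> the chaining bound holds with a factor depending on the
  Hoelder constant of \<open>Vn n s\<close>. Tonelli's theorem and Jensen's inequality then bound
  the mean of this factor by \<open>E\<close>, uniformly in \<open>n\<close>.\<close>

lemma root_rate_osc_bound: "root_rate (iid \<psi> \<Otimes>\<^sub>M iid \<psi>) osc_bound"
proof -
  interpret I: prob_space "iid \<psi>" by (rule prob_space_iid[OF prob_space_axioms])
  interpret P: pair_prob_space "iid \<psi>" "iid \<psi>" ..
  obtain m0 where m0: "\<And>m. m0 \<le> m \<Longrightarrow> 4 ^ DIM('x \<times> 'a) * (2 powr (q - \<alpha>)) ^ (2 * m) < 1 \<and> 0 < m"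
    using eventually_moment_condition by blast
  have holder: "holder_bound \<alpha> (dev_hconst (emp_hconst n s) n t) Z (dev (Vn n s) n t)"
    if "1 \<le> n" "s \<in> space (iid \<psi>)" "t \<in> space (iid \<psi>)" for n s t
    using that by (intro holder_dev holder_Vn emp_hconst_nonneg)
  have meas: "osc_bound n \<in> borel_measurable (iid \<psi> \<Otimes>\<^sub>M iid \<psi>)" if n: "1 \<le> n" for n
    unfolding osc_bound_def case_prod_beta'
    by (rule measurable_chain_sup[OF measurable_dev_Vn[OF n] holder[OF n]])
      (auto simp: space_pair_measure)
  show ?thesis
  proof (rule root_rateI[OF P.prob_space_axioms meas, where cutoff = m0])
    show "0 \<le> osc_bound n p" if "1 \<le> n" "p \<in> space (iid \<psi> \<Otimes>\<^sub>M iid \<psi>)" for n p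
      using that by (auto simp: osc_bound_def space_pair_measure intro: chain_sup_nonneg[OF holder])
    fix m assume "m0 \<le> m"
    with m0 have m: "4 ^ DIM('x \<times> 'a) * (2 powr (q - \<alpha>)) ^ (2 * m) < 1" "0 < m" by auto
    \<comment> \<open>Chosen so that the random factor
      \<open>1 + \<gamma> * emp_hconst n s * \<l> powr \<alpha>\<close> is the sample mean of
      \<open>1 + k * L w\<close>.\<close>
    define k where "k = \<gamma> * \<l> powr \<alpha> / (1 - \<gamma> * \<l> powr \<alpha>)"
    define c where "c = emp_dev_const \<psi> envelope m * weight_sum m"
    have c: "0 \<le> c"
      unfolding c_def using emp_dev_const_nonneg weight_sum_nonneg[OF m(1)] by (rule mult_nonneg_nonneg)
    define E where "E = (\<integral>w. (1 + k * L w) ^ (2 * m) \<partial>\<psi>)"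
    have iE: "integrable \<psi> (\<lambda>w. (1 + k * L w) ^ (2 * m))"
      by (intro all_moments_integrable_power all_moments_add all_moments_const all_moments_cmult moments_L)
    have E: "0 \<le> E" unfolding E_def by (intro integral_nonneg_AE) auto
    have "(\<integral>\<^sup>+p. ennreal (osc_bound n p ^ (2 * m)) \<partial>(iid \<psi> \<Otimes>\<^sub>M iid \<psi>)) \<le> ennreal (c * E / real n ^ m)"
      if n: "1 \<le> n" for n
    proof -
      note iM = integral_emp_mean[OF prob_space_axioms iE n]
      have "(\<integral>\<^sup>+p. ennreal (osc_bound n p ^ (2 * m)) \<partial>(iid \<psi> \<Otimes>\<^sub>M iid \<psi>)) =
          (\<integral>\<^sup>+s. \<integral>\<^sup>+t. ennreal (osc_bound n (s, t) ^ (2 * m)) \<partial>iid \<psi> \<partial>iid \<psi>)"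
        by (rule I.nn_integral_fst[symmetric]) (intro measurable_compose[OF _ measurable_ennreal] borel_measurable_power meas n)
      also have "\<dots> \<le> (\<integral>\<^sup>+s. ennreal (c / real n ^ m * emp_mean n s (\<lambda>w. (1 + k * L w) ^ (2 * m))) \<partial>iid \<psi>)"
      proof (rule nn_integral_mono)
        fix s assume s: "s \<in> space (iid \<psi>)"
        have "emp_mean n s (\<lambda>w. 1 + k * L w) = 1 + k * emp_mean n s L"
          using n by (simp add: emp_mean_def sum.distrib add_divide_distrib flip: sum_distrib_left)
        then have "1 + \<gamma> * emp_hconst n s * \<l> powr \<alpha> = emp_mean n s (\<lambda>w. 1 + k * L w)"
          by (simp add: emp_hconst_def k_def)
        then have "(1 + \<gamma> * emp_hconst n s * \<l> powr \<alpha>) ^ (2 * m) \<le> emp_mean n s (\<lambda>w. (1 + k * L w) ^ (2 * m))"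
          using emp_mean_even_power_le[OF n] by simp
        then have "c / real n ^ m * (1 + \<gamma> * emp_hconst n s * \<l> powr \<alpha>) ^ (2 * m) \<le>
            c / real n ^ m * emp_mean n s (\<lambda>w. (1 + k * L w) ^ (2 * m))"
          using c by (intro mult_left_mono) auto
        moreover have "(\<integral>\<^sup>+t. ennreal (osc_bound n (s, t) ^ (2 * m)) \<partial>iid \<psi>) \<le>
            ennreal (c / real n ^ m * (1 + \<gamma> * emp_hconst n s * \<l> powr \<alpha>) ^ (2 * m))"
          using dev_chain_moment[OF holder_Vn[OF n s] emp_hconst_nonneg[OF n s] n m]
          by (simp add: osc_bound_def c_def mult_ac)
        ultimately show "(\<integral>\<^sup>+t. ennreal (osc_bound n (s, t) ^ (2 * m)) \<partial>iid \<psi>) \<le>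
            ennreal (c / real n ^ m * emp_mean n s (\<lambda>w. (1 + k * L w) ^ (2 * m)))"
          by (meson ennreal_leI order_trans)
      qed
      also have "\<dots> = ennreal (\<integral>s. c / real n ^ m * emp_mean n s (\<lambda>w. (1 + k * L w) ^ (2 * m)) \<partial>iid \<psi>)"
        using c iM(1) by (intro nn_integral_eq_integral integrable_mult_right AE_I2 mult_nonneg_nonneg)
          (auto simp: emp_mean_def intro!: sum_nonneg divide_nonneg_nonneg)
      also have "\<dots> = ennreal (c * E / real n ^ m)" using iM by (simp add: E_def)
      finally show ?thesis .
    qed
    moreover have "0 \<le> c * E" using c E by simp
    ultimately show "\<exists>C\<ge>0. \<forall>n\<ge>1.
        (\<integral>\<^sup>+p. ennreal (osc_bound n p ^ (2 * m)) \<partial>(iid \<psi> \<Otimes>\<^sub>M iid \<psi>)) \<le> ennreal (C / real n ^ m)"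
      by blast
  qed
qed

end

section \<open>The split-sample estimator\<close>

text \<open>On a set of bounded diameter a Hoelder bound passes to any smaller exponent at the price
  of a power of the diameter.\<close>

lemma powr_le_mult_powr:
  fixes x D :: real
  assumes "0 \<le> x" "x \<le> D" "p \<le> p'"
  shows "x powr p' \<le> D powr (p' - p) * x powr p"
proof (cases "x = 0")
  case False
  have "x powr p' = x powr (p' - p) * x powr p" by (simp flip: powr_add)
  also have "\<dots> \<le> D powr (p' - p) * x powr p"
    using assms by (intro mult_right_mono powr_mono2) auto
  finally show ?thesis .
qed simp

text \<open>The orders 0 and 1 are recovered from \<open>y ^ k \<le> 1 + y ^ (k + 2)\<close> on a
  probability space.\<close>

lemma (in prob_space) all_momentsI:
  assumes f: "f \<in> borel_measurable M" and i: "\<And>k :: nat. 2 \<le> k \<Longrightarrow> integrable M (\<lambda>x. \<bar>f x\<bar> ^ k)"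
  shows "all_moments M f"
  unfolding all_moments_def
proof (intro conjI allI f)
  fix k :: nat
  show "integrable M (\<lambda>x. \<bar>f x\<bar> ^ k)"
  proof (rule Bochner_Integration.integrable_bound)
    show "integrable M (\<lambda>x. 1 + \<bar>f x\<bar> ^ (k + 2))" by (intro Bochner_Integration.integrable_add i) auto
    have "y ^ k \<le> 1 + y ^ (k + 2)" if "0 \<le> y" for y :: real
    proof (cases "y \<le> 1")
      case True
      then have "y ^ k \<le> 1" using that by (intro power_le_one)
      then show ?thesis using zero_le_power[OF that, of "k + 2"] by linarith
    next
      case False
      then have "y ^ k \<le> y ^ (k + 2)" by (intro power_increasing) auto
      then show ?thesis by linarith
    qed
    then show "AE x in M. norm (\<bar>f x\<bar> ^ k) \<le> norm (1 + \<bar>f x\<bar> ^ (k + 2))" by simp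
  qed (use f in measurable)
qed

text \<open>For \<open>\<l> > 1\<close> the factor \<open>\<l> powr \<alpha>\<close> tends to 1 as
  \<alpha> decreases to 0, so discounting wins for small exponents. The conclusions that mention no
  exponent rest on this one.\<close>

lemma ex_contracting_exponent:
  fixes \<gamma> \<l> \<alpha>\<^sub>0 :: real
  assumes "0 < \<gamma>" "\<gamma> < 1" "0 \<le> \<l>" "0 < \<alpha>\<^sub>0"
  shows "\<exists>\<alpha>\<in>{0<..\<alpha>\<^sub>0}. \<gamma> * \<l> powr \<alpha> < 1"
proof (cases "\<l> \<le> 1")
  case True
  then have "\<l> powr \<alpha>\<^sub>0 \<le> 1" using assms by (intro powr_le1) auto
  then have "\<gamma> * \<l> powr \<alpha>\<^sub>0 \<le> \<gamma> * 1" using assms by (intro mult_left_mono) auto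
  then have "\<gamma> * \<l> powr \<alpha>\<^sub>0 < 1" using assms by linarith
  then show ?thesis using assms by (intro bexI[of _ \<alpha>\<^sub>0]) auto
next
  case False
  then have "((\<lambda>\<alpha>. \<gamma> * \<l> powr \<alpha>) \<longlongrightarrow> \<gamma> * \<l> powr 0) (at_right 0)"
    by (intro tendsto_intros) auto
  then have "eventually (\<lambda>\<alpha>. \<gamma> * \<l> powr \<alpha> < 1) (at_right 0)"
    using False assms by (intro order_tendstoD(2)) auto
  then obtain b where b: "0 < b" "\<And>y. 0 < y \<Longrightarrow> y < b \<Longrightarrow> \<gamma> * \<l> powr y < 1"
    by (auto simp: eventually_at_right_field)
  then show ?thesis using assms by (intro bexI[of _ "min \<alpha>\<^sub>0 (b / 2)"]) auto
qed

section \<open>Joint law of the two samples\<close>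

context split_sample
begin

definition noise_pair :: "'o \<Rightarrow> (nat \<Rightarrow> 'w) \<times> (nat \<Rightarrow> 'w)" where
  "noise_pair \<omega> = ((\<lambda>i. S VSample i \<omega>), (\<lambda>i. S QSample i \<omega>))"

lemma S_measurable: "S U i \<in> M \<rightarrow>\<^sub>M \<psi>"
  and W_measurable: "W \<in> M \<rightarrow>\<^sub>M \<psi>"
proof -
  have "random_variable \<psi> (case_option W (\<lambda>(U, i). S U i) j)" for j
    using indep by (auto simp: indep_vars_def)
  from this[of "Some (U, i)"] this[of None] show "S U i \<in> M \<rightarrow>\<^sub>M \<psi>" "W \<in> M \<rightarrow>\<^sub>M \<psi>" by auto
qed

lemma prob_noise: "prob_space \<psi>"
  using prob_space_distr[OF W_measurable] by (simp add: distr_copy)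

lemma distr_S: "distr M (iid \<psi>) (\<lambda>\<omega> i. S U i \<omega>) = iid \<psi>"
proof -
  let ?X = "case_option W (\<lambda>(U, i). S U i)"
  let ?P = "\<Pi>\<^sub>M j\<in>UNIV. \<psi> :: ((sample \<times> nat) option \<Rightarrow> 'w) measure"
  have X: "?X j \<in> M \<rightarrow>\<^sub>M \<psi>" "distr M \<psi> (?X j) = \<psi>" for j
    using S_measurable W_measurable distr_sample distr_copy by (auto split: option.split)
  have "distr M ?P (\<lambda>\<omega>. \<lambda>j\<in>UNIV. ?X j \<omega>) = (\<Pi>\<^sub>M j\<in>UNIV. distr M \<psi> (?X j))"
    using indep_vars_iff_distr_eq_PiM[where I=UNIV and M'="\<lambda>_. \<psi>" and X="?X"] X(1) indep by simp
  then have full: "distr M ?P (\<lambda>\<omega> j. ?X j \<omega>) = ?P"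
    by (simp only: X(2) restrict_UNIV)
  have m1: "(\<lambda>\<omega> j. ?X j \<omega>) \<in> M \<rightarrow>\<^sub>M ?P"
    by (rule measurable_PiM_single') (use X(1) measurable_space[OF X(1)] in auto)
  have m2: "(\<lambda>g i. g (Some (U, i))) \<in> ?P \<rightarrow>\<^sub>M iid \<psi>"
    by (rule measurable_PiM_single') (auto simp: space_PiM)
  have "distr ?P (iid \<psi>) (\<lambda>g i. g (Some (U, i))) = iid \<psi>"
    using distr_PiM_reindex[of UNIV "\<lambda>_. \<psi>" "\<lambda>i. Some (U, i)" UNIV] prob_noise by (simp add: inj_on_def restrict_UNIV)
  moreover have "distr M (iid \<psi>) (\<lambda>\<omega> i. S U i \<omega>) = distr (distr M ?P (\<lambda>\<omega> j. ?X j \<omega>)) (iid \<psi>) (\<lambda>g i. g (Some (U, i)))"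
    by (subst distr_distr[OF m2 m1]) (simp add: comp_def)
  ultimately show ?thesis unfolding full by simp
qed

lemma noise_measurable: "(\<lambda>\<omega> i. S U i \<omega>) \<in> M \<rightarrow>\<^sub>M iid \<psi>"
  by (rule measurable_PiM_single') (auto intro: S_measurable simp: space_PiM measurable_space[OF S_measurable])

lemma noise_pair_measurable: "noise_pair \<in> M \<rightarrow>\<^sub>M iid \<psi> \<Otimes>\<^sub>M iid \<psi>"
  unfolding noise_pair_def[abs_def] by (intro measurable_Pair noise_measurable)

text \<open>The samples are disjoint blocks of one independent family. The resulting product law
  turns conditioning on the V-sample into an iterated integral.\<close>

lemma distr_noise_pair: "distr M (iid \<psi> \<Otimes>\<^sub>M iid \<psi>) noise_pair = iid \<psi> \<Otimes>\<^sub>M iid \<psi>"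
proof -
  let ?X = "case_option W (\<lambda>(U, i). S U i)"
  define U where "U b = (if b then VSample else QSample)" for b
  define K where "K b = range (\<lambda>i :: nat. Some (U b, i))" for b
  have "disjoint_family_on K UNIV"
    by (auto simp: disjoint_family_on_def K_def U_def)
  then have "indep_vars (\<lambda>b. \<Pi>\<^sub>M j\<in>K b. \<psi>) (\<lambda>b \<omega>. restrict (\<lambda>j. ?X j \<omega>) (K b)) UNIV"
    by (intro indep_vars_restrict[OF indep]) auto
  then have "indep_vars (\<lambda>_. iid \<psi>) (\<lambda>b \<omega>. (\<lambda>g i. g (Some (U b, i))) (restrict (\<lambda>j. ?X j \<omega>) (K b))) UNIV"
  proof (rule indep_vars_compose2)
    fix b
    show "(\<lambda>g i. g (Some (U b, i))) \<in> (\<Pi>\<^sub>M j\<in>K b. \<psi>) \<rightarrow>\<^sub>M iid \<psi>"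
    proof (rule measurable_PiM_single')
      show "(\<lambda>g. g (Some (U b, i))) \<in> (\<Pi>\<^sub>M j\<in>K b. \<psi>) \<rightarrow>\<^sub>M \<psi>" for i
        by (rule measurable_component_singleton) (auto simp: K_def)
      show "(\<lambda>g i. g (Some (U b, i))) \<in> space (\<Pi>\<^sub>M j\<in>K b. \<psi>) \<rightarrow> (UNIV \<rightarrow>\<^sub>E space \<psi>)"
        by (auto simp: space_PiM K_def)
    qed
  qed
  also have "(\<lambda>b \<omega>. (\<lambda>g i. g (Some (U b, i))) (restrict (\<lambda>j. ?X j \<omega>) (K b))) =
      case_bool (\<lambda>\<omega> i. S VSample i \<omega>) (\<lambda>\<omega> i. S QSample i \<omega>)"
    by (auto simp: fun_eq_iff K_def U_def split: bool.split)
  also have "(\<lambda>_. iid \<psi>) = case_bool (iid \<psi>) (iid \<psi>)"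
    by (auto simp: fun_eq_iff split: bool.split)
  finally have "indep_var (iid \<psi>) (\<lambda>\<omega> i. S VSample i \<omega>) (iid \<psi>) (\<lambda>\<omega> i. S QSample i \<omega>)"
    by (simp add: indep_var_def)
  then show ?thesis
    unfolding indep_var_distribution_eq distr_S noise_pair_def[abs_def] by simp
qed

lemma distr_fst_noise_pair: "distr M (iid \<psi>) (\<lambda>\<omega>. fst (noise_pair \<omega>)) = iid \<psi>"
  and distr_snd_noise_pair: "distr M (iid \<psi>) (\<lambda>\<omega>. snd (noise_pair \<omega>)) = iid \<psi>"
  by (simp_all add: noise_pair_def distr_S)

text \<open>Moment hypotheses are stated on the underlying space through the copy \<open>W\<close>,
  while the analysis takes place under \<psi>.\<close>

lemma all_moments_noise:
  assumes g: "g \<in> borel_measurable \<psi>" and i: "\<And>k :: nat. 2 \<le> k \<Longrightarrow> integrable M (\<lambda>\<omega>. \<bar>g (W \<omega>)\<bar> ^ k)"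
  shows "all_moments \<psi> g"
proof (rule prob_space.all_momentsI[OF prob_noise g])
  fix k :: nat assume "2 \<le> k"
  have "integrable (distr M \<psi> W) (\<lambda>w. \<bar>g w\<bar> ^ k)"
    by (subst integrable_distr_eq[OF W_measurable]) (use g i[OF \<open>2 \<le> k\<close>] in auto)
  then show "integrable \<psi> (\<lambda>w. \<bar>g w\<bar> ^ k)" by (simp add: distr_copy)
qed

end

theorem theorem5:
  fixes XX :: "'x::euclidean_space set"
    and AA :: "'a::euclidean_space set"
    and WW :: "'w::euclidean_space set"
    and f :: "'x \<times> 'a \<Rightarrow> 'w \<Rightarrow> 'x"
    and r :: "'x \<times> 'a \<Rightarrow> 'w \<Rightarrow> real"
    and \<psi> :: "'w measure"
    and \<gamma> \<l>P qbar \<alpha>r \<l>f :: real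
    and M :: "'o measure"
    and S :: "sample \<Rightarrow> nat \<Rightarrow> 'o \<Rightarrow> 'w"
    and W :: "'o \<Rightarrow> 'w"
    and Lr :: "'w \<Rightarrow> real"
    and z0 :: "'x \<times> 'a"
  assumes "control_problem XX AA WW f r \<psi> \<gamma>"
    and "split_sample M \<psi> S W"
    and compact_Z: "compact (XX \<times> AA)"
    and "\<l>P \<ge> 0" and "qbar \<in> {0..1}"
    and tv: "\<And>x a b. x \<in> XX \<Longrightarrow> a \<in> AA \<Longrightarrow> b \<in> AA \<Longrightarrow>
      tv_dist (trans_kernel XX f \<psi> (x, a)) (trans_kernel XX f \<psi> (x, b)) \<le> \<l>P * norm (a - b) powr qbar"
    and "z0 \<in> XX \<times> AA"
    and moments_r: "\<And>k::nat. k \<ge> 2 \<Longrightarrow> integrable M (\<lambda>\<omega>. \<bar>r z0 (W \<omega>)\<bar> ^ k)"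
    and "\<alpha>r \<in> {0<..1}"
    and "Lr \<in> borel_measurable (restrict_space borel WW)"
    and "\<And>w. w \<in> WW \<Longrightarrow> Lr w \<ge> 0"
    and moments_Lr: "\<And>k::nat. k \<ge> 2 \<Longrightarrow> integrable M (\<lambda>\<omega>. Lr (W \<omega>) ^ k)"
    and holder_r: "\<And>z z' w. z \<in> XX \<times> AA \<Longrightarrow> z' \<in> XX \<times> AA \<Longrightarrow> w \<in> WW \<Longrightarrow>
      \<bar>r z w - r z' w\<bar> \<le> Lr w * norm (z - z') powr \<alpha>r"
    and "\<l>f \<ge> 0"
    and lipschitz_f: "\<And>z z' w. z \<in> XX \<times> AA \<Longrightarrow> z' \<in> XX \<times> AA \<Longrightarrow> w \<in> WW \<Longrightarrow>
      norm (f z w - f z' w) \<le> \<l>f * norm (z - z')"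
  shows
    "(\<forall>\<alpha>\<in>{0<..\<alpha>r}. \<gamma> * \<l>f powr \<alpha> < 1 \<longrightarrow>
       holder_on \<alpha> (XX \<times> AA) (opt_q XX AA f r \<psi> \<gamma>) \<and>
       (\<forall>n\<ge>1. \<forall>\<omega>\<in>space M. holder_on \<alpha> (XX \<times> AA) (emp_q XX AA f r \<gamma> S n \<omega>))) \<and>
    (bounded (mean_reward r \<psi> ` (XX \<times> AA))) \<and>
    (mean_reward r \<psi> \<in> borel_measurable (restrict_space borel (XX \<times> AA))) \<and>
    (bounded (opt_value XX AA f r \<psi> \<gamma> ` XX)) \<and>
    (opt_value XX AA f r \<psi> \<gamma> \<in> borel_measurable (restrict_space borel XX)) \<and>
    (bounded (opt_q XX AA f r \<psi> \<gamma> ` (XX \<times> AA))) \<and>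
    (opt_q XX AA f r \<psi> \<gamma> \<in> borel_measurable (restrict_space borel (XX \<times> AA))) \<and>
    (\<forall>x\<in>XX. continuous_on AA (\<lambda>a. opt_q XX AA f r \<psi> \<gamma> (x, a)) \<and>
       (\<exists>a\<in>AA. opt_value XX AA f r \<psi> \<gamma> x = opt_q XX AA f r \<psi> \<gamma> (x, a) \<and>
         (\<forall>b\<in>AA. opt_q XX AA f r \<psi> \<gamma> (x, b) \<le> opt_q XX AA f r \<psi> \<gamma> (x, a)))) \<and>
    (\<forall>n\<ge>1. AE \<omega> in M.
       emp_q XX AA f r \<gamma> S n \<omega> \<in> borel_measurable (restrict_space borel (XX \<times> AA)) \<and>
       (\<forall>x\<in>XX. continuous_on AA (\<lambda>a. emp_q XX AA f r \<gamma> S n \<omega> (x, a)))) \<and>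
    (\<forall>q\<in>{0..qbar}. q < Sup {\<alpha> \<in> {0..\<alpha>r}. \<gamma> * \<l>f powr \<alpha> < 1} \<longrightarrow>
       (\<exists>(\<delta> :: nat \<Rightarrow> 'o \<Rightarrow> real) (\<Lambda> :: nat \<Rightarrow> 'o \<Rightarrow> real) (C\<delta> :: real) (C\<Lambda> :: nat \<Rightarrow> real).
         (\<forall>n\<ge>1. \<delta> n \<in> borel_measurable M \<and> \<Lambda> n \<in> borel_measurable M \<and>
           (\<forall>\<omega>\<in>space M. \<delta> n \<omega> > 0 \<and> \<Lambda> n \<omega> > 0)) \<and>
         (\<forall>n\<ge>1. AE \<omega> in M.
           (SUP z\<in>XX \<times> AA. ereal \<bar>emp_q XX AA f r \<gamma> S n \<omega> z - opt_q XX AA f r \<psi> \<gamma> z\<bar>)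
             \<le> ereal (\<delta> n \<omega>) \<and>
           (SUP x\<in>XX. SUP (a, b)\<in>{(a, b). a \<in> AA \<and> b \<in> AA \<and> a \<noteq> b}.
               ereal (\<bar>(emp_q XX AA f r \<gamma> S n \<omega> (x, a) - opt_q XX AA f r \<psi> \<gamma> (x, a))
                      - (emp_q XX AA f r \<gamma> S n \<omega> (x, b) - opt_q XX AA f r \<psi> \<gamma> (x, b))\<bar>
                 / norm (a - b) powr q))
             \<le> ereal (\<Lambda> n \<omega>)) \<and>
         (\<forall>n\<ge>1. integrable M (\<lambda>\<omega>. \<delta> n \<omega> ^ 2) \<and>
           (\<integral>\<omega>. \<delta> n \<omega> ^ 2 \<partial>M) \<le> C\<delta> / real n) \<and>
         (\<forall>n\<ge>1. \<forall>k\<ge>2. integrable M (\<lambda>\<omega>. \<Lambda> n \<omega> ^ k) \<and>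
           (\<integral>\<omega>. \<Lambda> n \<omega> ^ k \<partial>M) \<le> C\<Lambda> k * real n powr (- real k / 2))))"
proof -
  interpret cp: control_problem XX AA WW f r \<psi> \<gamma> by fact
  interpret sp: split_sample M \<psi> S W by fact
  interpret psi: prob_space \<psi> by (rule cp.prob_noise)
  let ?Z = "XX \<times> AA" and ?V = "opt_value XX AA f r \<psi> \<gamma>" and ?Q = "opt_q XX AA f r \<psi> \<gamma>"
    and ?Qn = "emp_q XX AA f r \<gamma> S"
  have sp_noise: "space \<psi> = WW"
    using sets_eq_imp_space_eq[OF cp.sets_noise] by (simp add: space_restrict_space)
  have "XX = fst ` ?Z" using cp.AA_nonempty by auto
  then have compact_XX: "compact XX"
    using compact_continuous_image[OF continuous_on_fst[OF continuous_on_id] compact_Z] by (simp add: id_def)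
  have XX_nonempty: "XX \<noteq> {}" using \<open>z0 \<in> ?Z\<close> by auto
  have bounded_Z: "bounded ?Z" by (rule compact_imp_bounded[OF compact_Z])
  obtain D where D: "0 < D" "\<And>z z'. z \<in> ?Z \<Longrightarrow> z' \<in> ?Z \<Longrightarrow> norm (z - z') \<le> D"
  proof -
    obtain e where e: "\<forall>z\<in>?Z. \<forall>z'\<in>?Z. dist z z' \<le> e" using bounded_Z by (auto simp: bounded_two_points)
    show ?thesis
    \<comment> \<open>The maximum keeps \<open>D\<close> positive even if \<open>Z\<close> is a
      single point.\<close>
    proof (rule that[of "max e 1"])
      show "norm (z - z') \<le> max e 1" if "z \<in> ?Z" "z' \<in> ?Z" for z z'
        using e that unfolding dist_norm by (meson max.coboundedI1)
    qed simp
  qed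
  have sets_Z: "sets (borel_on ?Z \<Otimes>\<^sub>M \<psi>) = sets (borel_on ?Z \<Otimes>\<^sub>M borel_on WW)"
    by (rule sets_pair_measure_cong[OF refl cp.sets_noise])
  have joint_f: "(\<lambda>(z, w). f z w) \<in> borel_on ?Z \<Otimes>\<^sub>M \<psi> \<rightarrow>\<^sub>M borel_on XX"
    using cp.measurable_dynamics by (simp only: measurable_cong_sets[OF sets_Z refl])
  have joint_r: "(\<lambda>(z, w). r z w) \<in> borel_measurable (borel_on ?Z \<Otimes>\<^sub>M \<psi>)"
    using cp.measurable_reward by (simp only: measurable_cong_sets[OF sets_Z refl])
  have slice: "(\<lambda>w. (z, w)) \<in> \<psi> \<rightarrow>\<^sub>M borel_on ?Z \<Otimes>\<^sub>M \<psi>" if "z \<in> ?Z" for z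
    by (rule measurable_Pair1') (use that in \<open>simp add: space_restrict_space\<close>)
  have f_meas: "f z \<in> \<psi> \<rightarrow>\<^sub>M borel_on XX" if "z \<in> ?Z" for z
    using measurable_compose[OF slice[OF that] joint_f] by simp
  have r_meas: "r z \<in> borel_measurable \<psi>" if "z \<in> ?Z" for z
    using measurable_compose[OF slice[OF that] joint_r] by simp
  have Lr_meas: "Lr \<in> borel_measurable \<psi>"
    using \<open>Lr \<in> borel_measurable (borel_on WW)\<close>
    by (simp only: measurable_cong_sets[OF cp.sets_noise refl])
  have am_Lr: "all_moments \<psi> Lr"
  proof (rule sp.all_moments_noise[OF Lr_meas])
    fix k :: nat assume "2 \<le> k"
    have "Lr (W \<omega>) \<ge> 0" if "\<omega> \<in> space M" for \<omega>
      using measurable_space[OF sp.W_measurable that] assms(11) by (simp add: sp_noise)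
    then show "integrable M (\<lambda>\<omega>. \<bar>Lr (W \<omega>)\<bar> ^ k)"
      using moments_Lr[OF \<open>2 \<le> k\<close>] by (simp cong: Bochner_Integration.integrable_cong)
  qed
  have am_r: "all_moments \<psi> (r z0)"
    by (rule sp.all_moments_noise[OF r_meas[OF \<open>z0 \<in> ?Z\<close>] moments_r])
  \<comment> \<open>The Hoelder modulus of the reward after lowering the exponent from
    \<open>\<alpha>r\<close> to \<alpha> on a set of diameter at most \<open>D\<close>.\<close>
  define L where "L \<alpha> w = D powr (\<alpha>r - \<alpha>) * Lr w" for \<alpha> w
  have am_L: "all_moments \<psi> (L \<alpha>)" for \<alpha>
    unfolding L_def[abs_def] by (rule psi.all_moments_cmult[OF am_Lr])
  have r_int: "integrable \<psi> (r z)" if z: "z \<in> ?Z" for z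
  proof (rule Bochner_Integration.integrable_bound[OF _ r_meas[OF z]])
    show "integrable \<psi> (\<lambda>w. \<bar>r z0 w\<bar> + norm (z - z0) powr \<alpha>r * Lr w)"
      using all_moments_integrable[OF am_r] all_moments_integrable[OF am_Lr] by auto
    show "AE w in \<psi>. norm (r z w) \<le> norm (\<bar>r z0 w\<bar> + norm (z - z0) powr \<alpha>r * Lr w)"
    proof (rule AE_I2)
      fix w assume "w \<in> space \<psi>"
      then show "norm (r z w) \<le> norm (\<bar>r z0 w\<bar> + norm (z - z0) powr \<alpha>r * Lr w)"
        using holder_r[OF z \<open>z0 \<in> ?Z\<close>, of w] by (simp add: sp_noise mult.commute)
    qed
  qed
  have mdp: "noisy_mdp \<psi> XX AA f r \<gamma> \<alpha> \<l>f (L \<alpha>)" if \<alpha>: "\<alpha> \<in> {0<..\<alpha>r}" "\<gamma> * \<l>f powr \<alpha> < 1" for \<alpha>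
  proof
    fix z z' w assume z: "z \<in> ?Z" "z' \<in> ?Z" and w: "w \<in> space \<psi>"
    have "Lr w * norm (z - z') powr \<alpha>r \<le> Lr w * (D powr (\<alpha>r - \<alpha>) * norm (z - z') powr \<alpha>)"
      using assms(11)[of w] w D(2)[OF z] \<alpha> by (intro mult_left_mono powr_le_mult_powr) (auto simp: sp_noise)
    with holder_r[OF z, of w] w show "\<bar>r z w - r z' w\<bar> \<le> L \<alpha> w * norm (z - z') powr \<alpha>"
      by (simp add: L_def sp_noise mult_ac)
  qed (use \<alpha> assms(11) compact_XX XX_nonempty cp.AA_compact cp.AA_nonempty cp.discount f_meas r_int
      all_moments_integrable[OF am_L] lipschitz_f \<open>\<l>f \<ge> 0\<close> joint_f joint_r in \<open>auto simp: L_def sp_noise\<close>)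
  have noise_in: "(\<lambda>i. S U i \<omega>) \<in> space (iid \<psi>)" if "\<omega> \<in> space M" for U \<omega>
    using measurable_space[OF sp.noise_measurable that] .
  have holder: "holder_on \<alpha> ?Z (?Q) \<and>
      (\<forall>n\<ge>1. \<forall>\<omega>\<in>space M. holder_on \<alpha> ?Z (?Qn n \<omega>))"
    and emp_cont: "\<forall>n\<ge>1. \<forall>\<omega>\<in>space M. continuous_on ?Z (?Qn n \<omega>)"
    if \<alpha>: "\<alpha> \<in> {0<..\<alpha>r}" "\<gamma> * \<l>f powr \<alpha> < 1" for \<alpha>
  proof -
    interpret m: noisy_mdp \<psi> XX AA f r \<gamma> \<alpha> \<l>f "L \<alpha>" by (rule mdp[OF \<alpha>])
    have "holder_bound \<alpha> m.hconst ?Z (?Q)"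
      using m.holder_qval_val m.opt_q_eq_qval by (simp add: holder_bound_def)
    moreover have "\<exists>c. holder_bound \<alpha> c ?Z (?Qn n \<omega>)"
      if "1 \<le> n" "\<omega> \<in> space M" for n \<omega>
      using m.holder_emp_mean[OF that(1) noise_in[OF that(2)] m.holder_Vn[OF that(1) noise_in[OF that(2)]]
          m.emp_hconst_nonneg[OF that(1) noise_in[OF that(2)]], of QSample VSample]
      unfolding emp_q_def[abs_def] by blast
    ultimately show "holder_on \<alpha> ?Z (?Q) \<and>
        (\<forall>n\<ge>1. \<forall>\<omega>\<in>space M. holder_on \<alpha> ?Z (?Qn n \<omega>))"
      "\<forall>n\<ge>1. \<forall>\<omega>\<in>space M. continuous_on ?Z (?Qn n \<omega>)"
      using m.exponent by (blast intro: holder_bound_imp_holder_on holder_bound_imp_continuous_on)+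
  qed
  have ex_\<alpha>: "\<exists>\<alpha>\<in>{0<..\<alpha>r}. \<gamma> * \<l>f powr \<alpha> < 1"
    by (rule ex_contracting_exponent) (use cp.discount \<open>\<l>f \<ge> 0\<close> \<open>\<alpha>r \<in> {0<..1}\<close> in auto)
  have section_cont: "continuous_on AA (\<lambda>a. g (x, a))" if "continuous_on ?Z g" "x \<in> XX" for g :: "_ \<Rightarrow> real" and x
    by (rule continuous_on_compose2[OF that(1)]) (use that(2) in \<open>auto intro!: continuous_intros\<close>)
  have regularity: "bounded (mean_reward r \<psi> ` ?Z)"
      "mean_reward r \<psi> \<in> borel_measurable (borel_on ?Z)"
      "bounded (?V ` XX)"
      "?V \<in> borel_measurable (borel_on XX)"
      "bounded (?Q ` ?Z)"
      "?Q \<in> borel_measurable (borel_on ?Z)"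
    and maximizer: "\<forall>x\<in>XX. continuous_on AA (\<lambda>a. ?Q (x, a)) \<and>
       (\<exists>a\<in>AA. ?V x = ?Q (x, a) \<and>
         (\<forall>b\<in>AA. ?Q (x, b) \<le> ?Q (x, a)))"
  proof -
    obtain \<alpha> where \<alpha>: "\<alpha> \<in> {0<..\<alpha>r}" "\<gamma> * \<l>f powr \<alpha> < 1" using ex_\<alpha> by blast
    interpret m: noisy_mdp \<psi> XX AA f r \<gamma> \<alpha> \<l>f "L \<alpha>" by (rule mdp[OF \<alpha>])
    \<comment> \<open>The mean reward is the Q-value of the zero function, so its continuity is a
      special case.\<close>
    have "holder_bound \<alpha> 0 XX (\<lambda>_. 0)" by (simp add: holder_bound_def)
    from m.holder_qval[OF this order_refl] have "continuous_on ?Z (m.qval (\<lambda>_. 0))"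
      by (rule holder_bound_imp_continuous_on[OF _ m.exponent])
    then have cr: "continuous_on ?Z (mean_reward r \<psi>)"
      unfolding m.qval_def[abs_def] mean_reward_def[abs_def] by simp
    show "bounded (mean_reward r \<psi> ` ?Z)"
      by (rule compact_imp_bounded[OF compact_continuous_image[OF cr compact_Z]])
    show "mean_reward r \<psi> \<in> borel_measurable (borel_on ?Z)"
      by (rule borel_measurable_continuous_on_restrict[OF cr])
    have cv: "continuous_on XX (?V)"
      using m.val_continuous by (simp add: m.opt_value_eq_val cong: continuous_on_cong)
    show "bounded (?V ` XX)"
      by (rule compact_imp_bounded[OF compact_continuous_image[OF cv compact_XX]])
    show "?V \<in> borel_measurable (borel_on XX)"
      by (rule borel_measurable_continuous_on_restrict[OF cv])
    have cq: "continuous_on ?Z (?Q)"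
      using m.qval_val_continuous by (simp add: m.opt_q_eq_qval cong: continuous_on_cong)
    show "bounded (?Q ` ?Z)"
      by (rule compact_imp_bounded[OF compact_continuous_image[OF cq compact_Z]])
    show "?Q \<in> borel_measurable (borel_on ?Z)"
      by (rule borel_measurable_continuous_on_restrict[OF cq])
    show "\<forall>x\<in>XX. continuous_on AA (\<lambda>a. ?Q (x, a)) \<and>
       (\<exists>a\<in>AA. ?V x = ?Q (x, a) \<and>
         (\<forall>b\<in>AA. ?Q (x, b) \<le> ?Q (x, a)))"
    proof (intro ballI conjI section_cont[OF cq])
      fix x assume x: "x \<in> XX"
      obtain a where a: "a \<in> AA" "\<And>b. b \<in> AA \<Longrightarrow> ?Q (x, b) \<le> ?Q (x, a)"
        using continuous_attains_sup[OF cp.AA_compact cp.AA_nonempty section_cont[OF cq x]] by blast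
      have "?V x = (SUP b\<in>AA. ?Q (x, b))"
        using x by (simp add: m.opt_value_eq_val m.val_fixed[OF x] m.opt_q_eq_qval cong: SUP_cong)
      also have "\<dots> = ?Q (x, a)"
        by (rule cSup_eq_maximum) (use a in auto)
      finally show "\<exists>a\<in>AA. ?V x = ?Q (x, a) \<and>
         (\<forall>b\<in>AA. ?Q (x, b) \<le> ?Q (x, a))"
        using a by blast
    qed
  qed
  have emp_regularity: "\<forall>n\<ge>1. AE \<omega> in M.
       ?Qn n \<omega> \<in> borel_measurable (borel_on ?Z) \<and>
       (\<forall>x\<in>XX. continuous_on AA (\<lambda>a. ?Qn n \<omega> (x, a)))"
  \<comment> \<open>The regularity holds at every sample point, not merely almost surely.\<close>
  proof (intro allI impI AE_I2 conjI ballI)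
    fix n \<omega> assume "1 \<le> (n :: nat)" "\<omega> \<in> space M"
    with ex_\<alpha> emp_cont have c: "continuous_on ?Z (?Qn n \<omega>)" by blast
    show "?Qn n \<omega> \<in> borel_measurable (borel_on ?Z)"
      by (rule borel_measurable_continuous_on_restrict[OF c])
    show "continuous_on AA (\<lambda>a. ?Qn n \<omega> (x, a))" if "x \<in> XX" for x
      by (rule section_cont[OF c that])
  qed
  have rates: "\<exists>(\<delta> :: nat \<Rightarrow> 'o \<Rightarrow> real) (\<Lambda> :: nat \<Rightarrow> 'o \<Rightarrow> real) (C\<delta> :: real) (C\<Lambda> :: nat \<Rightarrow> real).
         (\<forall>n\<ge>1. \<delta> n \<in> borel_measurable M \<and> \<Lambda> n \<in> borel_measurable M \<and>
           (\<forall>\<omega>\<in>space M. \<delta> n \<omega> > 0 \<and> \<Lambda> n \<omega> > 0)) \<and>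
         (\<forall>n\<ge>1. AE \<omega> in M.
           (SUP z\<in>?Z. ereal \<bar>?Qn n \<omega> z - ?Q z\<bar>)
             \<le> ereal (\<delta> n \<omega>) \<and>
           (SUP x\<in>XX. SUP (a, b)\<in>{(a, b). a \<in> AA \<and> b \<in> AA \<and> a \<noteq> b}.
               ereal (\<bar>(?Qn n \<omega> (x, a) - ?Q (x, a))
                      - (?Qn n \<omega> (x, b) - ?Q (x, b))\<bar>
                 / norm (a - b) powr q))
             \<le> ereal (\<Lambda> n \<omega>)) \<and>
         (\<forall>n\<ge>1. integrable M (\<lambda>\<omega>. \<delta> n \<omega> ^ 2) \<and>
           (\<integral>\<omega>. \<delta> n \<omega> ^ 2 \<partial>M) \<le> C\<delta> / real n) \<and>
         (\<forall>n\<ge>1. \<forall>k\<ge>2. integrable M (\<lambda>\<omega>. \<Lambda> n \<omega> ^ k) \<and>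
           (\<integral>\<omega>. \<Lambda> n \<omega> ^ k \<partial>M) \<le> C\<Lambda> k * real n powr (- real k / 2))"
    if q: "q \<in> {0..qbar}" "q < Sup {\<alpha> \<in> {0..\<alpha>r}. \<gamma> * \<l>f powr \<alpha> < 1}" for q
  proof -
    have "{\<alpha> \<in> {0..\<alpha>r}. \<gamma> * \<l>f powr \<alpha> < 1} \<noteq> {}" using ex_\<alpha> by force
    moreover have "bdd_above {\<alpha> \<in> {0..\<alpha>r}. \<gamma> * \<l>f powr \<alpha> < 1}" by (rule bdd_aboveI[of _ \<alpha>r]) auto
    ultimately obtain \<alpha> where "\<alpha> \<in> {0..\<alpha>r}" "\<gamma> * \<l>f powr \<alpha> < 1" "q < \<alpha>"
      using q(2) by (auto simp: less_cSup_iff)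
    then have \<alpha>: "\<alpha> \<in> {0<..\<alpha>r}" "\<gamma> * \<l>f powr \<alpha> < 1" "q < \<alpha>" using q(1) by auto
    \<comment> \<open>Chaining needs an exponent strictly between 0 and \<alpha>, but
      \<open>q\<close> may be 0; the excess \<open>p - q\<close> is given back as a power of the
      diameter.\<close>
    define p where "p = (q + \<alpha>) / 2"
    have p: "0 < p" "p < \<alpha>" "q \<le> p" using \<alpha> q(1) by (auto simp: p_def)
    have "?Z \<noteq> {}" using \<open>z0 \<in> ?Z\<close> by auto
    then obtain J C B where ch: "chaining ?Z p \<alpha> J C B" using ex_chaining[OF bounded_Z _ p(1,2)] by blast
    interpret m: noisy_mdp \<psi> XX AA f r \<gamma> \<alpha> \<l>f "L \<alpha>" by (rule mdp[OF \<alpha>(1,2)])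
    interpret ch: chaining ?Z p \<alpha> J C B by fact
    interpret c: chained_mdp \<psi> XX AA f r \<gamma> \<alpha> \<l>f "L \<alpha>" p J C B z0 D
      by unfold_locales (use \<open>z0 \<in> ?Z\<close> am_L am_r p D in auto)
    let ?s = "\<lambda>\<omega>. fst (sp.noise_pair \<omega>)" and ?t = "\<lambda>\<omega>. snd (sp.noise_pair \<omega>)"
    \<comment> \<open>Deviation of the Q-sample, plus error of the estimated value function
      propagated by the contraction, plus a term for strict positivity.\<close>
    define \<delta> where "\<delta> n \<omega> = c.dev_bound n (?t \<omega>) + \<gamma> / (1 - \<gamma>) * c.dev_bound n (?s \<omega>) + 1 / sqrt (real n)" for n \<omega>
    \<comment> \<open>The chaining term has exponent \<open>p\<close> and the total variation term
      exponent \<open>qbar\<close>; the powers of \<open>D\<close> lower both to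
      \<open>q\<close>.\<close>
    define \<Lambda> where "\<Lambda> n \<omega> = C * D powr (p - q) * c.osc_bound n (sp.noise_pair \<omega>)
        + 2 * \<gamma> / (1 - \<gamma>) * \<l>P * D powr (qbar - q) * c.dev_bound n (?s \<omega>) + 1 / sqrt (real n)" for n \<omega>
    have noise_s: "?s \<in> M \<rightarrow>\<^sub>M iid \<psi>" and noise_t: "?t \<in> M \<rightarrow>\<^sub>M iid \<psi>"
      using sp.noise_measurable by (simp_all add: sp.noise_pair_def)
    note rate_s = root_rate_distr[OF c.root_rate_dev_bound noise_s sp.distr_fst_noise_pair]
    note rate_t = root_rate_distr[OF c.root_rate_dev_bound noise_t sp.distr_snd_noise_pair]
    note rate_osc = root_rate_distr[OF c.root_rate_osc_bound sp.noise_pair_measurable sp.distr_noise_pair]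
    note rate_1 = root_rate_inverse_sqrt[OF sp.prob_space_axioms]
    have k\<delta>: "0 \<le> \<gamma> / (1 - \<gamma>)" and k\<Lambda>: "0 \<le> C * D powr (p - q)"
        "0 \<le> 2 * \<gamma> / (1 - \<gamma>) * \<l>P * D powr (qbar - q)"
      using cp.discount ch.C_nonneg \<open>\<l>P \<ge> 0\<close> by auto
    have rate_\<delta>: "root_rate M \<delta>"
      unfolding \<delta>_def[abs_def] by (intro root_rate_add root_rate_cmult rate_s rate_t rate_1 k\<delta>)
    have rate_\<Lambda>: "root_rate M \<Lambda>"
      unfolding \<Lambda>_def[abs_def] by (intro root_rate_add root_rate_cmult rate_s rate_osc rate_1 k\<Lambda>)
    have pos: "\<delta> n \<omega> > 0" "\<Lambda> n \<omega> > 0" if n: "1 \<le> n" and \<omega>: "\<omega> \<in> space M" for n \<omega>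
    proof -
      have "0 < 1 / sqrt (real n)" using n by simp
      then show "\<delta> n \<omega> > 0" "\<Lambda> n \<omega> > 0"
        unfolding \<delta>_def \<Lambda>_def
        by (intro add_nonneg_pos add_nonneg_nonneg mult_nonneg_nonneg[OF k\<delta>] mult_nonneg_nonneg[OF k\<Lambda>(1)]
            mult_nonneg_nonneg[OF k\<Lambda>(2)] root_rate_nonneg[OF rate_s n \<omega>]
            root_rate_nonneg[OF rate_t n \<omega>] root_rate_nonneg[OF rate_osc n \<omega>]; assumption)+
    qed
    have emp_q_eq: "?Qn n \<omega> z = emp_mean n (?t \<omega>) (c.integrand (m.Vn n (?s \<omega>)) z)" for n \<omega> z
      unfolding emp_q_def sp.noise_pair_def c.integrand_def[abs_def] by simp
    have err: "\<bar>?Qn n \<omega> z - ?Q z\<bar> \<le> \<delta> n \<omega>"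
      if n: "1 \<le> n" and \<omega>: "\<omega> \<in> space M" and z: "z \<in> ?Z" for n \<omega> z
    proof -
      have "0 \<le> 1 / sqrt (real n)" by simp
      with c.emp_q_error_le[OF n measurable_space[OF noise_s \<omega>] measurable_space[OF noise_t \<omega>] z]
      show ?thesis unfolding emp_q_eq m.opt_q_eq_qval[OF z] \<delta>_def by linarith
    qed
    have osc: "\<bar>(?Qn n \<omega> (x, a) - ?Q (x, a))
        - (?Qn n \<omega> (x, b) - ?Q (x, b))\<bar> / norm (a - b) powr q \<le> \<Lambda> n \<omega>"
      if n: "1 \<le> n" and \<omega>: "\<omega> \<in> space M" and x: "x \<in> XX" and ab: "a \<in> AA" "b \<in> AA" "a \<noteq> b" for n \<omega> x a b
    proof -
      let ?n = "norm (a - b)"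
      have z: "(x, a) \<in> ?Z" "(x, b) \<in> ?Z" using x ab by auto
      have n_le: "0 \<le> ?n" "?n \<le> D" using D(2)[OF z] by (auto simp: norm_Pair)
      let ?E = "c.osc_bound n (sp.noise_pair \<omega>)" and ?d = "c.dev_bound n (?s \<omega>)"
      have nn: "0 \<le> ?E" "0 \<le> ?d" using root_rate_nonneg[OF rate_osc n \<omega>] root_rate_nonneg[OF rate_s n \<omega>] by auto
      have "\<bar>(?Qn n \<omega> (x, a) - ?Q (x, a))
          - (?Qn n \<omega> (x, b) - ?Q (x, b))\<bar>
          \<le> C * ?E * ?n powr p + 2 * \<gamma> / (1 - \<gamma>) * ?d * (\<l>P * ?n powr qbar)"
        using c.emp_q_increment_le[OF n measurable_space[OF noise_s \<omega>] measurable_space[OF noise_t \<omega>] x ab(1,2)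
            tv[OF x ab(1,2)]]
        unfolding emp_q_eq m.opt_q_eq_qval[OF z(1)] m.opt_q_eq_qval[OF z(2)] by simp
      also have "\<dots> \<le> C * ?E * (D powr (p - q) * ?n powr q)
          + 2 * \<gamma> / (1 - \<gamma>) * ?d * (\<l>P * (D powr (qbar - q) * ?n powr q))"
        using nn ch.C_nonneg cp.discount \<open>\<l>P \<ge> 0\<close> p q(1) n_le
        by (intro add_mono mult_left_mono powr_le_mult_powr mult_nonneg_nonneg) auto
      also have "\<dots> = (C * D powr (p - q) * ?E + 2 * \<gamma> / (1 - \<gamma>) * \<l>P * D powr (qbar - q) * ?d) * ?n powr q"
        by (simp add: algebra_simps)
      also have "\<dots> \<le> \<Lambda> n \<omega> * ?n powr q"
        unfolding \<Lambda>_def by (intro mult_right_mono) auto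
      finally show ?thesis using ab(3) by (simp add: divide_le_eq)
    qed
    obtain C\<delta> where C\<delta>: "\<And>n. 1 \<le> n \<Longrightarrow> integrable M (\<lambda>\<omega>. \<delta> n \<omega> ^ 2) \<and>
        (\<integral>\<omega>. \<delta> n \<omega> ^ 2 \<partial>M) \<le> C\<delta> * real n powr (- real 2 / 2)"
      using root_rate_moments[OF rate_\<delta>, of 2] by blast
    obtain C\<Lambda> where C\<Lambda>: "\<And>n k. 1 \<le> n \<Longrightarrow> integrable M (\<lambda>\<omega>. \<Lambda> n \<omega> ^ k) \<and>
        (\<integral>\<omega>. \<Lambda> n \<omega> ^ k \<partial>M) \<le> C\<Lambda> k * real n powr (- real k / 2)"
      using root_rate_moments[OF rate_\<Lambda>] by metis
    show ?thesis
    proof (rule exI[of _ \<delta>], rule exI[of _ \<Lambda>], rule exI[of _ C\<delta>], rule exI[of _ C\<Lambda>],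
        intro conjI allI impI ballI AE_I2 SUP_least)
      fix n :: nat assume n: "1 \<le> n"
      show "\<delta> n \<in> borel_measurable M" "\<Lambda> n \<in> borel_measurable M"
        by (rule root_rate_measurable[OF rate_\<delta> n], rule root_rate_measurable[OF rate_\<Lambda> n])
      show "\<delta> n \<omega> > 0" "\<Lambda> n \<omega> > 0" if "\<omega> \<in> space M" for \<omega>
        using pos[OF n that] by auto
      show "integrable M (\<lambda>\<omega>. \<delta> n \<omega> ^ 2)" using C\<delta>[OF n] by blast
      show "(\<integral>\<omega>. \<delta> n \<omega> ^ 2 \<partial>M) \<le> C\<delta> / real n"
        using C\<delta>[OF n] n by (simp add: powr_minus_divide)
      show "integrable M (\<lambda>\<omega>. \<Lambda> n \<omega> ^ k)"
        "(\<integral>\<omega>. \<Lambda> n \<omega> ^ k \<partial>M) \<le> C\<Lambda> k * real n powr (- real k / 2)" for k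
        using C\<Lambda>[OF n] by auto
      show "ereal \<bar>?Qn n \<omega> z - ?Q z\<bar> \<le> ereal (\<delta> n \<omega>)" if "\<omega> \<in> space M" "z \<in> ?Z" for \<omega> z
        using err[OF n that] by simp
      show "(case ab of (a, b) \<Rightarrow> ereal (\<bar>(?Qn n \<omega> (x, a) - ?Q (x, a)) - (?Qn n \<omega> (x, b) - ?Q (x, b))\<bar>
          / norm (a - b) powr q)) \<le> ereal (\<Lambda> n \<omega>)"
        if "\<omega> \<in> space M" "x \<in> XX" "ab \<in> {(a, b). a \<in> AA \<and> b \<in> AA \<and> a \<noteq> b}" for \<omega> x ab
        using osc[OF n that(1,2)] that(3) by (cases ab) simp
    qed
  qed
  show ?thesis
    using holder rates by (intro conjI regularity maximizer emp_regularity) blast+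
qed

end
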